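(* For every uniformly absorbing atomless MDP with bounded measurable reward vector-function with values in $\mathbb R^N$, the set $\mathcal V^{\mathbb F}\subset\mathbb R^N$ of performance vectors of all deterministic policies is convex.
   Context: A standard Borel space is a measurable space isomorphic to a Borel subset of a Polish space. An MDP consists of: a standard Borel state space $\bar{\mathbb X}$; a standard Borel action space $(\mathbb A,\mathcal A)$; nonempty sets $A(x)\in\mathcal A$ of available actions, $x\in\bar{\mathbb X}$, such that $\{(x,a):x\in\bar{\mathbb X},a\in A(x)\}$ is measurable; a transition probability $p$ from $\bar{\mathbb X}\times\mathbb A$ to $\bar{\mathbb X}$; a fixed initial probability distribution $\mu$ on $\bar{\mathbb X}$; a bounded measurable reward vector-function $r:\bar{\mathbb X}\times\mathbb A\to\mathbb R^N$, $N\ge1$. It is always assumed that there is at least one selector, i.e. a measurable map $\phi$ from the state space to $\mathbb A$ with $\phi(x)\in A(x)$ for all $x$. A policy $\pi$ is a sequence of transition probabilities $\pi_t$, $t=0,1,\ldots$, from the set of histories $h_t=(x_0,a_0,x_1,\ldots,x_t)$ to $\mathbb A$ with $\pi_t(A(x_t)|h_t)=1$; $\Pi$ is the set of all policies. A policy is nonrandomized if every $\pi_t(\cdot|h_t)$ is concentrated at one point, Markov if each $\pi_t(\cdot|h_t)$ depends only on $x_t$, and stationary if it is Markov and $\pi_t(\cdot|x)$ does not depend on $t$. $\mathbb M$ is the set of nonrandomized Markov policies and $\mathbb F$ is the set of deterministic (nonrandomized stationary) policies, identified with selectors. $P^\pi,E^\pi$ are the probability and expectation on trajectories determined by $\mu,\pi,p$.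 For a state $x$ let $T^{x}=\inf\{t=0,1,\ldots: x_t=x\}$. The MDP is absorbing if there is a state $\bar x\in\bar{\mathbb X}$ (fixed) such that: (i) $\mu(\{\bar x\})=0$; (ii) $A(\bar x)=\{\bar a\}$ for some $\bar a\in\mathbb A$, $p(\{\bar x\}|\bar x,\bar a)=1$, $r(\bar x,\bar a)=0$; (iii) there is a finite constant $L$ with $E^\pi T^{\bar x}\le L$ for all $\pi\in\Pi$. Put $\mathbb X=\bar{\mathbb X}\setminus\{\bar x\}$. An absorbing MDP is uniformly absorbing if $\lim_{n\to\infty}\sup_{\pi\in\mathbb M}E^\pi\sum_{t=n}^\infty I\{t<T^{\bar x}\}=0$. An absorbing MDP is atomless if $\mu(\{x\})=0$ and $p(\{y\}|x,a)=0$ for all $x,y\in\mathbb X$ and $a\in A(x)$. The performance vector of $\pi$ is $v^\pi=E^\pi\sum_{t=0}^{T^{\bar x}-1}r(x_t,a_t)=E^\pi\sum_{t=0}^\infty r(x_t,a_t)\in\mathbb R^N$, and $\mathcal V^{\mathbb F}=\{v^\phi:\phi\in\mathbb F\}$. *)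

theory Defs
  imports "HOL-Probability.Probability"
begin

section \<open>Standard Borel spaces\<close>

definition borel_of :: "'a topology \<Rightarrow> 'a measure" where
  "borel_of X = sigma (topspace X) {U. openin X U}"

text \<open>As in the class \<^class>\<open>polish_space\<close>, separability is expressed by second countability,
  which is equivalent for metrizable spaces.\<close>

definition Polish_topology :: "'a topology \<Rightarrow> bool" where
  "Polish_topology X \<longleftrightarrow> completely_metrizable_space X \<and> second_countable X"

definition isomorphic_measurable_spaces :: "'a measure \<Rightarrow> 'b measure \<Rightarrow> bool" where
  "isomorphic_measurable_spaces M N \<longleftrightarrow>
     (\<exists>f \<in> M \<rightarrow>\<^sub>M N. \<exists>g \<in> N \<rightarrow>\<^sub>M M.
        (\<forall>x\<in>space M. g (f x) = x) \<and> (\<forall>y\<in>space N. f (g y) = y))"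

text \<open>A definition cannot quantify over the type carrying the Polish space. The carrier is
  taken to be an arbitrary set of reals (with an arbitrary Polish topology), which loses no
  generality since a Polish space has at most continuum many points; see \<open>standard_borelI\<close>
  below.\<close>

definition standard_borel :: "'a measure \<Rightarrow> bool" where
  "standard_borel M \<longleftrightarrow>
     (\<exists>(X :: real topology) B. Polish_topology X \<and> B \<in> sets (borel_of X) \<and>
        isomorphic_measurable_spaces M (restrict_space (borel_of X) B))"

lemma space_borel_of [simp]: "space (borel_of X) = topspace X"
  unfolding borel_of_def by (simp add: space_measure_of_conv)

lemma sets_borel_of: "sets (borel_of X) = sigma_sets (topspace X) {U. openin X U}"
  unfolding borel_of_def by (rule sets_measure_of) (auto dest: openin_subset)

lemma openin_in_borel_of: "openin X U \<Longrightarrow> U \<in> sets (borel_of X)"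
  by (auto simp: sets_borel_of)

lemma closedin_in_borel_of:
  assumes "closedin X C" shows "C \<in> sets (borel_of X)"
proof -
  have "topspace X - (topspace X - C) \<in> sets (borel_of X)"
    using assms openin_in_borel_of[of X "topspace X - C"] sets.compl_sets[of _ "borel_of X"]
    by (force simp: closedin_def)
  moreover have "topspace X - (topspace X - C) = C"
    using closedin_subset[OF assms] by auto
  ultimately show ?thesis by simp
qed

lemma continuous_map_measurable_borel_of:
  assumes "continuous_map X Y f" shows "f \<in> borel_of X \<rightarrow>\<^sub>M borel_of Y"
  unfolding borel_of_def[of Y]
proof (rule measurable_measure_of)
  show "f \<in> space (borel_of X) \<rightarrow> topspace Y"
    using continuous_map_image_subset_topspace[OF assms] by auto
  show "f -` U \<inter> space (borel_of X) \<in> sets (borel_of X)" if "U \<in> {U. openin Y U}" for U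
  proof -
    have "f -` U \<inter> space (borel_of X) = {x \<in> topspace X. f x \<in> U}" by auto
    then show ?thesis
      using that assms openin_continuous_map_preimage[of X Y f U]
      by (auto intro!: openin_in_borel_of)
  qed
qed (auto dest: openin_subset)

lemma Polish_topology_homeomorphic:
  assumes "X homeomorphic_space Y" "Polish_topology X" shows "Polish_topology Y"
  using assms homeomorphic_completely_metrizable_space[OF assms(1)]
    homeomorphic_space_second_countability[OF assms(1)]
  by (simp add: Polish_topology_def)

lemma Polish_inj_real:
  fixes X :: "'p topology"
  assumes "Polish_topology X"
  obtains e :: "'p \<Rightarrow> real" where "inj_on e (topspace X)"
proof -
  have met: "metrizable_space X" and "second_countable X"
    using assms completely_metrizable_imp_metrizable_space by (auto simp: Polish_topology_def)
  then obtain \<B> where \<B>: "countable \<B>" "\<And>U x. openin X U \<and> x \<in> U \<Longrightarrow> \<exists>V\<in>\<B>. x \<in> V \<and> V \<subseteq> U"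
    unfolding second_countable_def by metis
  have t0: "t1_space X"
    using met metrizable_imp_Hausdorff_space Hausdorff_imp_t1_space by blast
  obtain h :: "nat set \<Rightarrow> real" where h: "inj h"
    using nat_sets_eqpoll_reals unfolding eqpoll_def bij_betw_def by blast
  define e where "e x = h (to_nat_on \<B> ` {V\<in>\<B>. x \<in> V})" for x
  have "x = y" if xy: "x \<in> topspace X" "y \<in> topspace X" "e x = e y" for x y
  proof (rule ccontr)
    assume "x \<noteq> y"
    then obtain U where U: "openin X U" "x \<in> U" "y \<notin> U"
      using t0 xy unfolding t1_space_def by metis
    then obtain V where V: "V \<in> \<B>" "x \<in> V" "V \<subseteq> U" using \<B>(2)[of U x] by auto
    have "to_nat_on \<B> ` {V\<in>\<B>. x \<in> V} = to_nat_on \<B> ` {V\<in>\<B>. y \<in> V}"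
      using injD[OF h xy(3)[unfolded e_def]] .
    moreover have "to_nat_on \<B> V \<in> to_nat_on \<B> ` {V\<in>\<B>. x \<in> V}" using V by auto
    ultimately have "to_nat_on \<B> V \<in> to_nat_on \<B> ` {V\<in>\<B>. y \<in> V}" by (simp only:)
    then obtain W where "W \<in> \<B>" "y \<in> W" "to_nat_on \<B> V = to_nat_on \<B> W"
      unfolding image_iff by blast
    then have "y \<in> V" using \<B>(1) V(1) by (metis inj_on_to_nat_on inj_onD)
    then show False using U V by auto
  qed
  then show ?thesis using that[of e] by (auto intro: inj_onI)
qed

lemma Polish_homeomorphic_real:
  fixes X :: "'p topology"
  assumes "Polish_topology X"
  obtains Y :: "real topology" where "X homeomorphic_space Y"
proof -
  obtain e :: "'p \<Rightarrow> real" where e: "inj_on e (topspace X)" using Polish_inj_real[OF assms] .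
  define g where "g = the_inv_into (topspace X) e"
  have ge: "g (e x) = x" if "x \<in> topspace X" for x
    using the_inv_into_f_f[OF e that] by (simp add: g_def)
  define Y where "Y = pullback_topology (e ` topspace X) g X"
  have tY: "topspace Y = e ` topspace X"
    unfolding Y_def topspace_pullback_topology using ge by auto
  have "homeomorphic_maps X Y e g"
    unfolding homeomorphic_maps_def
  proof (intro conjI)
    show "continuous_map X Y e"
      unfolding Y_def
    proof (rule continuous_map_pullback')
      show "continuous_map X X (g \<circ> e)"
        using continuous_map_eq[OF continuous_map_id, of X "g \<circ> e"] ge by simp
    qed auto
    show "continuous_map Y X g"
      unfolding Y_def using continuous_map_pullback[OF continuous_map_id, of "e ` topspace X" g X]
      by simp
  qed (auto simp: tY ge)
  then show ?thesis using that homeomorphic_space_def by blast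
qed

lemma isomorphic_measurable_spaces_trans:
  assumes "isomorphic_measurable_spaces M N" "isomorphic_measurable_spaces N K"
  shows "isomorphic_measurable_spaces M K"
proof -
  obtain f g where f: "f \<in> M \<rightarrow>\<^sub>M N" "g \<in> N \<rightarrow>\<^sub>M M"
    "\<forall>x\<in>space M. g (f x) = x" "\<forall>y\<in>space N. f (g y) = y"
    using assms(1) unfolding isomorphic_measurable_spaces_def by (elim bexE conjE) (rule that)
  obtain f' g' where f': "f' \<in> N \<rightarrow>\<^sub>M K" "g' \<in> K \<rightarrow>\<^sub>M N"
    "\<forall>x\<in>space N. g' (f' x) = x" "\<forall>y\<in>space K. f' (g' y) = y"
    using assms(2) unfolding isomorphic_measurable_spaces_def by (elim bexE conjE) (rule that)
  show ?thesis
    unfolding isomorphic_measurable_spaces_def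
  proof (intro bexI conjI ballI)
    show "f' \<circ> f \<in> M \<rightarrow>\<^sub>M K" "g \<circ> g' \<in> K \<rightarrow>\<^sub>M M"
      using f f' measurable_comp by blast+
    show "(g \<circ> g') ((f' \<circ> f) x) = x" if "x \<in> space M" for x
      using f(3) f'(3) measurable_space[OF f(1) that] that by simp
    show "(f' \<circ> f) ((g \<circ> g') y) = y" if "y \<in> space K" for y
      using f(4) f'(4) measurable_space[OF f'(2) that] that by simp
  qed
qed

lemma standard_borelI:
  fixes X :: "'p topology" and M :: "'a measure"
  assumes X: "Polish_topology X" and B: "B \<in> sets (borel_of X)"
    and M: "isomorphic_measurable_spaces M (restrict_space (borel_of X) B)"
  shows "standard_borel M"
proof -
  obtain Y :: "real topology" where Y: "X homeomorphic_space Y"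
    using Polish_homeomorphic_real[OF X] .
  then obtain f g where fg: "homeomorphic_maps X Y f g" unfolding homeomorphic_space_def by auto
  then have c: "continuous_map X Y f" "continuous_map Y X g"
    and inv: "\<And>x. x \<in> topspace X \<Longrightarrow> g (f x) = x" "\<And>y. y \<in> topspace Y \<Longrightarrow> f (g y) = y"
    by (auto simp: homeomorphic_maps_def)
  note [measurable] = c[THEN continuous_map_measurable_borel_of]
  have sB: "B \<subseteq> topspace X" using sets.sets_into_space[OF B] by simp
  define C where "C = g -` B \<inter> topspace Y"
  have C: "C \<in> sets (borel_of Y)"
    using measurable_sets[OF _ B, of g "borel_of Y"] by (simp add: C_def)
  have iso: "isomorphic_measurable_spaces (restrict_space (borel_of X) B) (restrict_space (borel_of Y) C)"
    unfolding isomorphic_measurable_spaces_def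
  proof (intro bexI conjI ballI)
    show "f \<in> restrict_space (borel_of X) B \<rightarrow>\<^sub>M restrict_space (borel_of Y) C"
      using sB inv continuous_map_image_subset_topspace[OF c(1)]
      by (intro measurable_restrict_space3) (auto 0 3 simp: C_def image_subset_iff subset_iff)
    show "g \<in> restrict_space (borel_of Y) C \<rightarrow>\<^sub>M restrict_space (borel_of X) B"
      by (intro measurable_restrict_space3) (auto simp: C_def)
  qed (use inv in \<open>auto simp: space_restrict_space\<close>)
  show ?thesis
    unfolding standard_borel_def
    using Polish_topology_homeomorphic[OF Y X] C isomorphic_measurable_spaces_trans[OF M iso] by blast
qed

lemma standard_borel_singleton:
  assumes "standard_borel M" "x \<in> space M" shows "{x} \<in> sets M"
proof -
  obtain X :: "real topology" and B f g where X: "Polish_topology X" and B: "B \<in> sets (borel_of X)"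
    and f: "f \<in> M \<rightarrow>\<^sub>M restrict_space (borel_of X) B"
    and gf: "\<forall>x\<in>space M. g (f x) = x"
    using assms(1) unfolding standard_borel_def isomorphic_measurable_spaces_def
    by (elim exE bexE conjE) (rule that)
  have fx: "f x \<in> topspace X" "f x \<in> B"
    using measurable_space[OF f assms(2)] by (auto simp: space_restrict_space)
  have "t1_space X"
    using X completely_metrizable_imp_metrizable_space metrizable_imp_Hausdorff_space
      Hausdorff_imp_t1_space by (auto simp: Polish_topology_def)
  then have "{f x} \<in> sets (borel_of X)"
    using fx by (intro closedin_in_borel_of) (simp add: closedin_t1_singleton)
  then have "{f x} \<in> sets (restrict_space (borel_of X) B)"
    using fx sets.Int[OF B sets.top] by (subst sets_restrict_space_iff) auto
  from measurable_sets[OF f this] have "f -` {f x} \<inter> space M \<in> sets M" .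
  moreover have "f -` {f x} \<inter> space M = {x}" using gf assms(2) by (auto) metis
  ultimately show ?thesis by simp
qed


section \<open>Markov decision processes\<close>

text \<open>Only \<open>space\<close> and \<open>sets\<close> of \<open>S\<close> (states) and \<open>A\<close> (actions) matter. A transition
  probability from \<open>M\<close> to \<open>N\<close> is an element of \<open>M \<rightarrow>\<^sub>M prob_algebra N\<close>.\<close>

locale MDP =
  fixes S :: "'x measure"
    and A :: "'a measure"
    and Av :: "'x \<Rightarrow> 'a set"
    and p :: "'x \<times> 'a \<Rightarrow> 'x measure"
    and \<mu> :: "'x measure"
    and r :: "'x \<times> 'a \<Rightarrow> real ^ 'n"
  assumes standard_borel_S: "standard_borel S"
    and standard_borel_A: "standard_borel A"
    and Av_sets: "x \<in> space S \<Longrightarrow> Av x \<in> sets A"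
    and Av_nonempty: "x \<in> space S \<Longrightarrow> Av x \<noteq> {}"
    and Av_graph: "{(x, a). x \<in> space S \<and> a \<in> Av x} \<in> sets (S \<Otimes>\<^sub>M A)"
    and transition: "p \<in> (S \<Otimes>\<^sub>M A) \<rightarrow>\<^sub>M prob_algebra S"
    and initial: "\<mu> \<in> space (prob_algebra S)"
    and reward_measurable: "r \<in> borel_measurable (S \<Otimes>\<^sub>M A)"
    and reward_bounded: "bounded (r ` space (S \<Otimes>\<^sub>M A))"
    and ex_selector: "\<exists>\<phi> \<in> S \<rightarrow>\<^sub>M A. \<forall>x\<in>space S. \<phi> x \<in> Av x"
begin

text \<open>A history \<open>(x\<^sub>0, a\<^sub>0, \<dots>, x\<^sub>t)\<close> is the pair \<open>(h, x\<^sub>t)\<close> with \<open>h i = (x\<^sub>i, a\<^sub>i)\<close> for \<open>i < t\<close>.\<close>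

definition hist :: "nat \<Rightarrow> ((nat \<Rightarrow> 'x \<times> 'a) \<times> 'x) measure" where
  "hist t = PiM {0..<t} (\<lambda>_. S \<Otimes>\<^sub>M A) \<Otimes>\<^sub>M S"

definition policies :: "(nat \<Rightarrow> (nat \<Rightarrow> 'x \<times> 'a) \<times> 'x \<Rightarrow> 'a measure) set" where
  "policies = {\<pi>. \<forall>t. \<pi> t \<in> hist t \<rightarrow>\<^sub>M prob_algebra A \<and>
                     (\<forall>(h, x) \<in> space (hist t). emeasure (\<pi> t (h, x)) (Av x) = 1)}"

definition nonrandomized :: "(nat \<Rightarrow> (nat \<Rightarrow> 'x \<times> 'a) \<times> 'x \<Rightarrow> 'a measure) \<Rightarrow> bool" where
  "nonrandomized \<pi> \<longleftrightarrow> (\<forall>t. \<forall>hx \<in> space (hist t). \<exists>a\<in>space A. emeasure (\<pi> t hx) {a} = 1)"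

definition Markov :: "(nat \<Rightarrow> (nat \<Rightarrow> 'x \<times> 'a) \<times> 'x \<Rightarrow> 'a measure) \<Rightarrow> bool" where
  "Markov \<pi> \<longleftrightarrow> (\<forall>t h h' x. (h, x) \<in> space (hist t) \<longrightarrow> (h', x) \<in> space (hist t) \<longrightarrow>
                   \<pi> t (h, x) = \<pi> t (h', x))"

definition stationary :: "(nat \<Rightarrow> (nat \<Rightarrow> 'x \<times> 'a) \<times> 'x \<Rightarrow> 'a measure) \<Rightarrow> bool" where
  "stationary \<pi> \<longleftrightarrow> Markov \<pi> \<and>
     (\<forall>s t h h' x. (h, x) \<in> space (hist s) \<longrightarrow> (h', x) \<in> space (hist t) \<longrightarrow>
        \<pi> s (h, x) = \<pi> t (h', x))"

definition nonrandomized_Markov_policies where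
  "nonrandomized_Markov_policies = {\<pi> \<in> policies. nonrandomized \<pi> \<and> Markov \<pi>}"

definition deterministic_policies where
  "deterministic_policies = {\<pi> \<in> policies. nonrandomized \<pi> \<and> stationary \<pi>}"

text \<open>\<open>step_kernel \<pi> t h\<close> is the conditional law of \<open>(x\<^sub>t, a\<^sub>t)\<close> given \<open>h i = (x\<^sub>i, a\<^sub>i)\<close>,
  \<open>i < t\<close>; \<open>P \<pi>\<close> is the Ionescu-Tulcea measure on trajectories \<open>\<omega> t = (x\<^sub>t, a\<^sub>t)\<close> generated
  by these kernels.\<close>

definition state_kernel :: "nat \<Rightarrow> (nat \<Rightarrow> 'x \<times> 'a) \<Rightarrow> 'x measure" where
  "state_kernel t h = (case t of 0 \<Rightarrow> \<mu> | Suc s \<Rightarrow> p (h s))"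

definition step_kernel ::
  "(nat \<Rightarrow> (nat \<Rightarrow> 'x \<times> 'a) \<times> 'x \<Rightarrow> 'a measure) \<Rightarrow> nat \<Rightarrow> (nat \<Rightarrow> 'x \<times> 'a) \<Rightarrow> ('x \<times> 'a) measure"
where
  "step_kernel \<pi> t h =
     state_kernel t h \<bind> (\<lambda>x. \<pi> t (h, x) \<bind> (\<lambda>a. return (S \<Otimes>\<^sub>M A) (x, a)))"

definition P :: "(nat \<Rightarrow> (nat \<Rightarrow> 'x \<times> 'a) \<times> 'x \<Rightarrow> 'a measure) \<Rightarrow> (nat \<Rightarrow> 'x \<times> 'a) measure" where
  "P \<pi> = projective_family.lim UNIV
            (Ionescu_Tulcea.CI (step_kernel \<pi>) (\<lambda>_. S \<Otimes>\<^sub>M A)) (\<lambda>_. S \<Otimes>\<^sub>M A)"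

definition hitting_time :: "'x \<Rightarrow> (nat \<Rightarrow> 'x \<times> 'a) \<Rightarrow> enat" where
  "hitting_time x \<omega> = Inf (enat ` {t. fst (\<omega> t) = x})"

lemma state_kernel_measurable [measurable]:
  "state_kernel t \<in> PiM {0..<t} (\<lambda>_. S \<Otimes>\<^sub>M A) \<rightarrow>\<^sub>M prob_algebra S"
proof (cases t)
  case 0
  then show ?thesis using initial by (simp add: state_kernel_def[abs_def])
next
  case (Suc s)
  then have "(\<lambda>h. h s) \<in> PiM {0..<t} (\<lambda>_. S \<Otimes>\<^sub>M A) \<rightarrow>\<^sub>M (S \<Otimes>\<^sub>M A)"
    by (intro measurable_component_singleton) simp
  from measurable_compose[OF this transition] show ?thesis
    using Suc by (simp add: state_kernel_def[abs_def])
qed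

lemma step_kernel_measurable:
  assumes "\<pi> \<in> policies"
  shows "step_kernel \<pi> t \<in> PiM {0..<t} (\<lambda>_. S \<Otimes>\<^sub>M A) \<rightarrow>\<^sub>M prob_algebra (S \<Otimes>\<^sub>M A)"
proof -
  have \<pi>: "\<pi> t \<in> PiM {0..<t} (\<lambda>_. S \<Otimes>\<^sub>M A) \<Otimes>\<^sub>M S \<rightarrow>\<^sub>M prob_algebra A"
    using assms by (auto simp: policies_def hist_def)
  show ?thesis
    unfolding step_kernel_def[abs_def]
  proof (rule measurable_bind_prob_space2[OF state_kernel_measurable], unfold split_def,
      rule measurable_bind_prob_space2[where N=A])
    let ?N = "(PiM {0..<t} (\<lambda>_. S \<Otimes>\<^sub>M A) \<Otimes>\<^sub>M S) \<Otimes>\<^sub>M A"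
    have "(\<lambda>z. (snd (fst z), snd z)) \<in> ?N \<rightarrow>\<^sub>M S \<Otimes>\<^sub>M A"
      by (intro measurable_Pair measurable_compose[OF measurable_fst measurable_snd] measurable_snd)
    from measurable_compose[OF this measurable_return_prob_space]
    show "(\<lambda>(y, a). return (S \<Otimes>\<^sub>M A) (snd y, a)) \<in> ?N \<rightarrow>\<^sub>M prob_algebra (S \<Otimes>\<^sub>M A)"
      by (simp add: split_def)
  qed (use \<pi> in simp)
qed

lemma Ionescu_Tulcea_step_kernel:
  assumes "\<pi> \<in> policies"
  shows "Ionescu_Tulcea (step_kernel \<pi>) (\<lambda>_. S \<Otimes>\<^sub>M A)"
proof (rule Ionescu_Tulcea.intro)
  fix i
  show "step_kernel \<pi> i \<in> PiM {0..<i} (\<lambda>_. S \<Otimes>\<^sub>M A) \<rightarrow>\<^sub>M subprob_algebra (S \<Otimes>\<^sub>M A)"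
    using step_kernel_measurable[OF assms] by (rule measurable_prob_algebraD)
next
  fix i :: nat and h assume "h \<in> space (PiM {0..<i} (\<lambda>_. S \<Otimes>\<^sub>M A))"
  from measurable_space[OF step_kernel_measurable[OF assms] this]
  show "prob_space (step_kernel \<pi> i h)" by (simp add: space_prob_algebra)
qed

text \<open>The identification of deterministic policies with selectors.\<close>

lemma deterministic_policies_iff_selector:
  "\<pi> \<in> deterministic_policies \<longleftrightarrow>
     (\<exists>\<phi> \<in> S \<rightarrow>\<^sub>M A. (\<forall>x\<in>space S. \<phi> x \<in> Av x) \<and>
        (\<forall>t. \<forall>(h, x) \<in> space (hist t). \<pi> t (h, x) = return A (\<phi> x)))"
proof
  assume det: "\<pi> \<in> deterministic_policies"
  then have pol: "\<And>t. \<pi> t \<in> hist t \<rightarrow>\<^sub>M prob_algebra A"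
    "\<And>t h x. (h, x) \<in> space (hist t) \<Longrightarrow> emeasure (\<pi> t (h, x)) (Av x) = 1"
    by (auto simp: deterministic_policies_def policies_def)
  have nr: "\<And>t hx. hx \<in> space (hist t) \<Longrightarrow> \<exists>a\<in>space A. emeasure (\<pi> t hx) {a} = 1"
    using det by (auto simp: deterministic_policies_def nonrandomized_def)
  have st: "\<pi> s (h, x) = \<pi> t (h', x)"
    if "(h, x) \<in> space (hist s)" "(h', x) \<in> space (hist t)" for s t h h' x
    using det that unfolding deterministic_policies_def stationary_def by blast
  define u :: "nat \<Rightarrow> 'x \<times> 'a" where "u = (\<lambda>_. undefined)"
  have u: "(u, x) \<in> space (hist 0)" if "x \<in> space S" for x
    using that by (simp add: hist_def space_pair_measure space_PiM u_def)
  obtain \<phi> where \<phi>: "\<And>x. x \<in> space S \<Longrightarrow> \<phi> x \<in> space A \<and> emeasure (\<pi> 0 (u, x)) {\<phi> x} = 1"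
    using nr[OF u] by metis
  have ret: "\<pi> 0 (u, x) = return A (\<phi> x)" if x: "x \<in> space S" for x
  proof -
    have \<nu>: "prob_space (\<pi> 0 (u, x))" "sets (\<pi> 0 (u, x)) = sets A"
      using measurable_space[OF pol(1) u[OF x]] by (auto simp: space_prob_algebra)
    interpret prob_space "\<pi> 0 (u, x)" by fact
    show ?thesis
    proof (rule measure_eqI)
      fix B assume B: "B \<in> sets (\<pi> 0 (u, x))"
      have sing: "{\<phi> x} \<in> sets (\<pi> 0 (u, x))" using \<phi>[OF x] emeasure_notin_sets by force
      show "emeasure (\<pi> 0 (u, x)) B = emeasure (return A (\<phi> x)) B"
      proof (cases "\<phi> x \<in> B")
        case True
        then have "emeasure (\<pi> 0 (u, x)) {\<phi> x} \<le> emeasure (\<pi> 0 (u, x)) B"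
          using B by (intro emeasure_mono) auto
        then have "emeasure (\<pi> 0 (u, x)) B = 1"
          using \<phi>[OF x] measure_le_1[of B] emeasure_le_1[of B] by (auto intro: antisym)
        then show ?thesis using True B \<nu> by simp
      next
        case False
        have "prob {\<phi> x} + prob B = prob ({\<phi> x} \<union> B)"
          using False B sing by (intro finite_measure_Union[symmetric]) auto
        also have "\<dots> \<le> 1" by simp
        finally have "prob B = 0"
          using \<phi>[OF x] measure_nonneg[of "\<pi> 0 (u, x)" B] by (simp add: emeasure_eq_measure antisym)
        then show ?thesis using False B \<nu> by (simp add: emeasure_eq_measure)
      qed
    qed (use \<nu> in simp)
  qed
  have "\<phi> \<in> S \<rightarrow>\<^sub>M A"
  proof (rule measurableI)
    fix B assume B: "B \<in> sets A"
    have pair: "(\<lambda>x. (u, x)) \<in> S \<rightarrow>\<^sub>M hist 0"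
      unfolding hist_def by (intro measurable_Pair1') (simp add: u_def space_PiM)
    have "(\<lambda>x. emeasure (\<pi> 0 (u, x)) B) \<in> borel_measurable S"
      by (rule measurable_compose[OF measurable_compose[OF pair measurable_prob_algebraD[OF pol(1)]]
            measurable_emeasure_subprob_algebra[OF B]])
    then have "(\<lambda>x. emeasure (\<pi> 0 (u, x)) B) -` {1} \<inter> space S \<in> sets S"
      by (rule measurable_sets) simp
    also have "(\<lambda>x. emeasure (\<pi> 0 (u, x)) B) -` {1} \<inter> space S = \<phi> -` B \<inter> space S"
      using ret B by (auto simp: indicator_def split: if_splits)
    finally show "\<phi> -` B \<inter> space S \<in> sets S" .
  qed (use \<phi> in auto)
  moreover have "\<phi> x \<in> Av x" if x: "x \<in> space S" for x
    using pol(2)[OF u[OF x]] ret[OF x] Av_sets[OF x] by (auto simp: indicator_def split: if_splits)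
  moreover have "\<pi> t (h, x) = return A (\<phi> x)" if hx: "(h, x) \<in> space (hist t)" for t h x
  proof -
    have x: "x \<in> space S" using hx by (simp add: hist_def space_pair_measure)
    show ?thesis using st[OF hx u[OF x]] ret[OF x] by simp
  qed
  ultimately show "\<exists>\<phi> \<in> S \<rightarrow>\<^sub>M A. (\<forall>x\<in>space S. \<phi> x \<in> Av x) \<and>
        (\<forall>t. \<forall>(h, x) \<in> space (hist t). \<pi> t (h, x) = return A (\<phi> x))" by blast
next
  assume "\<exists>\<phi> \<in> S \<rightarrow>\<^sub>M A. (\<forall>x\<in>space S. \<phi> x \<in> Av x) \<and>
        (\<forall>t. \<forall>(h, x) \<in> space (hist t). \<pi> t (h, x) = return A (\<phi> x))"
  then obtain \<phi> where \<phi>: "\<phi> \<in> S \<rightarrow>\<^sub>M A" "\<And>x. x \<in> space S \<Longrightarrow> \<phi> x \<in> Av x"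
    and \<pi>: "\<And>t h x. (h, x) \<in> space (hist t) \<Longrightarrow> \<pi> t (h, x) = return A (\<phi> x)" by blast
  have hS: "x \<in> space S" if "(h, x) \<in> space (hist t)" for t h x
    using that by (simp add: hist_def space_pair_measure)
  have \<phi>A: "\<phi> x \<in> space A" if "x \<in> space S" for x using measurable_space[OF \<phi>(1) that] .
  have "\<pi> t \<in> hist t \<rightarrow>\<^sub>M prob_algebra A" for t
  proof -
    have "snd \<in> hist t \<rightarrow>\<^sub>M S" unfolding hist_def by simp
    from measurable_compose[OF measurable_compose[OF this \<phi>(1)] measurable_return_prob_space]
    have "(\<lambda>hx. return A (\<phi> (snd hx))) \<in> hist t \<rightarrow>\<^sub>M prob_algebra A" .
    then show ?thesis by (subst measurable_cong) (use \<pi> in auto)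
  qed
  moreover have "emeasure (\<pi> t (h, x)) (Av x) = 1" if "(h, x) \<in> space (hist t)" for t h x
    using \<pi>[OF that] \<phi>(2)[OF hS[OF that]] Av_sets[OF hS[OF that]] by simp
  ultimately have "\<pi> \<in> policies" by (auto simp: policies_def)
  moreover have "nonrandomized \<pi>"
    unfolding nonrandomized_def
  proof (intro allI ballI)
    fix t hx assume hx: "hx \<in> space (hist t)"
    obtain h x where [simp]: "hx = (h, x)" by (cases hx)
    have "\<phi> x \<in> space A" using \<phi>A hS hx by simp
    moreover have "{\<phi> x} \<in> sets A" using standard_borel_singleton[OF standard_borel_A] calculation .
    ultimately show "\<exists>a\<in>space A. emeasure (\<pi> t hx) {a} = 1"
      using \<pi> hx by (intro bexI[of _ "\<phi> x"]) auto
  qed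
  moreover have "stationary \<pi>" using \<pi> by (auto simp: stationary_def Markov_def)
  ultimately show "\<pi> \<in> deterministic_policies" by (simp add: deterministic_policies_def)
qed

end

locale absorbing_MDP = MDP S A Av p \<mu> r
  for S :: "'x measure" and A :: "'a measure" and Av p \<mu> and r :: "'x \<times> 'a \<Rightarrow> real ^ 'n" +
  fixes xb :: 'x
  assumes xb_state: "xb \<in> space S"
    and initial_xb: "emeasure \<mu> {xb} = 0"
    and absorbing_xb: "\<exists>ab\<in>space A. Av xb = {ab} \<and> emeasure (p (xb, ab)) {xb} = 1 \<and> r (xb, ab) = 0"
    and expected_absorption_time:
      "\<exists>L::real. \<forall>\<pi>\<in>policies. (\<integral>\<^sup>+\<omega>. ennreal_of_enat (hitting_time xb \<omega>) \<partial>P \<pi>) \<le> ennreal L"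
begin

text \<open>The sum over \<open>t < T\<close> is written as a series; for \<open>P \<pi>\<close>-almost all trajectories it
  has only finitely many nonzero terms.\<close>

definition performance :: "(nat \<Rightarrow> (nat \<Rightarrow> 'x \<times> 'a) \<times> 'x \<Rightarrow> 'a measure) \<Rightarrow> real ^ 'n" where
  "performance \<pi> = (\<integral>\<omega>. (\<Sum>t. if enat t < hitting_time xb \<omega> then r (\<omega> t) else 0) \<partial>P \<pi>)"

definition deterministic_performance_set :: "(real ^ 'n) set" where
  "deterministic_performance_set = performance ` deterministic_policies"

end

locale uniformly_absorbing_MDP = absorbing_MDP +
  assumes uniformly_absorbing:
    "(\<lambda>n. SUP \<pi>\<in>nonrandomized_Markov_policies.
        \<integral>\<^sup>+\<omega>. (\<Sum>t. if enat (n + t) < hitting_time xb \<omega> then 1 else 0) \<partial>P \<pi>) \<longlonglongrightarrow> (0::ennreal)"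

locale atomless_MDP = absorbing_MDP +
  assumes initial_atomless: "x \<in> space S - {xb} \<Longrightarrow> emeasure \<mu> {x} = 0"
    and transition_atomless:
      "x \<in> space S - {xb} \<Longrightarrow> y \<in> space S - {xb} \<Longrightarrow> a \<in> Av x \<Longrightarrow> emeasure (p (x, a)) {y} = 0"

end

theory Submission
  imports Defs
begin

text \<open>Two deterministic policies are two selectors \<open>f0\<close>, \<open>f1\<close>, and every selector that at each state
  agrees with one of them is again a policy of the same process. It suffices to show that the set
  \<open>W\<close> of performance vectors of the selectors between \<open>f0\<close> and \<open>f1\<close> is convex.

  Uniform absorption provides a weight function \<open>w\<close>, the maximal expected time to absorption
  over both actions, with \<open>1 + \<integral>w dp \<le> w\<close> outside the absorbing state, and the integrals of \<open>w\<close> against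
  the state distributions at time \<open>n\<close> tend to \<open>0\<close> uniformly over the policies. Hence for each
  direction \<open>c\<close> value iteration started at a multiple of \<open>w\<close> decreases to a solution of the Bellman
  equation for the scalar reward \<open>c \<bullet> r\<close>. A selector is optimal in direction \<open>c\<close> if and only if almost
  surely it uses only actions attaining the maximum in this equation (conserving actions), and
  selectors that use actions conserving for nearby directions are nearly optimal.

  A point \<open>v\<close> of the convex hull of \<open>W\<close> is shown to lie in \<open>W\<close> by induction on the dimension of \<open>W\<close>.

  If \<open>v\<close> is in the relative interior, one constructs a continuous map from the unit ball of
  directions \<open>c\<close> to \<open>W\<close> whose value \<open>F c\<close> is nearly optimal in direction \<open>c\<close>. Optimal selectors for a
  finite net of directions are glued along the sublevel sets of an injective measurable function
  \<open>U\<close>, with weights depending continuously on \<open>c\<close>. When \<open>c\<close> moves, the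
  action is unstable at finitely many states only, and by atomlessness finite sets
  do not influence the performance, so \<open>F\<close> is continuous. If \<open>F\<close> missed \<open>v\<close>, then by Brouwer's
  theorem the map sending \<open>c\<close> to the normalized vector \<open>v - F c\<close> would have a fixed point \<open>c\<close> of norm \<open>1\<close>,
  for which \<open>c \<bullet> F c < c \<bullet> v\<close>, contradicting near optimality
  (\<open>interior_attained\<close>).

  If \<open>v\<close> is on the relative boundary, a supporting hyperplane gives a direction \<open>c\<close> in which \<open>v\<close> is
  optimal. Every point of \<open>W\<close> with positive weight in a convex combination for \<open>v\<close> is then optimal as
  well, so its selector is almost surely conserving and can be altered on null sets so as to be
  conserving wherever the weight is finite. Restricting both \<open>f0\<close> and \<open>f1\<close> to conserving actions
  yields a pair whose performance set still has \<open>v\<close> in its convex hull, but lies in the hyperplane,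
  so that the dimension drops
  (\<open>perf_between_convex_hull\<close>).\<close>

section \<open>Integration and separation of points\<close>

text \<open>Fubini for kernels and unbounded integrands, obtained by applying the nonnegative version to the
  positive and to the negative part.\<close>

lemma integral_bind_integrable:
  fixes f :: "'b \<Rightarrow> real"
  assumes [measurable]: "f \<in> borel_measurable N" and k[measurable]: "k \<in> M \<rightarrow>\<^sub>M subprob_algebra N"
    and ne: "space M \<noteq> {}"
    and fin: "(\<integral>\<^sup>+x. \<integral>\<^sup>+y. ennreal \<bar>f y\<bar> \<partial>k x \<partial>M) < \<infinity>"
  shows "integrable (M \<bind> k) f" "(\<integral>y. f y \<partial>(M \<bind> k)) = (\<integral>x. \<integral>y. f y \<partial>k x \<partial>M)"
proof -
  have sB: "sets (M \<bind> k) = sets N" using sets_bind_measurable[OF k ne] .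
  have kN: "measurable (k x) borel = measurable N borel" if "x \<in> space M" for x
    using subprob_measurableD(3)[OF k that] .
  have m[measurable]: "f \<in> borel_measurable (M \<bind> k)"
    using sB by (simp cong: measurable_cong_sets)
  have "(\<integral>\<^sup>+y. ennreal \<bar>f y\<bar> \<partial>(M \<bind> k)) < \<infinity>"
    using fin by (subst nn_integral_bind[OF _ k]) auto
  then show int: "integrable (M \<bind> k) f"
    by (intro integrableI_bounded) auto
  have mn: "(\<lambda>x. \<integral>\<^sup>+y. ennreal (g y) \<partial>k x) \<in> borel_measurable M" if "g \<in> borel_measurable N" for g :: "'b \<Rightarrow> real"
    using that by (intro measurable_compose[OF k nn_integral_measurable_subprob_algebra]) auto
  have fin1: "(\<integral>\<^sup>+x. \<integral>\<^sup>+y. ennreal (g y) \<partial>k x \<partial>M) < \<infinity>" if "\<And>y. g y \<le> \<bar>f y\<bar>" for g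
    by (rule le_less_trans[OF _ fin]) (intro nn_integral_mono, use that in \<open>auto intro: ennreal_leI\<close>)
  have ae: "AE x in M. (\<integral>\<^sup>+y. ennreal \<bar>f y\<bar> \<partial>k x) \<noteq> \<infinity>"
    using fin by (intro nn_integral_PInf_AE mn) auto
  \<comment> \<open>applied below to \<open>f\<close> and to \<open>- f\<close>\<close>
  have part: "(\<integral>x. enn2real (\<integral>\<^sup>+y. ennreal (g y) \<partial>k x) \<partial>M) = enn2real (\<integral>\<^sup>+x. \<integral>\<^sup>+y. ennreal (g y) \<partial>k x \<partial>M)"
    "integrable M (\<lambda>x. enn2real (\<integral>\<^sup>+y. ennreal (g y) \<partial>k x))"
    if [measurable]: "g \<in> borel_measurable N" and le: "\<And>y. g y \<le> \<bar>f y\<bar>" for g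
  proof -
    note [measurable] = mn[OF that(1)]
    have "AE x in M. (\<integral>\<^sup>+y. ennreal (g y) \<partial>k x) \<noteq> \<infinity>"
      using fin1[of g] le by (intro nn_integral_PInf_AE mn) auto
    then have e: "(\<integral>\<^sup>+x. ennreal (enn2real (\<integral>\<^sup>+y. ennreal (g y) \<partial>k x)) \<partial>M) = (\<integral>\<^sup>+x. \<integral>\<^sup>+y. ennreal (g y) \<partial>k x \<partial>M)"
      by (intro nn_integral_cong_AE) (auto simp: less_top)
    show "(\<integral>x. enn2real (\<integral>\<^sup>+y. ennreal (g y) \<partial>k x) \<partial>M) = enn2real (\<integral>\<^sup>+x. \<integral>\<^sup>+y. ennreal (g y) \<partial>k x \<partial>M)"
      by (subst integral_eq_nn_integral) (auto simp: e)
    show "integrable M (\<lambda>x. enn2real (\<integral>\<^sup>+y. ennreal (g y) \<partial>k x))"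
      using fin1[of g] le by (intro integrableI_bounded) (auto simp: e)
  qed
  have "(\<integral>y. f y \<partial>(M \<bind> k)) = enn2real (\<integral>\<^sup>+y. ennreal (f y) \<partial>(M \<bind> k)) - enn2real (\<integral>\<^sup>+y. ennreal (- f y) \<partial>(M \<bind> k))"
    using int by (rule real_lebesgue_integral_def)
  also have "\<dots> = (\<integral>x. enn2real (\<integral>\<^sup>+y. ennreal (f y) \<partial>k x) \<partial>M) - (\<integral>x. enn2real (\<integral>\<^sup>+y. ennreal (- f y) \<partial>k x) \<partial>M)"
    by (subst (1 2) part(1)) (auto simp: nn_integral_bind[OF _ k])
  also have "\<dots> = (\<integral>x. enn2real (\<integral>\<^sup>+y. ennreal (f y) \<partial>k x) - enn2real (\<integral>\<^sup>+y. ennreal (- f y) \<partial>k x) \<partial>M)"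
    by (intro Bochner_Integration.integral_diff[symmetric] part(2)) auto
  also have "\<dots> = (\<integral>x. \<integral>y. f y \<partial>k x \<partial>M)"
  proof (rule integral_cong_AE)
    show "(\<lambda>x. enn2real (\<integral>\<^sup>+y. ennreal (f y) \<partial>k x) - enn2real (\<integral>\<^sup>+y. ennreal (- f y) \<partial>k x)) \<in> borel_measurable M"
      by (intro borel_measurable_diff borel_measurable_enn2real mn) auto
    show "(\<lambda>x. \<integral>y. f y \<partial>k x) \<in> borel_measurable M"
      by (rule measurable_compose[OF k integral_measurable_subprob_algebra]) auto
    show "AE x in M. enn2real (\<integral>\<^sup>+y. ennreal (f y) \<partial>k x) - enn2real (\<integral>\<^sup>+y. ennreal (- f y) \<partial>k x) = (\<integral>y. f y \<partial>k x)"
      using ae AE_space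
    proof eventually_elim
      case (elim x)
      have "integrable (k x) f"
        using elim kN by (intro integrableI_bounded) (auto simp: less_top)
      then show ?case by (rule real_lebesgue_integral_def[symmetric])
    qed
  qed
  finally show "(\<integral>y. f y \<partial>(M \<bind> k)) = (\<integral>x. \<integral>y. f y \<partial>k x \<partial>M)" .
qed

lemma indicator_compl_singleton_measurable:
  assumes "{x} \<in> sets M"
  shows "(indicator (- {x}) :: 'a \<Rightarrow> real) \<in> borel_measurable M"
    and "(indicator (- {x}) :: 'a \<Rightarrow> ennreal) \<in> borel_measurable M"
proof -
  have "space M - {x} \<in> sets M" using assms by auto
  then have "(indicator (space M - {x}) :: 'a \<Rightarrow> real) \<in> borel_measurable M"
    "(indicator (space M - {x}) :: 'a \<Rightarrow> ennreal) \<in> borel_measurable M"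
    by simp_all
  then show "(indicator (- {x}) :: 'a \<Rightarrow> real) \<in> borel_measurable M"
    "(indicator (- {x}) :: 'a \<Rightarrow> ennreal) \<in> borel_measurable M"
    by (auto elim!: measurable_cong[THEN iffD1, rotated] split: split_indicator)
qed

text \<open>At the first index where the two sets differ, the two series differ by a summand
  that is twice the sum of all later ones.\<close>

lemma ternary_expansion_inj:
  fixes A B :: "nat set"
  assumes eq: "(\<Sum>n. (1/3::real) ^ Suc n * indicator A n) = (\<Sum>n. (1/3) ^ Suc n * indicator B n)"
  shows "A = B"
proof (rule ccontr)
  have sm: "summable (\<lambda>n. (1/3::real) ^ Suc n * indicator C n)" for C
    by (rule summable_comparison_test'[OF summable_geometric[of "1/3::real"]]) (auto split: split_indicator)
  have less: "(\<Sum>n. (1/3::real) ^ Suc n * indicator D n) < (\<Sum>n. (1/3) ^ Suc n * indicator C n)"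
    if n: "n \<in> C" "n \<notin> D" and agree: "\<And>k. k < n \<Longrightarrow> k \<in> C \<longleftrightarrow> k \<in> D" for C D :: "nat set" and n
  proof -
    let ?d = "\<lambda>k. (1/3::real) ^ Suc k * indicator C k - (1/3) ^ Suc k * indicator D k"
    have sd: "summable ?d" by (intro summable_diff sm)
    have geo: "(\<lambda>k. (1/3::real) ^ Suc (k + Suc n)) sums ((1/3) ^ Suc n / 2)"
      using sums_mult[OF geometric_sums[of "1/3::real"], of "(1/3) ^ (n + 2)"]
      by (simp add: power_add mult_ac)
    have ls: "(\<Sum>k<Suc n. ?d k) = (1/3) ^ Suc n"
      using agree n by (simp add: sum.neutral split: split_indicator)
    have "- ((1/3) ^ Suc n / 2) = (\<Sum>k. - ((1/3::real) ^ Suc (k + Suc n)))"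
      using sums_unique[OF sums_minus[OF geo]] .
    also have "\<dots> \<le> (\<Sum>k. ?d (k + Suc n))"
      by (rule suminf_le[OF _ sums_summable[OF sums_minus[OF geo]] summable_ignore_initial_segment[OF sd]])
        (auto split: split_indicator)
    finally have "(1/3::real) ^ Suc n / 2 \<le> (\<Sum>k. ?d k)"
      using suminf_split_initial_segment[OF sd, of "Suc n"] ls by linarith
    moreover have "0 < (1/3::real) ^ Suc n / 2" by simp
    ultimately have "0 < (\<Sum>k. ?d k)" by linarith
    then show ?thesis using suminf_diff[OF sm sm, of C D] by linarith
  qed
  assume "A \<noteq> B"
  then have "\<exists>n. (n \<in> A) \<noteq> (n \<in> B)" by auto
  define n where "n = (LEAST n. (n \<in> A) \<noteq> (n \<in> B))"
  have "(n \<in> A) \<noteq> (n \<in> B)" unfolding n_def by (rule LeastI_ex) fact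
  moreover have "k \<in> A \<longleftrightarrow> k \<in> B" if "k < n" for k using not_less_Least[of k] that unfolding n_def by blast
  ultimately show False using less[of n A B] less[of n B A] eq by auto
qed

text \<open>The values of \<open>U\<close> encode which members of a countable base of the underlying Polish topology contain
  a point. A threshold for an injective coordinate is met by at most one state, which is negligible for
  atomless measures.\<close>

lemma standard_borel_embedding:
  assumes "standard_borel M"
  obtains U :: "'a \<Rightarrow> real" where "U \<in> borel_measurable M" "inj_on U (space M)"
    "\<And>x. 0 \<le> U x" "\<And>x. U x < 1"
proof -
  obtain X :: "real topology" and B f g where X: "Polish_topology X" and B: "B \<in> sets (borel_of X)"
    and f: "f \<in> M \<rightarrow>\<^sub>M restrict_space (borel_of X) B" and gf: "\<forall>x\<in>space M. g (f x) = x"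
    using assms unfolding standard_borel_def isomorphic_measurable_spaces_def
    by (elim exE bexE conjE) (rule that)
  have fX: "f \<in> M \<rightarrow>\<^sub>M borel_of X" using f by (simp add: measurable_restrict_space2_iff)
  have t1: "t1_space X" and "second_countable X"
    using X completely_metrizable_imp_metrizable_space metrizable_imp_Hausdorff_space
      Hausdorff_imp_t1_space by (auto simp: Polish_topology_def)
  then obtain \<B> where \<B>: "countable \<B>" "\<And>V. V \<in> \<B> \<Longrightarrow> openin X V"
      "\<And>W x. openin X W \<and> x \<in> W \<Longrightarrow> \<exists>V\<in>\<B>. x \<in> V \<and> V \<subseteq> W"
    unfolding second_countable_def by metis
  \<comment> \<open>the empty set is added so that the family can be enumerated\<close>
  define V where "V = from_nat_into (insert {} \<B>)"
  have rV: "range V = insert {} \<B>" unfolding V_def using \<B>(1) by (intro range_from_nat_into) auto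
  have oV: "openin X (V n)" for n using rangeI[of V n] \<B>(2) unfolding rV by auto
  define code where "code x = {n. f x \<in> V n}" for x
  define U where "U x = (\<Sum>n. (1/3::real) ^ Suc n * indicator (code x) n)" for x
  have le: "(1/3::real) ^ Suc n * indicator (code x) n \<le> (1/3) ^ Suc n" for n x by (auto split: split_indicator)
  have sg: "(\<lambda>n. (1/3::real) ^ Suc n) sums (1/2)"
    using sums_mult[OF geometric_sums[of "1/3::real"], of "1/3"] by simp
  have sm: "summable (\<lambda>n. (1/3::real) ^ Suc n * indicator (code x) n)" for x
    by (rule summable_comparison_test'[OF sums_summable[OF sg]]) (use le in \<open>auto split: split_indicator\<close>)
  show ?thesis
  proof (rule that[of U])
    have "(\<lambda>x. (1/3::real) ^ Suc n * indicator (code x) n) \<in> borel_measurable M" for n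
    proof -
      have "f -` V n \<inter> space M \<in> sets M" using measurable_sets[OF fX openin_in_borel_of[OF oV]] .
      then have "(\<lambda>x. (1/3::real) ^ Suc n * indicator (f -` V n) x) \<in> borel_measurable M"
        by (intro borel_measurable_times) (auto simp: borel_measurable_indicator_iff)
      also have "(\<lambda>x. (1/3::real) ^ Suc n * indicator (f -` V n) x) = (\<lambda>x. (1/3) ^ Suc n * indicator (code x) n)"
        by (auto simp: code_def split: split_indicator)
      finally show ?thesis .
    qed
    then show "U \<in> borel_measurable M" unfolding U_def[abs_def] by (rule borel_measurable_suminf)
    show "inj_on U (space M)"
    proof (rule inj_onI)
      fix x y assume xy: "x \<in> space M" "y \<in> space M" "U x = U y"
      then have cxy: "code x = code y" unfolding U_def by (intro ternary_expansion_inj)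
      have fxy: "f x \<in> topspace X" "f y \<in> topspace X" using measurable_space[OF fX] xy by auto
      have "f x = f y"
      proof (rule ccontr)
        assume "f x \<noteq> f y"
        then obtain W where "openin X W" "f x \<in> W" "f y \<notin> W"
          using t1 fxy unfolding t1_space_def by metis
        then obtain W' where W': "W' \<in> \<B>" "f x \<in> W'" "f y \<notin> W'" using \<B>(3) by blast
        then obtain n where "V n = W'" using rV by (metis insertCI rangeE)
        then show False using cxy W' unfolding code_def by blast
      qed
      then show "x = y" using gf xy by metis
    qed
    fix x
    show "0 \<le> U x" unfolding U_def by (intro suminf_nonneg sm) auto
    have "U x \<le> (\<Sum>n. (1/3::real) ^ Suc n)" unfolding U_def by (intro suminf_le le sm sums_summable[OF sg])
    then show "U x < 1" using sums_unique[OF sg] by simp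
  qed
qed

section \<open>State distributions under sequences of selectors\<close>

text \<open>The distribution of the state at time \<open>n\<close> when the selector \<open>F t\<close> is used at time \<open>t\<close>.\<close>

primrec state_law ::
  "('x \<times> 'a \<Rightarrow> 'x measure) \<Rightarrow> 'x measure \<Rightarrow> (nat \<Rightarrow> 'x \<Rightarrow> 'a) \<Rightarrow> nat \<Rightarrow> 'x measure" where
  "state_law p \<mu> F 0 = \<mu>"
| "state_law p \<mu> F (Suc n) = state_law p \<mu> F n \<bind> (\<lambda>x. p (x, F n x))"

definition selectors :: "'x measure \<Rightarrow> 'a measure \<Rightarrow> ('x \<Rightarrow> 'a set) \<Rightarrow> ('x \<Rightarrow> 'a) set" where
  "selectors S A Act = {f \<in> S \<rightarrow>\<^sub>M A. \<forall>x\<in>space S. f x \<in> Act x}"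

lemma kernel_selector_measurable:
  assumes "p \<in> S \<Otimes>\<^sub>M A \<rightarrow>\<^sub>M N" "f \<in> S \<rightarrow>\<^sub>M A"
  shows "(\<lambda>x. p (x, f x)) \<in> S \<rightarrow>\<^sub>M N"
  by (rule measurable_compose[OF _ assms(1)]) (use assms(2) in simp)

lemma state_law_in_prob_algebra:
  assumes "p \<in> S \<Otimes>\<^sub>M A \<rightarrow>\<^sub>M prob_algebra S" "\<mu> \<in> space (prob_algebra S)" "\<And>n. F n \<in> S \<rightarrow>\<^sub>M A"
  shows "state_law p \<mu> F n \<in> space (prob_algebra S)"
proof (induction n)
  case (Suc n)
  show ?case
    using prob_space_bind'[OF Suc kernel_selector_measurable[OF assms(1,3)]]
      sets_bind'[OF Suc kernel_selector_measurable[OF assms(1,3)]]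
    by (simp add: space_prob_algebra)
qed (use assms in simp)

lemma state_law_cong: "(\<And>i. i < n \<Longrightarrow> F i = F' i) \<Longrightarrow> state_law p \<mu> F n = state_law p \<mu> F' n"
  by (induction n) auto

lemma state_law_Suc_nn_integral:
  assumes p: "p \<in> S \<Otimes>\<^sub>M A \<rightarrow>\<^sub>M prob_algebra S" and \<mu>: "\<mu> \<in> space (prob_algebra S)"
    and F: "\<And>n. F n \<in> S \<rightarrow>\<^sub>M A" and g: "g \<in> borel_measurable S"
  shows "(\<integral>\<^sup>+x. g x \<partial>state_law p \<mu> F (Suc n)) = (\<integral>\<^sup>+x. \<integral>\<^sup>+y. g y \<partial>p (x, F n x) \<partial>state_law p \<mu> F n)"
proof -
  have s: "sets (state_law p \<mu> F n) = sets S"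
    using state_law_in_prob_algebra[where F=F, OF p \<mu> F] by (simp add: space_prob_algebra)
  have "(\<lambda>x. p (x, F n x)) \<in> state_law p \<mu> F n \<rightarrow>\<^sub>M subprob_algebra S"
    unfolding measurable_cong_sets[OF s refl]
    by (rule measurable_prob_algebraD[OF kernel_selector_measurable[OF p F]])
  then show ?thesis unfolding state_law.simps by (rule nn_integral_bind[OF g])
qed

section \<open>Controlled kernels with a weight function\<close>

text \<open>The setting in which convexity is proved. Off \<open>xb\<close>, the weight \<open>w\<close> decreases on average by at least
  one in each step, whatever admissible action is taken. This holds on \<open>G\<close>, which is never left; in the application it
  is the set of states with a finite maximal expected absorption time. The sequence \<open>u\<close>
  expresses uniform absorption, and \<open>U\<close> is an injective coordinate used to cut the state space.
  The absorbing state has a single action and no reward, and is the only possible atom.\<close>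

locale weighted_control =
  fixes S :: "'x measure" and A :: "'a measure" and p :: "'x \<times> 'a \<Rightarrow> 'x measure"
    and \<mu> :: "'x measure" and r :: "'x \<times> 'a \<Rightarrow> 'v::euclidean_space"
    and Act :: "'x \<Rightarrow> 'a set" and xb :: 'x and G :: "'x set" and w :: "'x \<Rightarrow> real"
    and K :: real and u :: "nat \<Rightarrow> real" and U :: "'x \<Rightarrow> real"
  assumes transition: "p \<in> S \<Otimes>\<^sub>M A \<rightarrow>\<^sub>M prob_algebra S"
    and initial: "\<mu> \<in> space (prob_algebra S)"
    and reward: "r \<in> borel_measurable (S \<Otimes>\<^sub>M A)"
    and xb_sets: "{xb} \<in> sets S"
    and K_nonneg: "0 \<le> K"
    and reward_bound: "x \<in> space S \<Longrightarrow> a \<in> Act x \<Longrightarrow> norm (r (x, a)) \<le> K * indicator (- {xb}) x"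
    and Act_xb: "a \<in> Act xb \<Longrightarrow> a' \<in> Act xb \<Longrightarrow> a = a'"
    and G_sets: "G \<in> sets S"
    and w_measurable: "w \<in> borel_measurable S"
    and w_nonneg: "0 \<le> w x"
    and G_closed: "x \<in> G \<Longrightarrow> a \<in> Act x \<Longrightarrow> AE y in p (x, a). y \<in> G"
    and drift: "x \<in> G \<Longrightarrow> a \<in> Act x \<Longrightarrow>
      ennreal (indicator (- {xb}) x) + (\<integral>\<^sup>+y. ennreal (w y) \<partial>p (x, a)) \<le> ennreal (w x)"
    and initial_G: "AE x in \<mu>. x \<in> G"
    and u_nonneg: "0 \<le> u n"
    and tail: "f \<in> selectors S A Act \<Longrightarrow>
      (\<integral>\<^sup>+x. ennreal (w x) \<partial>state_law p \<mu> (\<lambda>_. f) n) \<le> ennreal (u n)"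
    and u_tendsto: "u \<longlonglongrightarrow> 0"
    and initial_atomless: "y \<in> space S - {xb} \<Longrightarrow> emeasure \<mu> {y} = 0"
    and transition_atomless:
      "x \<in> space S \<Longrightarrow> a \<in> Act x \<Longrightarrow> y \<in> space S - {xb} \<Longrightarrow> emeasure (p (x, a)) {y} = 0"
    and U_measurable: "U \<in> borel_measurable S"
    and U_inj: "inj_on U (space S)"
    and U_range: "x \<in> space S \<Longrightarrow> 0 \<le> U x \<and> U x < 1"
    and singletons: "x \<in> space S \<Longrightarrow> {x} \<in> sets S"
begin

abbreviation sel :: "('x \<Rightarrow> 'a) set" where "sel \<equiv> selectors S A Act"
abbreviation law :: "('x \<Rightarrow> 'a) \<Rightarrow> nat \<Rightarrow> 'x measure" where "law f \<equiv> state_law p \<mu> (\<lambda>_. f)"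
abbreviation live :: "'x \<Rightarrow> real" where "live \<equiv> indicator (- {xb})"

lemma selD: assumes "f \<in> sel" shows "f \<in> S \<rightarrow>\<^sub>M A" "\<And>x. x \<in> space S \<Longrightarrow> f x \<in> Act x"
  using assms by (auto simp: selectors_def)

lemma G_space: "x \<in> G \<Longrightarrow> x \<in> space S"
  using sets.sets_into_space[OF G_sets] by auto

lemma live_measurable[measurable]: "live \<in> borel_measurable S"
  by (rule indicator_compl_singleton_measurable(1)[OF xb_sets])

lemma kernel: "f \<in> sel \<Longrightarrow> (\<lambda>x. p (x, f x)) \<in> S \<rightarrow>\<^sub>M prob_algebra S"
  by (rule kernel_selector_measurable[OF transition selD(1)])

lemma kernel': "f \<in> sel \<Longrightarrow> (\<lambda>x. p (x, f x)) \<in> S \<rightarrow>\<^sub>M subprob_algebra S"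
  by (rule measurable_prob_algebraD[OF kernel])

lemma kernel_prob_space:
  assumes "x \<in> space S" "f \<in> sel"
  shows "prob_space (p (x, f x))" "sets (p (x, f x)) = sets S"
  using measurable_space[OF kernel[OF assms(2)] assms(1)] by (auto simp: space_prob_algebra)

lemma kernel_measurable_cong:
  assumes "x \<in> space S" "f \<in> sel"
  shows "measurable (p (x, f x)) N = measurable S N"
  using kernel_prob_space(2)[OF assms] by (rule measurable_cong_sets) simp

lemma law_prob: "f \<in> sel \<Longrightarrow> law f n \<in> space (prob_algebra S)"
  by (rule state_law_in_prob_algebra[OF transition initial]) (rule selD)

lemma law_space:
  assumes "f \<in> sel"
  shows "prob_space (law f n)" "sets (law f n) = sets S" "space (law f n) = space S"
  using law_prob[OF assms] sets_eq_imp_space_eq[of "law f n" S] by (auto simp: space_prob_algebra)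

lemma law_measurable: "f \<in> sel \<Longrightarrow> measurable (law f n) N = measurable S N"
  by (rule measurable_cong_sets[OF law_space(2) refl])

lemma kernel_law: "f \<in> sel \<Longrightarrow> (\<lambda>x. p (x, f x)) \<in> law f n \<rightarrow>\<^sub>M subprob_algebra S"
  using kernel' by (simp add: law_measurable)

lemma law_ne: "f \<in> sel \<Longrightarrow> space (law f n) \<noteq> {}"
  using prob_space.not_empty[OF law_space(1)] by simp

lemma reward_sel: "f \<in> sel \<Longrightarrow> (\<lambda>x. r (x, f x)) \<in> borel_measurable S"
  by (rule kernel_selector_measurable[OF reward selD(1)])

lemma law_G: "f \<in> sel \<Longrightarrow> AE x in law f n. x \<in> G"
proof (induction n)
  case 0 then show ?case using initial_G unfolding state_law.simps by -
next
  case (Suc n)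
  have "AE x in law f n. AE y in p (x, f x). y \<in> G"
    using Suc(1)[OF Suc(2)]
  proof eventually_elim
    case (elim x) then show ?case using G_closed selD(2)[OF Suc(2)] G_space by blast
  qed
  moreover have "Measurable.pred S (\<lambda>y. y \<in> G)" using G_sets by simp
  ultimately show ?case
    unfolding state_law.simps by (subst AE_bind[OF kernel_law[OF Suc(2)]]) auto
qed

lemma kernel_integral_measurable:
  fixes V :: "'x \<Rightarrow> real"
  assumes "f \<in> sel" "V \<in> borel_measurable S"
  shows "(\<lambda>x. \<integral>y. V y \<partial>p (x, f x)) \<in> borel_measurable S"
  by (rule measurable_compose[OF kernel'[OF assms(1)] integral_measurable_subprob_algebra[OF assms(2)]])

lemma kernel_weight:
  assumes "x \<in> G" "f \<in> sel"
  shows "integrable (p (x, f x)) w" "live x + (\<integral>y. w y \<partial>p (x, f x)) \<le> w x"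
proof -
  have x: "x \<in> space S" using G_space assms(1) .
  have le: "ennreal (live x) + (\<integral>\<^sup>+y. ennreal (w y) \<partial>p (x, f x)) \<le> ennreal (w x)"
    using drift[OF assms(1) selD(2)[OF assms(2) x]] .
  then have le': "(\<integral>\<^sup>+y. ennreal (w y) \<partial>p (x, f x)) \<le> ennreal (w x)"
    by (rule order_trans[rotated]) simp
  show i: "integrable (p (x, f x)) w"
    using le' w_nonneg
    by (intro integrableI_bounded) (auto simp: kernel_measurable_cong[OF x assms(2)] w_measurable intro: le_less_trans)
  have "(\<integral>\<^sup>+y. ennreal (w y) \<partial>p (x, f x)) = ennreal (\<integral>y. w y \<partial>p (x, f x))"
    using i w_nonneg by (intro nn_integral_eq_integral) auto
  with le have "ennreal (live x + (\<integral>y. w y \<partial>p (x, f x))) \<le> ennreal (w x)"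
    using w_nonneg by (subst ennreal_plus) (auto intro: integral_nonneg_AE)
  then show "live x + (\<integral>y. w y \<partial>p (x, f x)) \<le> w x"
    unfolding ennreal_le_iff[OF w_nonneg] .
qed

text \<open>On \<open>G\<close> such functions are integrable against the kernels and the state
  distributions. Outside \<open>G\<close> Bochner integrals may fail to exist.\<close>

definition weight_bounded :: "real \<Rightarrow> ('x \<Rightarrow> real) \<Rightarrow> bool" where
  "weight_bounded C V \<longleftrightarrow> 0 \<le> C \<and> V \<in> borel_measurable S \<and> (\<forall>x\<in>G. \<bar>V x\<bar> \<le> C * w x)"

lemma weight_boundedD:
  assumes "weight_bounded C V"
  shows "0 \<le> C" "V \<in> borel_measurable S" "\<And>x. x \<in> G \<Longrightarrow> \<bar>V x\<bar> \<le> C * w x"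
  using assms by (auto simp: weight_bounded_def)

lemma kernel_G: "x \<in> G \<Longrightarrow> f \<in> sel \<Longrightarrow> AE y in p (x, f x). y \<in> G"
  using G_closed selD(2) G_space by blast

lemma kernel_weight_bounded:
  assumes "weight_bounded C V" "x \<in> G" "f \<in> sel"
  shows "integrable (p (x, f x)) V" "\<bar>\<integral>y. V y \<partial>p (x, f x)\<bar> \<le> C * (w x - live x)"
proof -
  note x = G_space[OF assms(2)]
  have ae: "AE y in p (x, f x). \<bar>V y\<bar> \<le> C * w y"
    using kernel_G[OF assms(2,3)] by eventually_elim (rule weight_boundedD[OF assms(1)])
  have wi: "integrable (p (x, f x)) (\<lambda>y. C * w y)" using kernel_weight[OF assms(2,3)] by simp
  show i: "integrable (p (x, f x)) V"
    using ae weight_boundedD(2)[OF assms(1)]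
    by (intro Bochner_Integration.integrable_bound[OF wi]) (auto simp: kernel_measurable_cong[OF x assms(3)])
  have "\<bar>\<integral>y. V y \<partial>p (x, f x)\<bar> \<le> (\<integral>y. C * w y \<partial>p (x, f x))"
    using ae by (intro order_trans[OF integral_abs_bound] integral_mono_AE integrable_abs i wi)
  also have "\<dots> \<le> C * (w x - live x)"
    using kernel_weight(2)[OF assms(2,3)] weight_boundedD(1)[OF assms(1)] by (simp add: mult_left_mono)
  finally show "\<bar>\<integral>y. V y \<partial>p (x, f x)\<bar> \<le> C * (w x - live x)" .
qed

lemma kernel_integral_mono:
  assumes "weight_bounded C V" "weight_bounded C' V'" "x \<in> G" "f \<in> sel" "\<And>y. y \<in> G \<Longrightarrow> V y \<le> V' y"
  shows "(\<integral>y. V y \<partial>p (x, f x)) \<le> (\<integral>y. V' y \<partial>p (x, f x))"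
  by (rule integral_mono_AE[OF kernel_weight_bounded(1)[OF assms(1,3,4)] kernel_weight_bounded(1)[OF assms(2,3,4)]])
    (use kernel_G[OF assms(3,4)] in \<open>eventually_elim, use assms(5) in auto\<close>)

lemma law_weight:
  assumes "f \<in> sel"
  shows "integrable (law f n) w" "(\<integral>x. w x \<partial>law f n) \<le> u n"
proof -
  show i: "integrable (law f n) w"
    using tail[OF assms, of n] w_nonneg
    by (intro integrableI_bounded) (auto simp: law_measurable[OF assms] w_measurable intro: le_less_trans)
  have "ennreal (\<integral>x. w x \<partial>law f n) \<le> ennreal (u n)"
    using tail[OF assms, of n] i w_nonneg by (subst nn_integral_eq_integral[symmetric]) auto
  then show "(\<integral>x. w x \<partial>law f n) \<le> u n" using u_nonneg by (simp add: ennreal_le_iff)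
qed

lemma law_weight_bounded:
  assumes "weight_bounded C V" "f \<in> sel"
  shows "integrable (law f n) V" "\<bar>\<integral>x. V x \<partial>law f n\<bar> \<le> C * u n"
proof -
  have ae: "AE y in law f n. \<bar>V y\<bar> \<le> C * w y"
    using law_G[OF assms(2)] by eventually_elim (rule weight_boundedD[OF assms(1)])
  have wi: "integrable (law f n) (\<lambda>y. C * w y)" using law_weight[OF assms(2)] by simp
  show i: "integrable (law f n) V"
    using ae weight_boundedD(2)[OF assms(1)]
    by (intro Bochner_Integration.integrable_bound[OF wi]) (auto simp: law_measurable[OF assms(2)])
  have "\<bar>\<integral>y. V y \<partial>law f n\<bar> \<le> (\<integral>y. C * w y \<partial>law f n)"
    using ae by (intro order_trans[OF integral_abs_bound] integral_mono_AE integrable_abs i wi)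
  also have "\<dots> \<le> C * u n"
    using law_weight(2)[OF assms(2)] weight_boundedD(1)[OF assms(1)] by (simp add: mult_left_mono)
  finally show "\<bar>\<integral>x. V x \<partial>law f n\<bar> \<le> C * u n" .
qed

lemma weight_bounded_kernel:
  assumes "weight_bounded C V" "f \<in> sel"
  shows "weight_bounded C (\<lambda>x. \<integral>y. V y \<partial>p (x, f x))"
  unfolding weight_bounded_def
proof (intro conjI ballI)
  fix x assume x: "x \<in> G"
  have "C * (w x - live x) \<le> C * w x"
    using weight_boundedD(1)[OF assms(1)] by (intro mult_left_mono) auto
  then show "\<bar>\<integral>y. V y \<partial>p (x, f x)\<bar> \<le> C * w x"
    using kernel_weight_bounded(2)[OF assms(1) x assms(2)] by linarith
qed (use weight_boundedD(1,2)[OF assms(1)] kernel_integral_measurable[OF assms(2)] in auto)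

lemma law_Suc_weight_bounded:
  assumes "weight_bounded C V" "f \<in> sel"
  shows "(\<integral>x. V x \<partial>law f (Suc n)) = (\<integral>x. \<integral>y. V y \<partial>p (x, f x) \<partial>law f n)"
proof -
  have [measurable]: "V \<in> borel_measurable S" using weight_boundedD[OF assms(1)] by simp
  have "(\<integral>\<^sup>+x. \<integral>\<^sup>+y. ennreal \<bar>V y\<bar> \<partial>p (x, f x) \<partial>law f n) = (\<integral>\<^sup>+y. ennreal \<bar>V y\<bar> \<partial>law f (Suc n))"
    unfolding state_law.simps by (rule nn_integral_bind[OF _ kernel_law[OF assms(2)], symmetric]) simp
  also have "\<dots> < \<infinity>"
    using law_weight_bounded(1)[OF assms, of "Suc n"] unfolding integrable_iff_bounded by simp
  finally show ?thesis
    unfolding state_law.simps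
    by (intro integral_bind_integrable(2)[OF _ kernel_law[OF assms(2)] law_ne[OF assms(2)]]) auto
qed

lemma weight_bounded_live: "0 \<le> C \<Longrightarrow> V \<in> borel_measurable S \<Longrightarrow> (\<And>x. x \<in> G \<Longrightarrow> \<bar>V x\<bar> \<le> C * live x) \<Longrightarrow> f \<in> sel \<Longrightarrow> weight_bounded C V"
  unfolding weight_bounded_def
proof (intro conjI ballI)
  fix x assume *: "0 \<le> C" "\<And>x. x \<in> G \<Longrightarrow> \<bar>V x\<bar> \<le> C * live x" "f \<in> sel" "x \<in> G"
  have "0 \<le> (\<integral>y. w y \<partial>p (x, f x))" using w_nonneg by (intro integral_nonneg_AE) auto
  then have "live x \<le> w x" using kernel_weight(2)[OF *(4,3)] by linarith
  then have "C * live x \<le> C * w x" using *(1) by (rule mult_left_mono)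
  then show "\<bar>V x\<bar> \<le> C * w x" using *(2)[OF *(4)] by linarith
qed

text \<open>Each step spent off \<open>xb\<close> lowers the expected weight by its probability, so a telescoping sum bounds
  the expected time off \<open>xb\<close> after time \<open>n\<close> by the expected weight at time \<open>n\<close>.\<close>

lemma live_sum:
  assumes "f \<in> sel"
  shows "(\<Sum>t<k. \<integral>x. live x \<partial>law f (n + t)) + (\<integral>x. w x \<partial>law f (n + k)) \<le> (\<integral>x. w x \<partial>law f n)"
proof (induction k)
  case (Suc k)
  have dw: "weight_bounded 1 w" using w_measurable w_nonneg by (auto simp: weight_bounded_def)
  have dl: "weight_bounded 1 live" using live_measurable assms by (intro weight_bounded_live) (auto split: split_indicator)
  have "(\<integral>x. live x \<partial>law f (n + k)) + (\<integral>x. w x \<partial>law f (Suc (n + k)))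
      = (\<integral>x. live x + (\<integral>y. w y \<partial>p (x, f x)) \<partial>law f (n + k))"
    unfolding law_Suc_weight_bounded[OF dw assms]
    by (rule Bochner_Integration.integral_add[symmetric])
      (rule law_weight_bounded(1)[OF dl assms] law_weight_bounded(1)[OF weight_bounded_kernel[OF dw assms] assms])+
  also have "\<dots> \<le> (\<integral>x. w x \<partial>law f (n + k))"
  proof (rule integral_mono_AE)
    show "AE x in law f (n + k). live x + (\<integral>y. w y \<partial>p (x, f x)) \<le> w x"
      using law_G[OF assms] by eventually_elim (rule kernel_weight(2)[OF _ assms])
  qed (intro Bochner_Integration.integrable_add law_weight_bounded(1)[OF dl assms]
        law_weight_bounded(1)[OF weight_bounded_kernel[OF dw assms] assms] law_weight(1)[OF assms])+
  finally show ?case using Suc by simp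
qed simp

lemma live_tail:
  assumes "f \<in> sel"
  shows "(\<Sum>t<k. \<integral>x. live x \<partial>law f (n + t)) \<le> u n"
proof -
  have "0 \<le> (\<integral>x. w x \<partial>law f (n + k))" using w_nonneg by (intro integral_nonneg_AE) auto
  then show ?thesis using live_sum[OF assms, of n k] law_weight(2)[OF assms, of n] by linarith
qed

lemma live_summable:
  assumes "f \<in> sel"
  shows "summable (\<lambda>t. \<integral>x. live x \<partial>law f (t + n))" "(\<Sum>t. \<integral>x. live x \<partial>law f (t + n)) \<le> u n"
proof -
  have nn: "0 \<le> (\<integral>x. live x \<partial>law f t)" for t by (intro integral_nonneg_AE) auto
  show s: "summable (\<lambda>t. \<integral>x. live x \<partial>law f (t + n))"
    using live_tail[OF assms, of n] by (intro summableI_nonneg_bounded[where x="u n"] nn) (simp add: add.commute)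
  show "(\<Sum>t. \<integral>x. live x \<partial>law f (t + n)) \<le> u n"
    using live_tail[OF assms, of n] by (intro suminf_le_const[OF s]) (simp add: add.commute)
qed

lemma inner_reward_bound:
  assumes "f \<in> sel" "x \<in> space S"
  shows "\<bar>c \<bullet> r (x, f x)\<bar> \<le> norm c * K * live x"
proof -
  have "\<bar>c \<bullet> r (x, f x)\<bar> \<le> norm c * norm (r (x, f x))" by (rule Cauchy_Schwarz_ineq2)
  also have "\<dots> \<le> norm c * (K * live x)"
    using reward_bound[OF assms(2) selD(2)[OF assms]] by (intro mult_left_mono) auto
  finally show ?thesis by simp
qed

lemma inner_reward_measurable: "f \<in> sel \<Longrightarrow> (\<lambda>x. c \<bullet> r (x, f x)) \<in> borel_measurable S"
  using reward_sel by simp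

lemma inner_reward_bounded: "f \<in> sel \<Longrightarrow> weight_bounded (norm c * K) (\<lambda>x. c \<bullet> r (x, f x))"
  using inner_reward_bound G_space inner_reward_measurable K_nonneg by (intro weight_bounded_live[of _ _ f]) auto

lemma inner_reward_law:
  assumes "f \<in> sel"
  shows "\<bar>\<integral>x. c \<bullet> r (x, f x) \<partial>law f t\<bar> \<le> norm c * K * (\<integral>x. live x \<partial>law f t)"
proof -
  have dl: "weight_bounded 1 live" using live_measurable assms by (intro weight_bounded_live) (auto split: split_indicator)
  have li: "integrable (law f t) (\<lambda>x. norm c * K * live x)" using law_weight_bounded(1)[OF dl assms] by simp
  have "\<bar>\<integral>x. c \<bullet> r (x, f x) \<partial>law f t\<bar> \<le> (\<integral>x. \<bar>c \<bullet> r (x, f x)\<bar> \<partial>law f t)" by (rule integral_abs_bound)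
  also have "\<dots> \<le> (\<integral>x. norm c * K * live x \<partial>law f t)"
    using law_weight_bounded(1)[OF inner_reward_bounded[OF assms] assms] inner_reward_bound[OF assms] law_space(3)[OF assms]
    by (intro integral_mono li) auto
  finally show ?thesis by simp
qed

lemma inner_reward_summable:
  assumes "f \<in> sel"
  shows "summable (\<lambda>t. \<integral>x. c \<bullet> r (x, f x) \<partial>law f (t + n))"
    "\<bar>\<Sum>t. \<integral>x. c \<bullet> r (x, f x) \<partial>law f (t + n)\<bar> \<le> norm c * K * u n"
proof -
  have s: "summable (\<lambda>t. norm c * K * (\<integral>x. live x \<partial>law f (t + n)))"
    using live_summable(1)[OF assms] by (rule summable_mult)
  show s1: "summable (\<lambda>t. \<integral>x. c \<bullet> r (x, f x) \<partial>law f (t + n))"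
    using inner_reward_law[OF assms] by (intro summable_comparison_test'[OF s]) auto
  have s2: "summable (\<lambda>t. \<bar>\<integral>x. c \<bullet> r (x, f x) \<partial>law f (t + n)\<bar>)"
    using inner_reward_law[OF assms] by (intro summable_comparison_test'[OF s]) auto
  have "\<bar>\<Sum>t. \<integral>x. c \<bullet> r (x, f x) \<partial>law f (t + n)\<bar> \<le> (\<Sum>t. \<bar>\<integral>x. c \<bullet> r (x, f x) \<partial>law f (t + n)\<bar>)"
    using s2 by (rule summable_rabs)
  also have "\<dots> \<le> (\<Sum>t. norm c * K * (\<integral>x. live x \<partial>law f (t + n)))"
    using inner_reward_law[OF assms] by (intro suminf_le s s2) auto
  also have "\<dots> = norm c * K * (\<Sum>t. \<integral>x. live x \<partial>law f (t + n))"
    using live_summable(1)[OF assms] by (rule suminf_mult)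
  also have "\<dots> \<le> norm c * K * u n"
    using live_summable(2)[OF assms] K_nonneg by (intro mult_left_mono) auto
  finally show "\<bar>\<Sum>t. \<integral>x. c \<bullet> r (x, f x) \<partial>law f (t + n)\<bar> \<le> norm c * K * u n" .
qed

definition perf :: "('x \<Rightarrow> 'a) \<Rightarrow> 'v" where
  "perf f = (\<Sum>t. \<integral>x. r (x, f x) \<partial>law f t)"

text \<open>Reduces questions on vectors of performances to scalar rewards.\<close>

lemma perf_inner:
  assumes "f \<in> sel"
  shows "c \<bullet> perf f = (\<Sum>t. \<integral>x. c \<bullet> r (x, f x) \<partial>law f t)"
proof -
  have i: "integrable (law f t) (\<lambda>x. r (x, f x))" for t
  proof -
    interpret prob_space "law f t" using law_space(1)[OF assms] .
    have "norm (r (x, f x)) \<le> K" if "x \<in> space S" for x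
      using reward_bound[OF that selD(2)[OF assms that]] K_nonneg by (auto split: split_indicator_asm)
    then show ?thesis
      using law_measurable[OF assms] law_space(3)[OF assms] reward_sel[OF assms]
      by (intro integrable_const_bound[where B=K]) auto
  qed
  have dl: "weight_bounded 1 live" using live_measurable assms by (intro weight_bounded_live) (auto split: split_indicator)
  have "summable (\<lambda>t. \<integral>x. r (x, f x) \<partial>law f t)"
  proof (rule summable_comparison_test')
    show "summable (\<lambda>t. K * (\<integral>x. live x \<partial>law f t))"
      using live_summable(1)[OF assms, of 0] by (intro summable_mult) simp
    fix t
    have "norm (\<integral>x. r (x, f x) \<partial>law f t) \<le> (\<integral>x. K * live x \<partial>law f t)"
      using reward_bound selD(2)[OF assms] law_space(3)[OF assms] law_weight_bounded(1)[OF dl assms]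
      by (intro order_trans[OF integral_norm_bound] integral_mono integrable_norm i) auto
    then show "norm (\<integral>x. r (x, f x) \<partial>law f t) \<le> K * (\<integral>x. live x \<partial>law f t)" by simp
  qed
  from bounded_linear.suminf[OF bounded_linear_inner_right this, of c]
  show ?thesis using i by (simp add: perf_def)
qed

section \<open>Bellman equation and conserving selectors\<close>

abbreviation between :: "('x \<Rightarrow> 'a) \<Rightarrow> ('x \<Rightarrow> 'a) \<Rightarrow> ('x \<Rightarrow> 'a) set" where
  "between f0 f1 \<equiv> selectors S A (\<lambda>x. {f0 x, f1 x})"

lemma betweenD:
  assumes "f \<in> between f0 f1"
  shows "f \<in> S \<rightarrow>\<^sub>M A" "\<And>x. x \<in> space S \<Longrightarrow> f x = f0 x \<or> f x = f1 x"
  using assms by (auto simp: selectors_def)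

lemma between_sel: "f0 \<in> sel \<Longrightarrow> f1 \<in> sel \<Longrightarrow> f \<in> between f0 f1 \<Longrightarrow> f \<in> sel"
  by (auto simp: selectors_def)

lemma between_mono: "g0 \<in> between f0 f1 \<Longrightarrow> g1 \<in> between f0 f1 \<Longrightarrow> f \<in> between g0 g1 \<Longrightarrow> f \<in> between f0 f1"
  by (fastforce simp: selectors_def)

definition action_value :: "'v \<Rightarrow> ('x \<Rightarrow> real) \<Rightarrow> 'x \<Rightarrow> 'a \<Rightarrow> real" where
  "action_value c V x a = c \<bullet> r (x, a) + (\<integral>y. V y \<partial>p (x, a))"

lemma action_value_measurable: "f \<in> sel \<Longrightarrow> V \<in> borel_measurable S \<Longrightarrow> (\<lambda>x. action_value c V x (f x)) \<in> borel_measurable S"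
  unfolding action_value_def by (intro borel_measurable_add inner_reward_measurable kernel_integral_measurable)

lemma action_value_bound:
  assumes "weight_bounded K V" "norm c \<le> 1" "f \<in> sel" "x \<in> G"
  shows "\<bar>action_value c V x (f x)\<bar> \<le> K * w x"
proof -
  have "\<bar>c \<bullet> r (x, f x)\<bar> \<le> norm c * (K * live x)"
    using inner_reward_bound[OF assms(3) G_space[OF assms(4)]] by (simp add: mult.assoc)
  also have "\<dots> \<le> 1 * (K * live x)"
    using assms(2) K_nonneg by (intro mult_right_mono) auto
  finally show ?thesis
    using kernel_weight_bounded(2)[OF assms(1,4,3)] unfolding action_value_def by (simp add: right_diff_distrib)
qed

lemma action_value_mono:
  assumes "weight_bounded C V" "weight_bounded C' V'" "x \<in> G" "f \<in> sel" "\<And>y. y \<in> G \<Longrightarrow> V y \<le> V' y"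
  shows "action_value c V x (f x) \<le> action_value c V' x (f x)"
  using kernel_integral_mono[OF assms] by (simp add: action_value_def)

text \<open>The reward term changes by at most \<open>K * norm (c - c')\<close> off \<open>xb\<close>, and the drift condition for \<open>w\<close>
  compensates exactly for this.\<close>

lemma action_value_lipschitz:
  assumes V: "weight_bounded C V" "weight_bounded C' V'" and x: "x \<in> G" and f: "f \<in> sel"
    and le: "\<And>y. y \<in> G \<Longrightarrow> \<bar>V y - V' y\<bar> \<le> K * norm (c - c') * w y"
  shows "\<bar>action_value c V x (f x) - action_value c' V' x (f x)\<bar> \<le> K * norm (c - c') * w x"
proof -
  have d: "weight_bounded (K * norm (c - c')) (\<lambda>y. V y - V' y)"
    using le weight_boundedD(2)[OF V(1)] weight_boundedD(2)[OF V(2)] K_nonneg by (auto simp: weight_bounded_def)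
  have e: "(\<integral>y. V y - V' y \<partial>p (x, f x)) = (\<integral>y. V y \<partial>p (x, f x)) - (\<integral>y. V' y \<partial>p (x, f x))"
    by (rule Bochner_Integration.integral_diff[OF kernel_weight_bounded(1)[OF V(1) x f] kernel_weight_bounded(1)[OF V(2) x f]])
  have "\<bar>(c - c') \<bullet> r (x, f x)\<bar> \<le> norm (c - c') * K * live x"
    by (rule inner_reward_bound[OF f G_space[OF x]])
  moreover have "\<bar>\<integral>y. V y - V' y \<partial>p (x, f x)\<bar> \<le> K * norm (c - c') * (w x - live x)"
    by (rule kernel_weight_bounded(2)[OF d x f])
  ultimately show ?thesis
    unfolding action_value_def e by (simp add: inner_diff_left algebra_simps)
qed

text \<open>Starting from the upper bound \<open>K * w\<close> makes the iterates decrease, so that they converge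
  although the rewards have no definite sign.\<close>

primrec value_iteration :: "'v \<Rightarrow> ('x \<Rightarrow> 'a) \<Rightarrow> ('x \<Rightarrow> 'a) \<Rightarrow> nat \<Rightarrow> 'x \<Rightarrow> real" where
  "value_iteration c f0 f1 0 = (\<lambda>x. K * w x)"
| "value_iteration c f0 f1 (Suc n) = (\<lambda>x. max (action_value c (value_iteration c f0 f1 n) x (f0 x)) (action_value c (value_iteration c f0 f1 n) x (f1 x)))"

definition value_fun :: "'v \<Rightarrow> ('x \<Rightarrow> 'a) \<Rightarrow> ('x \<Rightarrow> 'a) \<Rightarrow> 'x \<Rightarrow> real" where
  "value_fun c f0 f1 x = lim (\<lambda>n. value_iteration c f0 f1 n x)"

lemma perf_partial:
  assumes "f \<in> sel"
  shows "\<bar>c \<bullet> perf f - (\<Sum>t<n. \<integral>x. c \<bullet> r (x, f x) \<partial>law f t)\<bar> \<le> norm c * K * u n"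
  using suminf_split_initial_segment[OF inner_reward_summable(1)[OF assms, where c=c and n=0, simplified], of n]
    inner_reward_summable(2)[OF assms, where c=c and n=n] by (simp add: perf_inner[OF assms])

context
  fixes f0 f1 assumes f0: "f0 \<in> sel" and f1: "f1 \<in> sel"
begin

lemma value_iteration_bounded: "norm c \<le> 1 \<Longrightarrow> weight_bounded K (value_iteration c f0 f1 n)"
proof (induction n)
  case 0
  then show ?case using w_measurable w_nonneg K_nonneg by (auto simp: weight_bounded_def)
next
  case (Suc n)
  then have d: "weight_bounded K (value_iteration c f0 f1 n)" by simp
  have "\<bar>value_iteration c f0 f1 (Suc n) x\<bar> \<le> K * w x" if "x \<in> G" for x
    using action_value_bound[OF d Suc(2) f0 that] action_value_bound[OF d Suc(2) f1 that] by auto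
  moreover have "value_iteration c f0 f1 (Suc n) \<in> borel_measurable S"
    using action_value_measurable[OF f0 weight_boundedD(2)[OF d]] action_value_measurable[OF f1 weight_boundedD(2)[OF d]] by simp
  ultimately show ?case using K_nonneg by (auto simp only: weight_bounded_def)
qed

lemma value_iteration_decreasing: "norm c \<le> 1 \<Longrightarrow> x \<in> G \<Longrightarrow> value_iteration c f0 f1 (Suc n) x \<le> value_iteration c f0 f1 n x"
proof (induction n arbitrary: x)
  case 0
  then show ?case
    using action_value_bound[OF value_iteration_bounded[of c 0] _ f0, of c x] action_value_bound[OF value_iteration_bounded[of c 0] _ f1, of c x] by (auto simp: abs_le_iff)
next
  case (Suc n)
  have "action_value c (value_iteration c f0 f1 (Suc n)) x (f x) \<le> action_value c (value_iteration c f0 f1 n) x (f x)" if "f \<in> sel" for f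
    using Suc by (intro action_value_mono[OF value_iteration_bounded value_iteration_bounded _ that]) (auto simp del: value_iteration.simps)
  from this[OF f0] this[OF f1] show ?case
    unfolding value_iteration.simps(2)[of c f0 f1 "Suc n"] value_iteration.simps(2)[of c f0 f1 n] by linarith
qed

lemma value_iteration_tendsto:
  assumes "norm c \<le> 1" "x \<in> G"
  shows "(\<lambda>n. value_iteration c f0 f1 n x) \<longlonglongrightarrow> value_fun c f0 f1 x"
proof -
  have "decseq (\<lambda>n. value_iteration c f0 f1 n x)"
    using value_iteration_decreasing[OF assms] by (rule decseq_SucI)
  moreover have "- (K * w x) \<le> value_iteration c f0 f1 n x" for n
    using weight_boundedD(3)[OF value_iteration_bounded[OF assms(1), of n] assms(2)] by linarith
  ultimately have "convergent (\<lambda>n. value_iteration c f0 f1 n x)"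
    by (metis decseq_convergent convergent_def)
  then show ?thesis unfolding value_fun_def by (simp add: convergent_LIMSEQ_iff)
qed

lemma value_bounded: assumes "norm c \<le> 1" shows "weight_bounded K (value_fun c f0 f1)"
  unfolding weight_bounded_def
proof (intro conjI ballI K_nonneg)
  show "value_fun c f0 f1 \<in> borel_measurable S"
    unfolding value_fun_def[abs_def] by (rule borel_measurable_lim_metric) (rule weight_boundedD(2)[OF value_iteration_bounded[OF assms]])
  fix x assume "x \<in> G"
  show "\<bar>value_fun c f0 f1 x\<bar> \<le> K * w x"
    by (rule tendsto_upperbound[OF tendsto_rabs[OF value_iteration_tendsto[OF assms \<open>x \<in> G\<close>]]])
      (use weight_boundedD(3)[OF value_iteration_bounded[OF assms] \<open>x \<in> G\<close>] in auto)
qed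

lemma value_bellman:
  assumes c: "norm c \<le> 1" and x: "x \<in> G"
  shows "value_fun c f0 f1 x = max (action_value c (value_fun c f0 f1) x (f0 x)) (action_value c (value_fun c f0 f1) x (f1 x))"
proof -
  have "(\<lambda>n. action_value c (value_iteration c f0 f1 n) x (f x)) \<longlonglongrightarrow> action_value c (value_fun c f0 f1) x (f x)" if f: "f \<in> sel" for f
    unfolding action_value_def
  proof (intro tendsto_add tendsto_const integral_dominated_convergence[where w="\<lambda>y. K * w y"])
    show "integrable (p (x, f x)) (\<lambda>y. K * w y)" using kernel_weight[OF x f] by simp
    show "AE y in p (x, f x). (\<lambda>n. value_iteration c f0 f1 n y) \<longlonglongrightarrow> value_fun c f0 f1 y"
      using kernel_G[OF x f] by eventually_elim (rule value_iteration_tendsto[OF c])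
    show "AE y in p (x, f x). norm (value_iteration c f0 f1 n y) \<le> K * w y" for n
      using kernel_G[OF x f] by eventually_elim (use weight_boundedD(3)[OF value_iteration_bounded[OF c]] in auto)
  qed (use weight_boundedD(2)[OF value_iteration_bounded[OF c]] weight_boundedD(2)[OF value_bounded[OF c]] kernel_measurable_cong[OF G_space[OF x] f] in auto)
  from tendsto_max[OF this[OF f0] this[OF f1]]
  have "(\<lambda>n. value_iteration c f0 f1 (Suc n) x) \<longlonglongrightarrow> max (action_value c (value_fun c f0 f1) x (f0 x)) (action_value c (value_fun c f0 f1) x (f1 x))"
    by simp
  moreover have "(\<lambda>n. value_iteration c f0 f1 (Suc n) x) \<longlonglongrightarrow> value_fun c f0 f1 x"
    using value_iteration_tendsto[OF c x] by (rule LIMSEQ_Suc)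
  ultimately show ?thesis by (rule LIMSEQ_unique[symmetric])
qed

lemma value_ge_action_value:
  assumes "norm c \<le> 1" "x \<in> G" "f \<in> between f0 f1"
  shows "action_value c (value_fun c f0 f1) x (f x) \<le> value_fun c f0 f1 x"
  using betweenD(2)[OF assms(3) G_space[OF assms(2)]] unfolding value_bellman[OF assms(1,2)] by auto

text \<open>All iterations start from the same function \<open>K * w\<close>, and the bound is preserved by each
  Bellman step.\<close>

lemma value_lipschitz:
  assumes c: "norm c \<le> 1" "norm c' \<le> 1" and x: "x \<in> G"
  shows "\<bar>value_fun c f0 f1 x - value_fun c' f0 f1 x\<bar> \<le> K * norm (c - c') * w x"
proof (rule tendsto_upperbound)
  show "(\<lambda>n. \<bar>value_iteration c f0 f1 n x - value_iteration c' f0 f1 n x\<bar>) \<longlonglongrightarrow> \<bar>value_fun c f0 f1 x - value_fun c' f0 f1 x\<bar>"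
    by (intro tendsto_rabs tendsto_diff value_iteration_tendsto c x)
  have "\<bar>value_iteration c f0 f1 n x - value_iteration c' f0 f1 n x\<bar> \<le> K * norm (c - c') * w x" for n
    using x
  proof (induction n arbitrary: x)
    case 0 then show ?case using w_nonneg K_nonneg by simp
  next
    case (Suc n)
    show ?case
      using action_value_lipschitz[OF value_iteration_bounded[OF c(1)] value_iteration_bounded[OF c(2)] Suc(2) f0 Suc(1)]
        action_value_lipschitz[OF value_iteration_bounded[OF c(1)] value_iteration_bounded[OF c(2)] Suc(2) f1 Suc(1)]
      by simp
  qed
  then show "\<forall>\<^sub>F n in sequentially. \<bar>value_iteration c f0 f1 n x - value_iteration c' f0 f1 n x\<bar> \<le> K * norm (c - c') * w x" by simp
qed simp

text \<open>The amount by which one step with \<open>f\<close> falls short of the Bellman maximum; \<open>f\<close> is conserving at \<open>x\<close> if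
  this is zero.\<close>

definition loss :: "'v \<Rightarrow> ('x \<Rightarrow> 'a) \<Rightarrow> 'x \<Rightarrow> real" where
  "loss c f x = value_fun c f0 f1 x - action_value c (value_fun c f0 f1) x (f x)"

lemma loss_nonneg: "norm c \<le> 1 \<Longrightarrow> f \<in> between f0 f1 \<Longrightarrow> x \<in> G \<Longrightarrow> 0 \<le> loss c f x"
  using value_ge_action_value by (simp add: loss_def)

lemma loss_bounded:
  assumes "norm c \<le> 1" "f \<in> between f0 f1"
  shows "weight_bounded (2 * K) (loss c f)"
  unfolding weight_bounded_def
proof (intro conjI ballI)
  have fs: "f \<in> sel" using between_sel[OF f0 f1 assms(2)] .
  show "0 \<le> 2 * K" using K_nonneg by simp
  show "loss c f \<in> borel_measurable S"
    using weight_boundedD(2)[OF value_bounded[OF assms(1)]] action_value_measurable[OF fs weight_boundedD(2)[OF value_bounded[OF assms(1)]]]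
    by (simp add: loss_def[abs_def])
  fix x assume x: "x \<in> G"
  show "\<bar>loss c f x\<bar> \<le> 2 * K * w x"
    using weight_boundedD(3)[OF value_bounded[OF assms(1)] x] action_value_bound[OF value_bounded[OF assms(1)] assms(1) fs x]
    unfolding loss_def by linarith
qed

lemma loss_telescope:
  assumes c: "norm c \<le> 1" and f: "f \<in> between f0 f1"
  shows "(\<Sum>t<n. (\<integral>x. c \<bullet> r (x, f x) \<partial>law f t) + (\<integral>x. loss c f x \<partial>law f t)) + (\<integral>x. value_fun c f0 f1 x \<partial>law f n)
    = (\<integral>x. value_fun c f0 f1 x \<partial>\<mu>)"
proof (induction n)
  case (Suc n)
  have fs: "f \<in> sel" using between_sel[OF f0 f1 f] .
  note vd = value_bounded[OF c]
  note i1 = law_weight_bounded(1)[OF inner_reward_bounded[OF fs] fs] and i2 = law_weight_bounded(1)[OF loss_bounded[OF c f] fs]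
    and i3 = law_weight_bounded(1)[OF weight_bounded_kernel[OF vd fs] fs]
  have "(\<integral>x. value_fun c f0 f1 x \<partial>law f n)
      = (\<integral>x. c \<bullet> r (x, f x) + loss c f x + (\<integral>y. value_fun c f0 f1 y \<partial>p (x, f x)) \<partial>law f n)"
    by (simp add: loss_def action_value_def)
  also have "\<dots> = (\<integral>x. c \<bullet> r (x, f x) \<partial>law f n) + (\<integral>x. loss c f x \<partial>law f n) + (\<integral>x. value_fun c f0 f1 x \<partial>law f (Suc n))"
    unfolding law_Suc_weight_bounded[OF vd fs]
    by (subst Bochner_Integration.integral_add[OF Bochner_Integration.integrable_add[OF i1 i2] i3],
        subst Bochner_Integration.integral_add[OF i1 i2]) simp
  finally show ?case using Suc by simp
qed simp

lemma perf_loss_partial: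
  assumes c: "norm c \<le> 1" and f: "f \<in> between f0 f1"
  shows "\<bar>c \<bullet> perf f + (\<Sum>t<n. \<integral>x. loss c f x \<partial>law f t) - (\<integral>x. value_fun c f0 f1 x \<partial>\<mu>)\<bar> \<le> 2 * K * u n"
proof -
  have fs: "f \<in> sel" using between_sel[OF f0 f1 f] .
  have "norm c * K * u n \<le> 1 * K * u n" using c K_nonneg u_nonneg by (intro mult_right_mono) auto
  then show ?thesis
    using loss_telescope[OF c f, of n] perf_partial[OF fs, where c=c and n=n] law_weight_bounded(2)[OF value_bounded[OF c] fs, of n]
    by (simp add: sum.distrib)
qed

lemma law_loss_nonneg:
  assumes "norm c \<le> 1" "f \<in> between f0 f1" 
  shows "0 \<le> (\<integral>x. loss c f x \<partial>law f t)"
proof (rule integral_nonneg_AE)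
  show "AE x in law f t. 0 \<le> loss c f x"
    using law_G[OF between_sel[OF f0 f1 assms(2)], of t]
    by eventually_elim (use loss_nonneg[OF assms] in auto)
qed

text \<open>The deficiency of a selector is the total expected loss along its trajectories. Uniform
  absorption makes the expected value at time \<open>n\<close> vanish in the limit of the telescoping sum.\<close>

lemma perf_loss_sums:
  assumes c: "norm c \<le> 1" and f: "f \<in> between f0 f1"
  shows "(\<lambda>t. \<integral>x. loss c f x \<partial>law f t) sums ((\<integral>x. value_fun c f0 f1 x \<partial>\<mu>) - c \<bullet> perf f)"
  unfolding sums_def
proof (rule tendstoI, goal_cases)
  case (1 e)
  have "(\<lambda>n. 2 * K * u n) \<longlonglongrightarrow> 2 * K * 0" by (intro tendsto_intros u_tendsto)
  then have "\<forall>\<^sub>F n in sequentially. 2 * K * u n < e" using 1 by (intro order_tendstoD) auto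
  then show ?case
  proof eventually_elim
    case (elim n)
    then show ?case using perf_loss_partial[OF c f, of n] unfolding dist_real_def by linarith
  qed
qed

lemma perf_le_value:
  assumes "norm c \<le> 1" "f \<in> between f0 f1"
  shows "c \<bullet> perf f \<le> (\<integral>x. value_fun c f0 f1 x \<partial>\<mu>)"
  using suminf_nonneg[OF sums_summable[OF perf_loss_sums[OF assms]] law_loss_nonneg[OF assms]]
    sums_unique[OF perf_loss_sums[OF assms]] by linarith

text \<open>The losses are nonnegative and their expectations sum to the deficiency \<open>0\<close>.\<close>

lemma conserving_ae:
  assumes c: "norm c \<le> 1" and f: "f \<in> between f0 f1" and eq: "c \<bullet> perf f = (\<integral>x. value_fun c f0 f1 x \<partial>\<mu>)"
  shows "AE x in law f t. loss c f x = 0"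
proof -
  have fs: "f \<in> sel" using between_sel[OF f0 f1 f] .
  have s: "(\<lambda>t. \<integral>x. loss c f x \<partial>law f t) sums 0" using perf_loss_sums[OF c f] eq by simp
  have "\<forall>t. (\<integral>x. loss c f x \<partial>law f t) = 0"
    using suminf_eq_zero_iff[OF sums_summable[OF s] law_loss_nonneg[OF c f]] sums_unique[OF s] by auto
  then have "(\<integral>x. loss c f x \<partial>law f t) = 0" by simp
  moreover have "AE x in law f t. 0 \<le> loss c f x"
    using law_G[OF fs] by eventually_elim (use loss_nonneg[OF c f] in auto)
  ultimately show ?thesis
    using integral_nonneg_eq_0_iff_AE[OF law_weight_bounded(1)[OF loss_bounded[OF c f] fs]] by blast
qed

definition greedy :: "'v \<Rightarrow> 'x \<Rightarrow> 'a" where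
  "greedy c x = (if action_value c (value_fun c f0 f1) x (f1 x) \<le> action_value c (value_fun c f0 f1) x (f0 x) then f0 x else f1 x)"

lemma greedy_between: assumes "norm c \<le> 1" shows "greedy c \<in> between f0 f1"
  unfolding selectors_def
proof (intro CollectI conjI)
  have [measurable]: "(\<lambda>x. action_value c (value_fun c f0 f1) x (f1 x)) \<in> borel_measurable S" "(\<lambda>x. action_value c (value_fun c f0 f1) x (f0 x)) \<in> borel_measurable S"
    using action_value_measurable f0 f1 weight_boundedD(2)[OF value_bounded[OF assms]] by auto
  have [measurable]: "f0 \<in> S \<rightarrow>\<^sub>M A" "f1 \<in> S \<rightarrow>\<^sub>M A" using f0 f1 selD by auto
  show "greedy c \<in> S \<rightarrow>\<^sub>M A" unfolding greedy_def[abs_def] by measurable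
qed (auto simp: greedy_def)

lemma greedy_loss: "norm c \<le> 1 \<Longrightarrow> x \<in> G \<Longrightarrow> loss c (greedy c) x = 0"
  using value_bellman[of c x] by (simp add: loss_def greedy_def)

text \<open>Values and action values are Lipschitz in the direction, with a constant proportional to the
  weight.\<close>

lemma near_conserving:
  assumes c: "norm c \<le> 1" "norm d \<le> 1" and x: "x \<in> G" and f: "f \<in> between f0 f1"
    and eq: "f x = greedy d x"
  shows "loss c f x \<le> 2 * K * norm (c - d) * w x"
proof -
  have fs: "f \<in> sel" using between_sel[OF f0 f1 f] .
  have 1: "\<bar>value_fun c f0 f1 x - value_fun d f0 f1 x\<bar> \<le> K * norm (c - d) * w x" by (rule value_lipschitz[OF c x])
  have 2: "\<bar>action_value c (value_fun c f0 f1) x (f x) - action_value d (value_fun d f0 f1) x (f x)\<bar> \<le> K * norm (c - d) * w x"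
    by (rule action_value_lipschitz[OF value_bounded[OF c(1)] value_bounded[OF c(2)] x fs value_lipschitz[OF c]])
  have "loss d f x = 0" using greedy_loss[OF c(2) x] unfolding loss_def eq .
  then show ?thesis using 1 2 unfolding loss_def by linarith
qed

text \<open>The loss of an almost conserving selector is small only relative to \<open>w\<close>, and the expected weights need
  not be summable over time. Thus one first fixes a horizon \<open>n\<close> after which everything is small by
  uniform absorption, and then chooses \<open>\<eta>\<close> to control the losses up to time \<open>n\<close>.\<close>

lemma near_optimal:
  assumes e: "0 < e"
  shows "\<exists>\<eta>>0. \<forall>c f. norm c \<le> 1 \<longrightarrow> f \<in> between f0 f1 \<longrightarrow>
    (\<forall>x\<in>G. \<exists>d. norm d \<le> 1 \<and> norm (c - d) \<le> \<eta> \<and> f x = greedy d x) \<longrightarrow>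
    (\<integral>x. value_fun c f0 f1 x \<partial>\<mu>) - e \<le> c \<bullet> perf f"
proof -
  have "(\<lambda>n. 2 * K * u n) \<longlonglongrightarrow> 2 * K * 0" by (intro tendsto_intros u_tendsto)
  then have "\<forall>\<^sub>F n in sequentially. 2 * K * u n < e / 2" using e by (intro order_tendstoD) auto
  then obtain n where n: "2 * K * u n < e / 2" by (auto simp: eventually_sequentially)
  define D where "D = 2 * K * (\<Sum>t<n. u t)"
  have D: "0 \<le> D" unfolding D_def using K_nonneg u_nonneg by (intro mult_nonneg_nonneg sum_nonneg) auto
  define \<eta> where "\<eta> = e / 2 / (D + 1)"
  have \<eta>: "0 < \<eta>" "\<eta> * D \<le> e / 2" using e D by (auto simp: \<eta>_def field_simps)
  show ?thesis
  proof (intro exI[of _ \<eta>] conjI allI impI \<eta>)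
    fix c f assume c: "norm c \<le> 1" and f: "f \<in> between f0 f1"
      and near: "\<forall>x\<in>G. \<exists>d. norm d \<le> 1 \<and> norm (c - d) \<le> \<eta> \<and> f x = greedy d x"
    have fs: "f \<in> sel" using between_sel[OF f0 f1 f] .
    have "loss c f x \<le> 2 * K * \<eta> * w x" if x: "x \<in> G" for x
    proof -
      from near x obtain d where d: "norm d \<le> 1" "norm (c - d) \<le> \<eta>" "f x = greedy d x" by blast
      have "2 * K * norm (c - d) * w x \<le> 2 * K * \<eta> * w x"
        using d K_nonneg w_nonneg by (intro mult_right_mono mult_left_mono) auto
      with near_conserving[OF c d(1) x f d(3)] show ?thesis by linarith
    qed
    then have "weight_bounded (2 * K * \<eta>) (loss c f)"
      using loss_nonneg[OF c f] weight_boundedD(2)[OF loss_bounded[OF c f]] \<eta>(1) K_nonneg unfolding weight_bounded_def by auto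
    from law_weight_bounded(2)[OF this fs] have "(\<integral>x. loss c f x \<partial>law f t) \<le> 2 * K * \<eta> * u t" for t
      by (meson abs_le_D1)
    then have "(\<Sum>t<n. \<integral>x. loss c f x \<partial>law f t) \<le> (\<Sum>t<n. 2 * K * \<eta> * u t)" by (rule sum_mono)
    also have "\<dots> = \<eta> * D" by (simp add: D_def sum_distrib_left mult_ac)
    finally show "(\<integral>x. value_fun c f0 f1 x \<partial>\<mu>) - e \<le> c \<bullet> perf f"
      using perf_loss_partial[OF c f, of n] n \<eta>(2) by linarith
  qed
qed

end

section \<open>Continuity of the performance under changes on finite sets\<close>

lemma finite_null:
  assumes "finite N" "N \<subseteq> space S - {xb}"
  shows "AE x in \<mu>. x \<notin> N" "x \<in> space S \<Longrightarrow> f \<in> sel \<Longrightarrow> AE y in p (x, f x). y \<notin> N"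
proof -
  have *: "AE y in M. y \<notin> N" if M: "sets M = sets S" "\<And>y. y \<in> space S - {xb} \<Longrightarrow> emeasure M {y} = 0" for M
  proof -
    have "AE y in M. y \<noteq> z" if z: "z \<in> N" for z
      using z assms(2) M singletons[of z]
      by (intro AE_I[of _ _ "{z}"]) auto
    then have "AE y in M. \<forall>z\<in>N. y \<noteq> z" using assms(1) by (simp add: AE_ball_countable countable_finite)
    then show ?thesis by eventually_elim auto
  qed
  show "AE x in \<mu>. x \<notin> N"
    using initial initial_atomless by (intro *) (auto simp: space_prob_algebra)
  show "x \<in> space S \<Longrightarrow> f \<in> sel \<Longrightarrow> AE y in p (x, f x). y \<notin> N"
    by (intro * kernel_prob_space transition_atomless) (auto dest: selD(2))
qed

lemma law_Suc_bounded:
  fixes g :: "'x \<Rightarrow> real"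
  assumes f: "f \<in> sel" and g: "g \<in> borel_measurable S" "\<And>x. x \<in> space S \<Longrightarrow> \<bar>g x\<bar> \<le> B"
  shows "(\<integral>x. g x \<partial>law f (Suc t)) = (\<integral>x. \<integral>y. g y \<partial>p (x, f x) \<partial>law f t)"
  unfolding state_law.simps
proof (rule integral_bind[OF g kernel_law[OF f]])
  show "finite_measure (law f t)" using law_space(1)[OF f] by (simp add: prob_space_def)
  show "AE x in law f t. emeasure (p (x, f x)) (space (p (x, f x))) \<le> ennreal 1"
    using kernel_prob_space(1)[OF _ f] law_space(3)[OF f, of t] prob_space.emeasure_le_1 by (intro AE_I2) auto
qed

text \<open>One step maps convergence off a finite set to convergence off the same
  finite set, since the kernels do not charge it.\<close>

lemma law_tendsto:
  fixes g :: "nat \<Rightarrow> 'x \<Rightarrow> real"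
  assumes fk: "\<And>k. fk k \<in> sel" and f: "f \<in> sel"
    and N: "finite N" "N \<subseteq> space S - {xb}"
    and fN: "\<And>x. x \<in> space S - N \<Longrightarrow> \<forall>\<^sub>F k in sequentially. fk k x = f x"
    and g: "\<And>k. g k \<in> borel_measurable S" "g' \<in> borel_measurable S"
    and B: "\<And>k x. x \<in> space S \<Longrightarrow> \<bar>g k x\<bar> \<le> B" "\<And>x. x \<in> space S \<Longrightarrow> \<bar>g' x\<bar> \<le> B"
    and gN: "\<And>x. x \<in> space S - N \<Longrightarrow> (\<lambda>k. g k x) \<longlonglongrightarrow> g' x"
  shows "(\<lambda>k. \<integral>x. g k x \<partial>law (fk k) t) \<longlonglongrightarrow> (\<integral>x. g' x \<partial>law f t)"
  using g B gN
proof (induction t arbitrary: g g')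
  case 0
  have m: "measurable \<mu> borel = measurable S borel"
    using initial by (intro measurable_cong_sets) (auto simp: space_prob_algebra)
  have s: "space \<mu> = space S" using initial by (auto simp: space_prob_algebra dest: sets_eq_imp_space_eq)
  interpret prob_space \<mu> using initial by (simp add: space_prob_algebra)
  show ?case unfolding state_law.simps
  proof (rule integral_dominated_convergence[where w="\<lambda>_. B"])
    show "AE x in \<mu>. (\<lambda>k. g k x) \<longlonglongrightarrow> g' x"
      using finite_null(1)[OF N] AE_space by eventually_elim (use 0(5) s in auto)
  qed (use 0 s m in auto)
next
  case (Suc t)
  have conv: "(\<lambda>k. \<integral>y. g k y \<partial>p (x, f x)) \<longlonglongrightarrow> (\<integral>y. g' y \<partial>p (x, f x))" if x: "x \<in> space S" for x
  proof -
    interpret prob_space "p (x, f x)" using kernel_prob_space[OF x f] by simp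
    have s: "space (p (x, f x)) = space S" using kernel_prob_space(2)[OF x f] by (rule sets_eq_imp_space_eq)
    show ?thesis
    proof (rule integral_dominated_convergence[where w="\<lambda>_. B"])
      show "AE y in p (x, f x). (\<lambda>k. g k y) \<longlonglongrightarrow> g' y"
        using finite_null(2)[OF N x f] AE_space by eventually_elim (use Suc(6) s in auto)
    qed (use Suc.prems s in \<open>auto simp: kernel_measurable_cong[OF x f]\<close>)
  qed
  have bd: "\<bar>\<integral>y. h y \<partial>p (x, f' x)\<bar> \<le> B"
    if x: "x \<in> space S" and f': "f' \<in> sel" and h: "h \<in> borel_measurable S" "\<And>y. y \<in> space S \<Longrightarrow> \<bar>h y\<bar> \<le> B" for x f' h
  proof -
    interpret prob_space "p (x, f' x)" using kernel_prob_space[OF x f'] by simp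
    have s: "space (p (x, f' x)) = space S" using kernel_prob_space(2)[OF x f'] by (rule sets_eq_imp_space_eq)
    have i: "integrable (p (x, f' x)) h"
      using h s by (intro integrable_const_bound[where B=B]) (auto simp: kernel_measurable_cong[OF x f'])
    have "\<bar>\<integral>y. h y \<partial>p (x, f' x)\<bar> \<le> (\<integral>y. \<bar>h y\<bar> \<partial>p (x, f' x))" by (rule integral_abs_bound)
    also have "\<dots> \<le> (\<integral>y. B \<partial>p (x, f' x))" using i h(2) s by (intro integral_mono) auto
    finally show ?thesis by (simp add: prob_space)
  qed
  have "(\<lambda>k. \<integral>x. \<integral>y. g k y \<partial>p (x, fk k x) \<partial>law (fk k) t) \<longlonglongrightarrow> (\<integral>x. \<integral>y. g' y \<partial>p (x, f x) \<partial>law f t)"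
  proof (rule Suc.IH)
    show "(\<lambda>k. \<integral>y. g k y \<partial>p (x, fk k x)) \<longlonglongrightarrow> (\<integral>y. g' y \<partial>p (x, f x))" if "x \<in> space S - N" for x
      by (rule Lim_transform_eventually[OF conv])
        (use that in \<open>auto intro: eventually_mono[OF fN]\<close>)
  qed (use Suc.prems kernel_integral_measurable fk f bd in auto)
  moreover have "(\<integral>x. g k x \<partial>law (fk k) (Suc t)) = (\<integral>x. \<integral>y. g k y \<partial>p (x, fk k x) \<partial>law (fk k) t)" for k
    by (rule law_Suc_bounded[OF fk Suc.prems(1,3)])
  moreover have "(\<integral>x. g' x \<partial>law f (Suc t)) = (\<integral>x. \<integral>y. g' y \<partial>p (x, f x) \<partial>law f t)"
    by (rule law_Suc_bounded[OF f Suc.prems(2,4)])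
  ultimately show ?case by (simp only:)
qed

text \<open>Each summand of the performance converges, and the remainders are uniformly small by uniform
  absorption.\<close>

lemma perf_tendsto:
  assumes fk: "\<And>k. fk k \<in> sel" and f: "f \<in> sel"
    and N: "finite N" "N \<subseteq> space S - {xb}"
    and fN: "\<And>x. x \<in> space S - N \<Longrightarrow> \<forall>\<^sub>F k in sequentially. fk k x = f x"
  shows "(\<lambda>k. perf (fk k)) \<longlonglongrightarrow> perf f"
proof -
  have step: "(\<lambda>k. \<integral>x. c \<bullet> r (x, fk k x) \<partial>law (fk k) t) \<longlonglongrightarrow> (\<integral>x. c \<bullet> r (x, f x) \<partial>law f t)" for c t
  proof (rule law_tendsto[OF fk f N fN, where B="norm c * K"])
    have "\<bar>c \<bullet> r (x, f' x)\<bar> \<le> norm c * K" if "f' \<in> sel" "x \<in> space S" for f' x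
      using inner_reward_bound[OF that, of c] K_nonneg by (auto split: split_indicator_asm)
    then show "\<bar>c \<bullet> r (x, fk k x)\<bar> \<le> norm c * K" "\<bar>c \<bullet> r (x, f x)\<bar> \<le> norm c * K" if "x \<in> space S" for k x
      using fk f that by auto
    show "(\<lambda>k. c \<bullet> r (x, fk k x)) \<longlonglongrightarrow> c \<bullet> r (x, f x)" if "x \<in> space S - N" for x
      by (rule Lim_transform_eventually[OF tendsto_const]) (auto intro: eventually_mono[OF fN[OF that]])
  qed (use fk f inner_reward_measurable in auto)
  have "(\<lambda>k. c \<bullet> perf (fk k)) \<longlonglongrightarrow> c \<bullet> perf f" for c
  proof (rule tendstoI, goal_cases)
    case (1 e)
    have "(\<lambda>n. norm c * K * u n) \<longlonglongrightarrow> norm c * K * 0" by (intro tendsto_intros u_tendsto)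
    then have "\<forall>\<^sub>F n in sequentially. norm c * K * u n < e / 3" using 1 by (intro order_tendstoD) auto
    then obtain n where n: "norm c * K * u n < e / 3" by (auto simp: eventually_sequentially)
    have "(\<lambda>k. \<Sum>t<n. \<integral>x. c \<bullet> r (x, fk k x) \<partial>law (fk k) t) \<longlonglongrightarrow> (\<Sum>t<n. \<integral>x. c \<bullet> r (x, f x) \<partial>law f t)"
      by (intro tendsto_sum step)
    from tendstoD[OF this, of "e / 3"] 1
    have "\<forall>\<^sub>F k in sequentially. dist (\<Sum>t<n. \<integral>x. c \<bullet> r (x, fk k x) \<partial>law (fk k) t) (\<Sum>t<n. \<integral>x. c \<bullet> r (x, f x) \<partial>law f t) < e / 3" by simp
    then show ?case
    proof eventually_elim
      case (elim k)
      then show ?case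
        using perf_partial[OF fk[of k], where c=c and n=n] perf_partial[OF f, where c=c and n=n] n
        unfolding dist_real_def by linarith
    qed
  qed
  then show ?thesis
    by (subst tendsto_componentwise_iff) (simp add: inner_commute)
qed

section \<open>Interior points by Brouwer's fixed point theorem\<close>

text \<open>The directions \<open>d\<close> of a list are tried in turn, and the first one whose bound \<open>2 - dist c d / \<eta>\<close>
  exceeds \<open>U x\<close> decides. As \<open>U\<close> takes values in \<open>[0, 1)\<close>, a direction closer to \<open>c\<close> than \<open>\<eta>\<close> is
  always accepted when its turn comes, and one farther away than \<open>2 * \<eta>\<close> never is. In between, the accepted set of states
  grows continuously as \<open>c\<close> approaches \<open>d\<close>.\<close>

primrec mix :: "real \<Rightarrow> ('v \<Rightarrow> 'x \<Rightarrow> 'a) \<Rightarrow> ('x \<Rightarrow> 'a) \<Rightarrow> 'v list \<Rightarrow> 'v \<Rightarrow> 'x \<Rightarrow> 'a" where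
  "mix \<eta> g f [] c x = f x"
| "mix \<eta> g f (d # ds) c x = (if U x < 2 - dist c d / \<eta> then g d x else mix \<eta> g f ds c x)"

lemma mix_between:
  assumes "f \<in> between f0 f1" "\<And>d. d \<in> set ds \<Longrightarrow> g d \<in> between f0 f1"
  shows "mix \<eta> g f ds c \<in> between f0 f1"
  using assms(2)
proof (induction ds)
  case Nil
  have "mix \<eta> g f [] c = f" by (rule ext) simp
  then show ?case using assms(1) by simp
next
  case (Cons d ds)
  then have *: "mix \<eta> g f ds c \<in> between f0 f1" "g d \<in> between f0 f1" by auto
  note [measurable] = betweenD(1)[OF *(1)] betweenD(1)[OF *(2)] U_measurable
  have "mix \<eta> g f (d # ds) c \<in> S \<rightarrow>\<^sub>M A"
    unfolding mix.simps(2)[abs_def] by measurable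
  then show ?case using betweenD(2)[OF *(1)] betweenD(2)[OF *(2)] by (auto simp: selectors_def)
qed

lemma mix_near:
  assumes "0 < \<eta>" "x \<in> space S" "\<exists>d\<in>set ds. dist c d < \<eta>"
  shows "\<exists>d\<in>set ds. dist c d \<le> 2 * \<eta> \<and> mix \<eta> g f ds c x = g d x"
  using assms(3)
proof (induction ds)
  case (Cons d ds)
  show ?case
  proof (cases "U x < 2 - dist c d / \<eta>")
    case True
    then have "dist c d / \<eta> \<le> 2" using U_range[OF assms(2)] by linarith
    then show ?thesis using True assms(1) by (auto simp: field_simps)
  next
    case False
    then have "1 \<le> dist c d / \<eta>" using U_range[OF assms(2)] by linarith
    then have "\<not> dist c d < \<eta>" using assms(1) by (auto simp: field_simps)
    then show ?thesis using Cons False by auto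
  qed
qed simp

lemma mix_eventually:
  assumes "(ck \<longlongrightarrow> c) sequentially" "\<And>d. d \<in> set ds \<Longrightarrow> U x \<noteq> 2 - dist c d / \<eta>" "\<eta> \<noteq> 0"
  shows "\<forall>\<^sub>F k in sequentially. mix \<eta> g f ds (ck k) x = mix \<eta> g f ds c x"
  using assms(2)
proof (induction ds)
  case (Cons d ds)
  have t: "(\<lambda>k. 2 - dist (ck k) d / \<eta>) \<longlonglongrightarrow> 2 - dist c d / \<eta>"
    by (intro tendsto_intros assms)
  have e: "\<forall>\<^sub>F k in sequentially. (U x < 2 - dist (ck k) d / \<eta>) = (U x < 2 - dist c d / \<eta>)"
  proof (cases "U x < 2 - dist c d / \<eta>")
    case True
    then show ?thesis using order_tendstoD(1)[OF t True] by (auto elim: eventually_mono)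
  next
    case False
    then have "2 - dist c d / \<eta> < U x" using Cons(2)[of d] by auto
    from order_tendstoD(2)[OF t this] show ?thesis using False by (auto elim!: eventually_mono)
  qed
  have "\<forall>\<^sub>F k in sequentially. mix \<eta> g f ds (ck k) x = mix \<eta> g f ds c x" using Cons by auto
  with e show ?case by eventually_elim auto
qed simp

text \<open>The action selected at \<open>x\<close> can jump at \<open>c\<close> only if \<open>U x\<close> equals one of the finitely many bounds, which by
  injectivity of \<open>U\<close> happens for finitely many states \<open>x\<close>.\<close>

lemma perf_mix_continuous:
  assumes f: "f \<in> between f0 f1" and g: "\<And>d. d \<in> set ds \<Longrightarrow> g d \<in> between f0 f1"
    and f0: "f0 \<in> sel" and f1: "f1 \<in> sel" and "\<eta> \<noteq> 0"
  shows "continuous_on T (\<lambda>c::'v. perf (mix \<eta> g f ds c))"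
proof (rule continuous_on_sequentiallyI)
  fix ck and c :: 'v assume ck: "ck \<longlonglongrightarrow> c"
  define N where "N = {x \<in> space S - {xb}. \<exists>d\<in>set ds. U x = 2 - dist c d / \<eta>}"
  have ms: "mix \<eta> g f ds c \<in> sel" for c using between_sel[OF f0 f1 mix_between[OF f g]] .
  have "finite (U ` N)"
    by (rule finite_subset[of _ "(\<lambda>d. 2 - dist c d / \<eta>) ` set ds"]) (auto simp: N_def)
  then have N: "finite N" "N \<subseteq> space S - {xb}"
    using inj_on_subset[OF U_inj, of N] by (auto simp: N_def intro: finite_imageD)
  show "(\<lambda>k. perf (mix \<eta> g f ds (ck k))) \<longlonglongrightarrow> perf (mix \<eta> g f ds c)"
  proof (rule perf_tendsto[OF ms ms N])
    fix x assume x: "x \<in> space S - N"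
    show "\<forall>\<^sub>F k in sequentially. mix \<eta> g f ds (ck k) x = mix \<eta> g f ds c x"
    proof (cases "x = xb")
      case True
      then have "mix \<eta> g f ds (ck k) x = mix \<eta> g f ds c x" for k
        using Act_xb selD(2)[OF ms] x by auto
      then show ?thesis by simp
    next
      case False
      then show ?thesis using x by (intro mix_eventually[OF ck _ \<open>\<eta> \<noteq> 0\<close>]) (auto simp: N_def)
    qed
  qed
qed

text \<open>Brouwer's theorem is applied on the unit ball of the direction space \<open>L\<close> of the affine hull. The
  ball is covered by finitely many small balls, and the greedy selectors for their centres are
  mixed.\<close>

lemma interior_attained:
  assumes f0: "f0 \<in> sel" and f1: "f1 \<in> sel"
    and v0: "v0 \<in> rel_interior (convex hull (perf ` between f0 f1))"
  shows "v0 \<in> perf ` between f0 f1"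
proof (rule ccontr)
  define W where "W = convex hull (perf ` between f0 f1)"
  assume nv: "v0 \<notin> perf ` between f0 f1"
  obtain \<delta> where \<delta>: "0 < \<delta>" "cball v0 \<delta> \<inter> affine hull W \<subseteq> W" and v0W: "v0 \<in> W"
    using v0 unfolding W_def[symmetric] mem_rel_interior_cball by auto
  \<comment> \<open>the linear space parallel to the affine hull; the ball is taken in it because near optimality
      in directions orthogonal to \<open>W\<close> carries no information\<close>
  define L where "L = (\<lambda>y. - v0 + y) ` (affine hull W)"
  have subL: "subspace L"
    unfolding L_def using v0W by (intro affine_diffs_subspace affine_affine_hull hull_inc)
  have WL: "y - v0 \<in> L" if "y \<in> W" for y
    using hull_inc[OF that, of affine] by (force simp: L_def)
  have LW: "v0 + c \<in> affine hull W" if "c \<in> L" for c using that by (auto simp: L_def)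
  define J where "J c = (\<integral>x. value_fun c f0 f1 x \<partial>\<mu>)" for c
  have J: "c \<bullet> y \<le> J c" if "norm c \<le> 1" "y \<in> W" for c y
  proof -
    have "W \<subseteq> {y. c \<bullet> y \<le> J c}"
      unfolding W_def using perf_le_value[OF f0 f1 that(1)]
      by (intro hull_minimal convex_halfspace_le) (auto simp: J_def)
    then show ?thesis using that(2) by auto
  qed
  obtain \<eta> where \<eta>: "0 < \<eta>" and near: "\<And>c f. norm c \<le> 1 \<Longrightarrow> f \<in> between f0 f1 \<Longrightarrow>
      (\<forall>x\<in>G. \<exists>d. norm d \<le> 1 \<and> norm (c - d) \<le> \<eta> \<and> f x = greedy f0 f1 d x) \<Longrightarrow> J c - \<delta> / 2 \<le> c \<bullet> perf f"
    using near_optimal[OF f0 f1, of "\<delta> / 2"] \<delta>(1) unfolding J_def by auto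
  define C where "C = cball 0 1 \<inter> L"
  have "0 \<in> C" using subspace_0[OF subL] by (simp add: C_def)
  then have "C \<noteq> {}" by blast
  have C: "compact C" "convex C" "C \<noteq> {}"
    using closed_subspace[OF subL] subspace_imp_convex[OF subL] \<open>C \<noteq> {}\<close>
    by (simp_all add: C_def compact_Int_closed convex_Int)
  obtain D where D: "finite D" "D \<subseteq> C" "C \<subseteq> (\<Union>d\<in>D. ball d (\<eta> / 2))"
  proof (rule compactE_image[OF C(1), of C "\<lambda>d. ball d (\<eta> / 2)"])
    show "C \<subseteq> (\<Union>d\<in>C. ball d (\<eta> / 2))" using \<eta> by force
  qed (use that in auto)
  obtain ds where ds: "set ds = D" using finite_list[OF D(1)] by auto
  have dn: "norm d \<le> 1" if "d \<in> set ds" for d using that ds D(2) by (auto simp: C_def)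
  define F where "F c = mix (\<eta> / 2) (greedy f0 f1) f0 ds c" for c
  have f00: "f0 \<in> between f0 f1" using selD[OF f0] by (auto simp: selectors_def)
  have gb: "greedy f0 f1 d \<in> between f0 f1" if "d \<in> set ds" for d by (rule greedy_between[OF f0 f1 dn[OF that]])
  have Fb: "F c \<in> between f0 f1" for c
    unfolding F_def by (rule mix_between[OF f00 gb])
  have FW: "perf (F c) \<in> W" for c unfolding W_def using Fb by (intro hull_inc) auto
  have opt: "J c - \<delta> / 2 \<le> c \<bullet> perf (F c)" if c: "c \<in> C" for c
  proof (rule near[OF _ Fb ballI])
    show "norm c \<le> 1" using c by (simp add: C_def)
    fix x assume x: "x \<in> G"
    have "\<exists>d\<in>set ds. dist c d < \<eta> / 2" using c D(3) ds by (force simp: dist_commute)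
    from mix_near[OF _ G_space[OF x] this, of "greedy f0 f1" f0] \<eta> dn
    show "\<exists>d. norm d \<le> 1 \<and> norm (c - d) \<le> \<eta> \<and> F c x = greedy f0 f1 d x"
      by (auto simp: F_def dist_norm)
  qed
  define H where "H c = - ((perf (F c) - v0) /\<^sub>R norm (perf (F c) - v0))" for c
  have nz: "perf (F c) - v0 \<noteq> 0" for c using nv Fb by auto
  have "continuous_on C (\<lambda>c. perf (F c))"
    unfolding F_def using \<eta> by (intro perf_mix_continuous[OF f00 gb f0 f1]) auto
  then have cH: "continuous_on C H"
    unfolding H_def using nz by (intro continuous_intros) auto
  have HC: "H \<in> C \<rightarrow> C"
    using nz WL[OF FW] subL by (auto simp: H_def C_def subspace_neg subspace_scale)
  obtain c where c: "c \<in> C" "H c = c" using brouwer[OF C cH HC] .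
  \<comment> \<open>a fixed point has norm \<open>1\<close> and points from \<open>F c\<close> towards \<open>v0\<close>\<close>
  have "norm (H c) = 1" using nz[of c] by (simp add: H_def)
  then have nc: "norm c = 1" using c(2) by simp
  \<comment> \<open>as \<open>v0\<close> is a relative interior point, the optimum in direction \<open>c\<close> exceeds \<open>c \<bullet> v0\<close> by \<open>\<delta>\<close>\<close>
  have "v0 + \<delta> *\<^sub>R c \<in> W"
  proof -
    have "\<delta> *\<^sub>R c \<in> L" using c subL by (auto simp: C_def subspace_scale)
    then have "v0 + \<delta> *\<^sub>R c \<in> affine hull W" by (rule LW)
    moreover have "v0 + \<delta> *\<^sub>R c \<in> cball v0 \<delta>" using nc \<delta> by (simp add: dist_norm)
    ultimately show ?thesis using \<delta>(2) by auto
  qed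
  from J[OF _ this, of c] have "c \<bullet> v0 + \<delta> \<le> J c"
    using nc by (simp add: inner_add_right dot_square_norm)
  with opt[OF c(1)] have pos: "0 < c \<bullet> (perf (F c) - v0)" using \<delta> by (simp add: inner_diff_right)
  have "perf (F c) - v0 = - (norm (perf (F c) - v0) *\<^sub>R H c)"
    using nz[of c] by (simp add: H_def)
  then have "perf (F c) - v0 = - (norm (perf (F c) - v0) *\<^sub>R c)" unfolding c(2) .
  then have "c \<bullet> (perf (F c) - v0) = - (norm (perf (F c) - v0) * (c \<bullet> c))"
    by (metis inner_minus_right inner_scaleR_right)
  then show False using pos by (simp add: dot_square_norm nc)
qed

section \<open>Boundary points by induction on the dimension\<close>

text \<open>Changing a selector where the process almost surely never is does not change the process.\<close>

lemma law_cong_AE: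
  assumes f: "f \<in> sel" and g: "g \<in> sel" and ae: "\<And>t. AE x in law f t. g x = f x"
  shows "law g t = law f t"
proof (induction t)
  case (Suc t)
  show ?case
    unfolding state_law.simps Suc
  proof (rule bind_cong_AE[OF refl _ kernel_law[OF f]])
    show "(\<lambda>x. p (x, g x)) \<in> law f t \<rightarrow>\<^sub>M subprob_algebra S"
      using kernel'[OF g] by (simp add: law_measurable[OF f])
    show "AE x in law f t. p (x, g x) = p (x, f x)"
      using ae[of t] by eventually_elim simp
  qed
qed simp

lemma perf_cong_AE:
  assumes f: "f \<in> sel" and g: "g \<in> sel" and ae: "\<And>t. AE x in law f t. g x = f x"
  shows "perf g = perf f"
proof -
  have "(\<integral>x. r (x, g x) \<partial>law g t) = (\<integral>x. r (x, f x) \<partial>law f t)" for t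
    unfolding law_cong_AE[OF assms]
  proof (rule integral_cong_AE)
    show "AE x in law f t. r (x, g x) = r (x, f x)" using ae[of t] by eventually_elim simp
  qed (use reward_sel[OF f] reward_sel[OF g] in \<open>auto simp: law_measurable[OF f]\<close>)
  then show ?thesis by (simp add: perf_def)
qed

text \<open>Replaces the actions of \<open>f\<close> that are not conserving in direction \<open>c\<close> by greedy ones.\<close>

definition conserve :: "('x \<Rightarrow> 'a) \<Rightarrow> ('x \<Rightarrow> 'a) \<Rightarrow> 'v \<Rightarrow> ('x \<Rightarrow> 'a) \<Rightarrow> 'x \<Rightarrow> 'a" where
  "conserve f0 f1 c f x = (if loss f0 f1 c f x = 0 then f x else greedy f0 f1 c x)"

context
  fixes f0 f1 and c :: 'v assumes f0: "f0 \<in> sel" and f1: "f1 \<in> sel" and c: "norm c \<le> 1"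
begin

lemma conserve_between:
  assumes f: "f \<in> between f0 f1"
  shows "conserve f0 f1 c f \<in> between f0 f1"
proof -
  note gb = greedy_between[OF f0 f1 c]
  note [measurable] = betweenD(1)[OF gb] betweenD(1)[OF f] weight_boundedD(2)[OF loss_bounded[OF f0 f1 c f]]
  have "conserve f0 f1 c f \<in> S \<rightarrow>\<^sub>M A" unfolding conserve_def[abs_def] by measurable
  then show ?thesis
    using betweenD(2)[OF gb] betweenD(2)[OF f] by (auto simp: selectors_def conserve_def)
qed

lemma self_between: "f0 \<in> between f0 f1" "f1 \<in> between f0 f1"
  using selD[OF f0] selD[OF f1] by (auto simp: selectors_def)

lemma conserve_loss:
  assumes f: "f \<in> between (conserve f0 f1 c f0) (conserve f0 f1 c f1)" and x: "x \<in> G"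
  shows "loss f0 f1 c f x = 0"
proof -
  have *: "loss f0 f1 c (conserve f0 f1 c g) x = 0" for g
    using greedy_loss[OF f0 f1 c x] by (auto simp: conserve_def loss_def[OF f0 f1])
  show ?thesis
    using betweenD(2)[OF f G_space[OF x]] *[of f0] *[of f1] by (auto simp: loss_def[OF f0 f1])
qed

text \<open>A selector between the two conserving ones loses nothing in any step.\<close>

lemma conserve_optimal:
  assumes f: "f \<in> between (conserve f0 f1 c f0) (conserve f0 f1 c f1)"
  shows "c \<bullet> perf f = (\<integral>x. value_fun c f0 f1 x \<partial>\<mu>)"
proof -
  have fb: "f \<in> between f0 f1"
    by (rule between_mono[OF conserve_between conserve_between f]) (rule self_between)+
  have "(\<integral>x. loss f0 f1 c f x \<partial>law f t) = 0" for t
  proof (rule integral_eq_zero_AE)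
    show "AE x in law f t. loss f0 f1 c f x = 0"
      using law_G[OF between_sel[OF f0 f1 fb], of t] by eventually_elim (rule conserve_loss[OF f])
  qed
  then have "(\<lambda>_. 0) sums ((\<integral>x. value_fun c f0 f1 x \<partial>\<mu>) - c \<bullet> perf f)"
    using perf_loss_sums[OF f0 f1 c fb] by simp
  from sums_unique2[OF sums_zero this] show ?thesis by simp
qed

text \<open>An optimal selector is almost surely conserving, so the modification takes place on null sets.\<close>

lemma optimal_conserve:
  assumes f: "f \<in> between f0 f1" and eq: "c \<bullet> perf f = (\<integral>x. value_fun c f0 f1 x \<partial>\<mu>)"
  shows "conserve f0 f1 c f \<in> between (conserve f0 f1 c f0) (conserve f0 f1 c f1)"
    "perf (conserve f0 f1 c f) = perf f"
proof -
  have fs: "f \<in> sel" using between_sel[OF f0 f1 f] .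
  have cs: "conserve f0 f1 c f \<in> sel" using between_sel[OF f0 f1 conserve_between[OF f]] .
  have "conserve f0 f1 c f x = conserve f0 f1 c f0 x \<or> conserve f0 f1 c f x = conserve f0 f1 c f1 x" if x: "x \<in> space S" for x
    using betweenD(2)[OF f x] by (auto simp: conserve_def loss_def[OF f0 f1])
  then show "conserve f0 f1 c f \<in> between (conserve f0 f1 c f0) (conserve f0 f1 c f1)"
    using selD(1)[OF cs] by (auto simp: selectors_def)
  have "AE x in law f t. conserve f0 f1 c f x = f x" for t
    using conserving_ae[OF f0 f1 c f eq, of t] by eventually_elim (simp add: conserve_def)
  then show "perf (conserve f0 f1 c f) = perf f" by (rule perf_cong_AE[OF fs cs])
qed

lemma greedy_optimal: "c \<bullet> perf (greedy f0 f1 c) = (\<integral>x. value_fun c f0 f1 x \<partial>\<mu>)"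
proof (rule conserve_optimal)
  have "greedy f0 f1 c x = conserve f0 f1 c f0 x \<or> greedy f0 f1 c x = conserve f0 f1 c f1 x" if "x \<in> space S" for x
    using betweenD(2)[OF greedy_between[OF f0 f1 c] that] by (auto simp: conserve_def)
  then show "greedy f0 f1 c \<in> between (conserve f0 f1 c f0) (conserve f0 f1 c f1)"
    using betweenD(1)[OF greedy_between[OF f0 f1 c]] by (auto simp: selectors_def)
qed

end

text \<open>Induction on the affine dimension. Interior points are attained by the fixed point argument. A
  point on the relative boundary maximizes some direction \<open>c\<close>, which confines every convex
  representation of it to conserving selectors and hence to a proper face.\<close>

theorem perf_between_convex_hull:
  assumes "f0 \<in> sel" "f1 \<in> sel"
  shows "convex hull (perf ` between f0 f1) \<subseteq> perf ` between f0 f1"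
  using assms
proof (induction "nat (aff_dim (perf ` between f0 f1) + 1)" arbitrary: f0 f1 rule: less_induct)
  case less
  note f0 = less(2) and f1 = less(3)
  define W where "W = perf ` between f0 f1"
  show ?case
    unfolding W_def[symmetric]
  proof
    fix v0 assume v0: "v0 \<in> convex hull W"
    show "v0 \<in> W"
    proof (cases "v0 \<in> rel_interior (convex hull W)")
      case True
      then show ?thesis using interior_attained[OF f0 f1] by (simp add: W_def)
    next
      case False
      obtain a where a: "a \<noteq> 0" "\<And>y. y \<in> convex hull W \<Longrightarrow> a \<bullet> v0 \<le> a \<bullet> y"
          "\<And>y. y \<in> rel_interior (convex hull W) \<Longrightarrow> a \<bullet> v0 < a \<bullet> y"
        using supporting_hyperplane_rel_boundary[OF convex_convex_hull v0 False] by blast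
      define c where "c = - (a /\<^sub>R norm a)"
      have c: "norm c \<le> 1" using a(1) by (simp add: c_def)
      have cle: "c \<bullet> y \<le> c \<bullet> v0" if "y \<in> convex hull W" for y
        using a(2)[OF that] a(1) by (simp add: c_def divide_simps)
      have clt: "c \<bullet> y < c \<bullet> v0" if "y \<in> rel_interior (convex hull W)" for y
        using a(3)[OF that] a(1) by (simp add: c_def divide_simps)
      define J where "J = (\<integral>x. value_fun c f0 f1 x \<partial>\<mu>)"
      have WJ: "c \<bullet> y \<le> J" if "y \<in> W" for y
        using that perf_le_value[OF f0 f1 c] by (auto simp: W_def J_def)
      define g0 where "g0 = conserve f0 f1 c f0"
      define g1 where "g1 = conserve f0 f1 c f1"
      have gb: "g0 \<in> between f0 f1" "g1 \<in> between f0 f1"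
        unfolding g0_def g1_def by (intro conserve_between[OF f0 f1 c] self_between[OF f0 f1 c])+
      have gs: "g0 \<in> sel" "g1 \<in> sel" using between_sel[OF f0 f1] gb by auto
      define W' where "W' = perf ` between g0 g1"
      have W'W: "W' \<subseteq> W" unfolding W'_def W_def using between_mono[OF gb] by auto
      have W'J: "W' \<subseteq> {y. c \<bullet> y = J}"
        unfolding W'_def g0_def g1_def J_def using conserve_optimal[OF f0 f1 c] by auto
      have WW': "y \<in> W'" if "y \<in> W" "c \<bullet> y = J" for y
      proof -
        obtain f where f: "f \<in> between f0 f1" "y = perf f" using \<open>y \<in> W\<close> by (auto simp: W_def)
        have "c \<bullet> perf f = (\<integral>x. value_fun c f0 f1 x \<partial>\<mu>)" using \<open>c \<bullet> y = J\<close> f(2) by (simp add: J_def)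
        note * = optimal_conserve[OF f0 f1 c f(1) this]
        show ?thesis
          unfolding W'_def g0_def g1_def f(2) by (rule image_eqI[where f=perf, OF *(2)[symmetric] *(1)])
      qed
      have "greedy f0 f1 c \<in> between f0 f1" by (rule greedy_between[OF f0 f1 c])
      then have "J \<le> c \<bullet> v0"
        using cle[OF hull_inc, of "perf (greedy f0 f1 c)"] greedy_optimal[OF f0 f1 c] by (auto simp: W_def J_def)
      obtain T m where T: "finite T" "T \<subseteq> W" "\<And>x. x \<in> T \<Longrightarrow> 0 \<le> m x" "sum m T = 1" "(\<Sum>x\<in>T. m x *\<^sub>R x) = v0"
        using v0 unfolding convex_hull_explicit by auto
      \<comment> \<open>\<open>v0\<close> attains the maximum \<open>J\<close> of \<open>c\<close>, hence so does every point of positive weight\<close>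
      have "(\<Sum>x\<in>T. m x * (J - c \<bullet> x)) = J * sum m T - c \<bullet> (\<Sum>x\<in>T. m x *\<^sub>R x)"
        by (simp add: inner_sum_right right_diff_distrib sum_subtractf sum_distrib_left mult_ac)
      then have "(\<Sum>x\<in>T. m x * (J - c \<bullet> x)) \<le> 0" using \<open>J \<le> c \<bullet> v0\<close> T by simp
      moreover have nn: "0 \<le> m x * (J - c \<bullet> x)" if "x \<in> T" for x
        using T(2,3) WJ that by (intro mult_nonneg_nonneg) auto
      ultimately have "(\<Sum>x\<in>T. m x * (J - c \<bullet> x)) = 0" by (intro antisym sum_nonneg) auto
      then have z: "m x * (J - c \<bullet> x) = 0" if "x \<in> T" for x
        using sum_nonneg_eq_0_iff[OF T(1), of "\<lambda>x. m x * (J - c \<bullet> x)"] nn that by auto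
      define T' where "T' = {x \<in> T. m x \<noteq> 0}"
      have T': "finite T'" "T' \<subseteq> W'" using T z WW' by (auto simp: T'_def)
      have "sum m T' = sum m T" "(\<Sum>x\<in>T'. m x *\<^sub>R x) = (\<Sum>x\<in>T. m x *\<^sub>R x)"
        using T(1) by (auto simp: T'_def intro!: sum.mono_neutral_left)
      then have "sum m T' = 1" "(\<Sum>x\<in>T'. m x *\<^sub>R x) = v0" using T(4,5) by simp_all
      then have v0W': "v0 \<in> convex hull W'"
        unfolding convex_hull_explicit using T' T(3) by (intro CollectI exI[of _ T'] exI[of _ m]) (auto simp: T'_def)
      have "affine hull W' \<subseteq> {y. c \<bullet> y = J}"
        using W'J by (rule hull_minimal) (rule affine_hyperplane)
      moreover obtain y where y: "y \<in> rel_interior (convex hull W)"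
        using rel_interior_eq_empty[OF convex_convex_hull, of W] v0 by auto
      moreover have "c \<bullet> v0 \<le> J"
        using v0 hull_minimal[of W "{y. c \<bullet> y \<le> J}" convex] WJ convex_halfspace_le[of c J] by auto
      moreover have "y \<in> affine hull W"
        using y rel_interior_subset convex_hull_subset_affine_hull by blast
      ultimately have "y \<in> affine hull W" "y \<notin> affine hull W'"
        using clt[OF y] by auto
      then have "affine hull W' \<subset> affine hull W"
        using hull_mono[OF W'W, of affine] by blast
      then have "aff_dim W' < aff_dim W" by (rule aff_dim_psubset)
      then have "nat (aff_dim W' + 1) < nat (aff_dim W + 1)" using aff_dim_geq[of W'] by linarith
      then have "convex hull W' \<subseteq> W'"
        unfolding W'_def W_def by (rule less(1)[OF _ gs])
      then show ?thesis using v0W' W'W by auto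
    qed
  qed
qed

end

section \<open>Trajectories of Markov decision processes under selectors\<close>

context MDP
begin

definition selector_policy :: "(nat \<Rightarrow> 'x \<Rightarrow> 'a) \<Rightarrow> nat \<Rightarrow> (nat \<Rightarrow> 'x \<times> 'a) \<times> 'x \<Rightarrow> 'a measure" where
  "selector_policy F t hx = return A (F t (snd hx))"

lemma hist_state: "(h, x) \<in> space (hist t) \<Longrightarrow> x \<in> space S"
  by (simp add: hist_def space_pair_measure)

lemma selector_policy_policies:
  assumes F: "\<And>t. F t \<in> selectors S A Av"
  shows "selector_policy F \<in> nonrandomized_Markov_policies"
proof -
  have Fm: "F t \<in> S \<rightarrow>\<^sub>M A" and Fv: "x \<in> space S \<Longrightarrow> F t x \<in> Av x" for t x
    using F by (auto simp: selectors_def)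
  have "selector_policy F t \<in> hist t \<rightarrow>\<^sub>M prob_algebra A" for t
  proof -
    have "snd \<in> hist t \<rightarrow>\<^sub>M S" unfolding hist_def by simp
    from measurable_compose[OF measurable_compose[OF this Fm] measurable_return_prob_space]
    show ?thesis unfolding selector_policy_def[abs_def] .
  qed
  moreover have "emeasure (selector_policy F t (h, x)) (Av x) = 1" if "(h, x) \<in> space (hist t)" for t h x
    using Fv[OF hist_state[OF that]] Av_sets[OF hist_state[OF that]] by (simp add: selector_policy_def)
  ultimately have "selector_policy F \<in> policies" by (auto simp: policies_def)
  moreover have "nonrandomized (selector_policy F)"
    unfolding nonrandomized_def
  proof (intro allI ballI)
    fix t hx assume hx: "hx \<in> space (hist t)"
    have "snd hx \<in> space S" using hx hist_state[of "fst hx" "snd hx"] by simp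
    then have a: "F t (snd hx) \<in> space A" using measurable_space[OF Fm] by blast
    have "{F t (snd hx)} \<in> sets A" using standard_borel_singleton[OF standard_borel_A a] .
    with a show "\<exists>a\<in>space A. emeasure (selector_policy F t hx) {a} = 1"
      by (intro bexI[of _ "F t (snd hx)"]) (auto simp: selector_policy_def)
  qed
  moreover have "Markov (selector_policy F)" by (auto simp: Markov_def selector_policy_def)
  ultimately show ?thesis by (simp add: nonrandomized_Markov_policies_def)
qed

context
  fixes \<pi> F
  assumes \<pi>: "\<pi> \<in> policies" and F: "\<And>t. F t \<in> selectors S A Av"
    and \<pi>F: "\<And>t h x. (h, x) \<in> space (hist t) \<Longrightarrow> \<pi> t (h, x) = return A (F t x)"
begin

interpretation IT: Ionescu_Tulcea "step_kernel \<pi>" "\<lambda>_. S \<Otimes>\<^sub>M A"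
  using Ionescu_Tulcea_step_kernel[OF \<pi>] .

lemma F_measurable: "F t \<in> S \<rightarrow>\<^sub>M A" using F by (simp add: selectors_def)

lemma F_pair[measurable]: "(\<lambda>x. (x, F t x)) \<in> S \<rightarrow>\<^sub>M S \<Otimes>\<^sub>M A"
  using F_measurable by simp

abbreviation start :: "nat \<Rightarrow> 'x \<times> 'a" where "start \<equiv> (\<lambda>_. undefined)"

text \<open>Given the state, the action is deterministic, so the step kernel is the image of the state kernel
  under the graph of the selector.\<close>

lemma nn_integral_step_kernel:
  assumes h: "h \<in> space (PiM {0..<t} (\<lambda>_. S \<Otimes>\<^sub>M A))" and g: "g \<in> borel_measurable (S \<Otimes>\<^sub>M A)"
  shows "(\<integral>\<^sup>+z. g z \<partial>step_kernel \<pi> t h) = (\<integral>\<^sup>+x. g (x, F t x) \<partial>state_kernel t h)"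
proof -
  have sk: "state_kernel t h \<in> space (prob_algebra S)"
    using measurable_space[OF state_kernel_measurable h] .
  then have ss: "sets (state_kernel t h) = sets S" by (simp add: space_prob_algebra)
  have sp: "space (state_kernel t h) = space S" using sets_eq_imp_space_eq[OF ss] .
  have "step_kernel \<pi> t h = state_kernel t h \<bind> (\<lambda>x. return (S \<Otimes>\<^sub>M A) (x, F t x))"
    unfolding step_kernel_def
  proof (rule bind_cong[OF refl])
    fix x assume "x \<in> space (state_kernel t h)"
    then have x: "x \<in> space S" by (simp add: sp)
    then have "(h, x) \<in> space (hist t)" using h by (simp add: hist_def space_pair_measure)
    then have "\<pi> t (h, x) = return A (F t x)" by (rule \<pi>F)
    moreover have "(\<lambda>a. return (S \<Otimes>\<^sub>M A) (x, a)) \<in> A \<rightarrow>\<^sub>M subprob_algebra (S \<Otimes>\<^sub>M A)"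
      using x by (intro measurable_compose[OF _ return_measurable]) simp
    moreover have "F t x \<in> space A" using measurable_space[OF F_measurable x] .
    ultimately show "\<pi> t (h, x) \<bind> (\<lambda>a. return (S \<Otimes>\<^sub>M A) (x, a)) = return (S \<Otimes>\<^sub>M A) (x, F t x)"
      using bind_return by (metis (no_types, lifting))
  qed
  moreover have k: "(\<lambda>x. return (S \<Otimes>\<^sub>M A) (x, F t x)) \<in> state_kernel t h \<rightarrow>\<^sub>M subprob_algebra (S \<Otimes>\<^sub>M A)"
    unfolding measurable_cong_sets[OF ss refl] by (rule measurable_compose[OF F_pair return_measurable])
  ultimately have "(\<integral>\<^sup>+z. g z \<partial>step_kernel \<pi> t h) = (\<integral>\<^sup>+x. \<integral>\<^sup>+z. g z \<partial>return (S \<Otimes>\<^sub>M A) (x, F t x) \<partial>state_kernel t h)"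
    using nn_integral_bind[OF g k] by (simp only:)
  also have "\<dots> = (\<integral>\<^sup>+x. g (x, F t x) \<partial>state_kernel t h)"
    using g measurable_space[OF F_pair] by (intro nn_integral_cong nn_integral_return) (auto simp: sp)
  finally show ?thesis .
qed

lemma start_space: "start \<in> space (PiM {0..<0} (\<lambda>_. S \<Otimes>\<^sub>M A))"
  by (simp add: space_PiM)

text \<open>The measure \<open>C 0 t\<close> of the Ionescu-Tulcea construction is the law of the first \<open>t\<close> coordinates; the
  statement disintegrates the law of \<open>t + 1\<close> coordinates with respect to the last one.\<close>

lemma nn_integral_C_Suc:
  assumes g: "(\<lambda>(h, z). g h z) \<in> borel_measurable (PiM {0..<t} (\<lambda>_. S \<Otimes>\<^sub>M A) \<Otimes>\<^sub>M (S \<Otimes>\<^sub>M A))"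
  shows "(\<integral>\<^sup>+h. g (restrict h {0..<t}) (h t) \<partial>IT.C 0 (Suc t) start)
       = (\<integral>\<^sup>+h. \<integral>\<^sup>+x. g h (x, F t x) \<partial>state_kernel t h \<partial>IT.C 0 t start)"
proof -
  have m: "(\<lambda>h. g (restrict h {0..<t}) (h t)) \<in> borel_measurable (PiM {0..<Suc t} (\<lambda>_. S \<Otimes>\<^sub>M A))"
  proof -
    have "(\<lambda>h. (restrict h {0..<t}, h t)) \<in> PiM {0..<Suc t} (\<lambda>_. S \<Otimes>\<^sub>M A) \<rightarrow>\<^sub>M PiM {0..<t} (\<lambda>_. S \<Otimes>\<^sub>M A) \<Otimes>\<^sub>M (S \<Otimes>\<^sub>M A)"
      by (intro measurable_Pair measurable_restrict measurable_component_singleton) auto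
    from measurable_compose[OF this g] show ?thesis by simp
  qed
  have sC: "sets (IT.C 0 t start) = sets (PiM {0..<t} (\<lambda>_. S \<Otimes>\<^sub>M A))"
    using IT.sets_C[OF start_space, of t] by simp
  have eP: "IT.eP (0 + t) \<in> IT.C 0 t start \<rightarrow>\<^sub>M subprob_algebra (PiM {0..<Suc t} (\<lambda>_. S \<Otimes>\<^sub>M A))"
    unfolding measurable_cong_sets[OF sC refl] add_0 by (rule IT.measurable_eP)
  have "(\<integral>\<^sup>+h. g (restrict h {0..<t}) (h t) \<partial>IT.C 0 (Suc t) start)
      = (\<integral>\<^sup>+h. \<integral>\<^sup>+h'. g (restrict h' {0..<t}) (h' t) \<partial>IT.eP t h \<partial>IT.C 0 t start)"
    using nn_integral_bind[OF m eP] by (simp only: IT.C.simps add_0)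
  also have "\<dots> = (\<integral>\<^sup>+h. \<integral>\<^sup>+x. g h (x, F t x) \<partial>state_kernel t h \<partial>IT.C 0 t start)"
  proof (rule nn_integral_cong)
    fix h assume "h \<in> space (IT.C 0 t start)"
    then have h: "h \<in> space (PiM {0..<t} (\<lambda>_. S \<Otimes>\<^sub>M A))" using IT.space_C[OF start_space] by simp
    then have r: "restrict (fun_upd h t z) {0..<t} = h" for z
      by (auto simp: space_PiM PiE_iff extensional_def)
    have "(\<integral>\<^sup>+h'. g (restrict h' {0..<t}) (h' t) \<partial>IT.eP t h) = (\<integral>\<^sup>+z. g h z \<partial>step_kernel \<pi> t h)"
      using IT.nn_integral_eP[OF h m] by (simp only: r fun_upd_same)
    also have "\<dots> = (\<integral>\<^sup>+x. g h (x, F t x) \<partial>state_kernel t h)"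
      using measurable_Pair2[OF g, of h] h by (intro nn_integral_step_kernel) auto
    finally show "(\<integral>\<^sup>+h'. g (restrict h' {0..<t}) (h' t) \<partial>IT.eP t h) = (\<integral>\<^sup>+x. g h (x, F t x) \<partial>state_kernel t h)" .
  qed
  finally show ?thesis .
qed

lemma law_in: "state_law p \<mu> F t \<in> space (prob_algebra S)"
  by (rule state_law_in_prob_algebra[where F=F, OF transition initial F_measurable])

text \<open>Under selectors the trajectory is a Markov chain, so the law of one coordinate is obtained by
  iterating the transition kernel.\<close>

lemma nn_integral_C_last:
  assumes "g \<in> borel_measurable (S \<Otimes>\<^sub>M A)"
  shows "(\<integral>\<^sup>+h. g (h t) \<partial>IT.C 0 (Suc t) start) = (\<integral>\<^sup>+x. g (x, F t x) \<partial>state_law p \<mu> F t)"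
  using assms
proof (induction t arbitrary: g)
  case 0
  have "(\<lambda>(h, z). g z) \<in> borel_measurable (PiM {0..<0} (\<lambda>_. S \<Otimes>\<^sub>M A) \<Otimes>\<^sub>M (S \<Otimes>\<^sub>M A))"
    unfolding split_def by (rule measurable_compose[OF measurable_snd 0])
  from nn_integral_C_Suc[OF this]
  have "(\<integral>\<^sup>+h. g (h 0) \<partial>IT.C 0 (Suc 0) start) = (\<integral>\<^sup>+h. \<integral>\<^sup>+x. g (x, F 0 x) \<partial>\<mu> \<partial>IT.C 0 0 start)"
    by (simp add: state_kernel_def)
  also have "\<dots> = (\<integral>\<^sup>+x. g (x, F 0 x) \<partial>\<mu>)"
    unfolding nn_integral_const prob_space.emeasure_space_1[OF IT.prob_space_C[OF start_space]] by simp
  finally show ?case by simp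
next
  case (Suc t)
  have m: "(\<lambda>x. g (x, F (Suc t) x)) \<in> borel_measurable S"
    by (rule measurable_compose[OF F_pair Suc(2)])
  have pm: "(\<lambda>z. \<integral>\<^sup>+x. g (x, F (Suc t) x) \<partial>p z) \<in> borel_measurable (S \<Otimes>\<^sub>M A)"
    by (rule measurable_compose[OF measurable_prob_algebraD[OF transition] nn_integral_measurable_subprob_algebra[OF m]])
  have "(\<lambda>(h, z). g z) \<in> borel_measurable (PiM {0..<Suc t} (\<lambda>_. S \<Otimes>\<^sub>M A) \<Otimes>\<^sub>M (S \<Otimes>\<^sub>M A))"
    unfolding split_def by (rule measurable_compose[OF measurable_snd Suc(2)])
  from nn_integral_C_Suc[OF this]
  have "(\<integral>\<^sup>+h. g (h (Suc t)) \<partial>IT.C 0 (Suc (Suc t)) start) = (\<integral>\<^sup>+h. \<integral>\<^sup>+x. g (x, F (Suc t) x) \<partial>p (h t) \<partial>IT.C 0 (Suc t) start)"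
    by (simp add: state_kernel_def)
  also have "\<dots> = (\<integral>\<^sup>+x. \<integral>\<^sup>+y. g (y, F (Suc t) y) \<partial>p (x, F t x) \<partial>state_law p \<mu> F t)"
    by (rule Suc.IH[OF pm])
  also have "\<dots> = (\<integral>\<^sup>+x. g (x, F (Suc t) x) \<partial>state_law p \<mu> F (Suc t))"
    by (rule state_law_Suc_nn_integral[where F=F, OF transition initial F_measurable m, symmetric])
  finally show ?case .
qed

lemma nn_integral_C_pair:
  assumes g: "(\<lambda>(z, z'). g z z') \<in> borel_measurable ((S \<Otimes>\<^sub>M A) \<Otimes>\<^sub>M (S \<Otimes>\<^sub>M A))"
  shows "(\<integral>\<^sup>+h. g (h t) (h (Suc t)) \<partial>IT.C 0 (Suc (Suc t)) start)
    = (\<integral>\<^sup>+x. \<integral>\<^sup>+y. g (x, F t x) (y, F (Suc t) y) \<partial>p (x, F t x) \<partial>state_law p \<mu> F t)"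
proof -
  have "(\<lambda>(h, z). g (h t) z) \<in> borel_measurable (PiM {0..<Suc t} (\<lambda>_. S \<Otimes>\<^sub>M A) \<Otimes>\<^sub>M (S \<Otimes>\<^sub>M A))"
  proof -
    have "(\<lambda>(h, z). (h t, z)) \<in> PiM {0..<Suc t} (\<lambda>_. S \<Otimes>\<^sub>M A) \<Otimes>\<^sub>M (S \<Otimes>\<^sub>M A) \<rightarrow>\<^sub>M (S \<Otimes>\<^sub>M A) \<Otimes>\<^sub>M (S \<Otimes>\<^sub>M A)"
      unfolding split_def
      by (intro measurable_Pair measurable_compose[OF measurable_fst measurable_component_singleton] measurable_snd) auto
    from measurable_compose[OF this g] show ?thesis by (simp add: split_def)
  qed
  from nn_integral_C_Suc[OF this]
  have "(\<integral>\<^sup>+h. g (h t) (h (Suc t)) \<partial>IT.C 0 (Suc (Suc t)) start)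
    = (\<integral>\<^sup>+h. \<integral>\<^sup>+y. g (h t) (y, F (Suc t) y) \<partial>p (h t) \<partial>IT.C 0 (Suc t) start)"
    by (simp add: state_kernel_def)
  also have "\<dots> = (\<integral>\<^sup>+x. \<integral>\<^sup>+y. g (x, F t x) (y, F (Suc t) y) \<partial>p (x, F t x) \<partial>state_law p \<mu> F t)"
  proof (rule nn_integral_C_last)
    have "(\<lambda>(z, y). g z (y, F (Suc t) y)) \<in> borel_measurable ((S \<Otimes>\<^sub>M A) \<Otimes>\<^sub>M S)"
    proof -
      have "(\<lambda>(z, y). (z, (y, F (Suc t) y))) \<in> (S \<Otimes>\<^sub>M A) \<Otimes>\<^sub>M S \<rightarrow>\<^sub>M (S \<Otimes>\<^sub>M A) \<Otimes>\<^sub>M (S \<Otimes>\<^sub>M A)"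
        unfolding split_def by (intro measurable_Pair1' measurable_Pair measurable_fst measurable_compose[OF measurable_snd F_pair] measurable_snd measurable_compose[OF measurable_snd F_measurable])
      from measurable_compose[OF this g] show ?thesis by (simp add: split_def)
    qed
    then show "(\<lambda>z. \<integral>\<^sup>+y. g z (y, F (Suc t) y) \<partial>p z) \<in> borel_measurable (S \<Otimes>\<^sub>M A)"
      by (rule nn_integral_measurable_subprob_algebra2[OF _ measurable_prob_algebraD[OF transition]])
  qed
  finally show ?thesis .
qed

lemma sets_P: "sets (P \<pi>) = sets (PiM UNIV (\<lambda>_. S \<Otimes>\<^sub>M A))"
  unfolding P_def by (rule IT.PF.sets_lim)

lemma nn_integral_P_finite:
  assumes g: "g \<in> borel_measurable (PiM {0..<n} (\<lambda>_. S \<Otimes>\<^sub>M A))"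
  shows "(\<integral>\<^sup>+\<omega>. g (restrict \<omega> {0..<n}) \<partial>P \<pi>) = (\<integral>\<^sup>+h. g h \<partial>IT.C 0 n start)"
proof -
  have up: "IT.up_to {0..<n} = n"
    using IT.up_to_iff_Ico[of "{0..<n}" n] IT.up_to_iff_Ico[of "{0..<n}" "IT.up_to {0..<n}"]
    by (intro antisym) (auto simp: ivl_subset)
  have CI: "IT.CI {0..<n} = IT.C 0 n start"
    using IT.distr_C[OF order_refl start_space, of n] unfolding IT.CI_def up by simp
  have d: "distr (P \<pi>) (PiM {0..<n} (\<lambda>_. S \<Otimes>\<^sub>M A)) (\<lambda>\<omega>. restrict \<omega> {0..<n}) = IT.C 0 n start"
    unfolding P_def using IT.distr_lim[of "{0..<n}"] CI by simp
  have m: "(\<lambda>\<omega>. restrict \<omega> {0..<n}) \<in> P \<pi> \<rightarrow>\<^sub>M PiM {0..<n} (\<lambda>_. S \<Otimes>\<^sub>M A)"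
    unfolding measurable_cong_sets[OF sets_P refl] by (intro measurable_restrict_subset) simp
  show ?thesis unfolding d[symmetric] by (rule nn_integral_distr[OF m, symmetric]) (use g in simp)
qed

lemma prob_space_P: "prob_space (P \<pi>)"
proof
  have "emeasure (P \<pi>) (space (P \<pi>)) = (\<integral>\<^sup>+h. 1 \<partial>IT.C 0 0 start)"
    using nn_integral_P_finite[of "\<lambda>_. 1" 0] by (simp del: IT.C.simps)
  also have "\<dots> = 1"
    unfolding nn_integral_const prob_space.emeasure_space_1[OF IT.prob_space_C[OF start_space]] by simp
  finally show "emeasure (P \<pi>) (space (P \<pi>)) = 1" .
qed

lemma nn_integral_P_coordinate:
  assumes g: "g \<in> borel_measurable (S \<Otimes>\<^sub>M A)"
  shows "(\<integral>\<^sup>+\<omega>. g (\<omega> t) \<partial>P \<pi>) = (\<integral>\<^sup>+x. g (x, F t x) \<partial>state_law p \<mu> F t)"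
proof -
  have "(\<lambda>h. h t) \<in> PiM {0..<Suc t} (\<lambda>_. S \<Otimes>\<^sub>M A) \<rightarrow>\<^sub>M S \<Otimes>\<^sub>M A"
    by (rule measurable_component_singleton) simp
  from measurable_compose[OF this g]
  have "(\<lambda>h. g (h t)) \<in> borel_measurable (PiM {0..<Suc t} (\<lambda>_. S \<Otimes>\<^sub>M A))" .
  from nn_integral_P_finite[OF this] show ?thesis by (simp add: nn_integral_C_last[OF g] del: IT.C.simps)
qed

lemma nn_integral_P_pair:
  assumes g: "(\<lambda>(z, z'). g z z') \<in> borel_measurable ((S \<Otimes>\<^sub>M A) \<Otimes>\<^sub>M (S \<Otimes>\<^sub>M A))"
  shows "(\<integral>\<^sup>+\<omega>. g (\<omega> t) (\<omega> (Suc t)) \<partial>P \<pi>)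
    = (\<integral>\<^sup>+x. \<integral>\<^sup>+y. g (x, F t x) (y, F (Suc t) y) \<partial>p (x, F t x) \<partial>state_law p \<mu> F t)"
proof -
  have "(\<lambda>h. (h t, h (Suc t))) \<in> PiM {0..<Suc (Suc t)} (\<lambda>_. S \<Otimes>\<^sub>M A) \<rightarrow>\<^sub>M (S \<Otimes>\<^sub>M A) \<Otimes>\<^sub>M (S \<Otimes>\<^sub>M A)"
    by (intro measurable_Pair measurable_component_singleton) auto
  from measurable_compose[OF this g]
  have "(\<lambda>h. g (h t) (h (Suc t))) \<in> borel_measurable (PiM {0..<Suc (Suc t)} (\<lambda>_. S \<Otimes>\<^sub>M A))" by simp
  from nn_integral_P_finite[OF this] show ?thesis by (simp add: nn_integral_C_pair[OF g] del: IT.C.simps)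
qed

lemma coordinate_measurable: "(\<lambda>\<omega>. \<omega> t) \<in> P \<pi> \<rightarrow>\<^sub>M S \<Otimes>\<^sub>M A"
  unfolding measurable_cong_sets[OF sets_P refl] by (rule measurable_component_singleton) simp

lemma distr_P_coordinate:
  "distr (P \<pi>) (S \<Otimes>\<^sub>M A) (\<lambda>\<omega>. \<omega> t) = distr (state_law p \<mu> F t) (S \<Otimes>\<^sub>M A) (\<lambda>x. (x, F t x))"
proof (rule measure_eqI)
  fix E assume "E \<in> sets (distr (P \<pi>) (S \<Otimes>\<^sub>M A) (\<lambda>\<omega>. \<omega> t))"
  then have E: "E \<in> sets (S \<Otimes>\<^sub>M A)" by simp
  have sl: "sets (state_law p \<mu> F t) = sets S" using law_in by (simp add: space_prob_algebra)
  have Fl: "(\<lambda>x. (x, F t x)) \<in> state_law p \<mu> F t \<rightarrow>\<^sub>M S \<Otimes>\<^sub>M A"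
    unfolding measurable_cong_sets[OF sl refl] by (rule F_pair)
  have i: "indicator E \<in> borel_measurable (S \<Otimes>\<^sub>M A)" using E by simp
  have "emeasure (distr (P \<pi>) (S \<Otimes>\<^sub>M A) (\<lambda>\<omega>. \<omega> t)) E = (\<integral>\<^sup>+z. indicator E z \<partial>distr (P \<pi>) (S \<Otimes>\<^sub>M A) (\<lambda>\<omega>. \<omega> t))"
    using E by simp
  also have "\<dots> = (\<integral>\<^sup>+\<omega>. indicator E (\<omega> t) \<partial>P \<pi>)"
    by (rule nn_integral_distr[OF coordinate_measurable]) (use E in simp)
  also have "\<dots> = (\<integral>\<^sup>+x. indicator E (x, F t x) \<partial>state_law p \<mu> F t)"
    by (rule nn_integral_P_coordinate[OF i])
  also have "\<dots> = (\<integral>\<^sup>+z. indicator E z \<partial>distr (state_law p \<mu> F t) (S \<Otimes>\<^sub>M A) (\<lambda>x. (x, F t x)))"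
    by (rule nn_integral_distr[OF Fl, symmetric]) (use E in simp)
  also have "\<dots> = emeasure (distr (state_law p \<mu> F t) (S \<Otimes>\<^sub>M A) (\<lambda>x. (x, F t x))) E"
    using E by simp
  finally show "emeasure (distr (P \<pi>) (S \<Otimes>\<^sub>M A) (\<lambda>\<omega>. \<omega> t)) E = emeasure (distr (state_law p \<mu> F t) (S \<Otimes>\<^sub>M A) (\<lambda>x. (x, F t x))) E" .
qed simp

end
end

context absorbing_MDP
begin

lemma xb_in_sets: "{xb} \<in> sets S"
  using standard_borel_singleton[OF standard_borel_S xb_state] .

lemma xb_absorbing:
  assumes "a \<in> Av xb"
  shows "r (xb, a) = 0" "prob_space (p (xb, a))" "sets (p (xb, a)) = sets S" "emeasure (p (xb, a)) {xb} = 1"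
proof -
  obtain ab where ab: "ab \<in> space A" "Av xb = {ab}" "emeasure (p (xb, ab)) {xb} = 1" "r (xb, ab) = 0"
    using absorbing_xb by auto
  then have a: "a = ab" using assms by simp
  have "p (xb, ab) \<in> space (prob_algebra S)"
    using ab(1) xb_state by (intro measurable_space[OF transition]) (simp add: space_pair_measure)
  then show "r (xb, a) = 0" "prob_space (p (xb, a))" "sets (p (xb, a)) = sets S" "emeasure (p (xb, a)) {xb} = 1"
    using ab a by (auto simp: space_prob_algebra)
qed

lemma xb_absorbing_AE:
  assumes "a \<in> Av xb"
  shows "AE y in p (xb, a). y = xb"
proof -
  interpret prob_space "p (xb, a)" using xb_absorbing[OF assms] by simp
  have "prob {xb} = 1" using xb_absorbing(4)[OF assms] by (simp add: measure_def)
  then show ?thesis using AE_prob_1[of "{xb}"] by simp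
qed

context
  fixes \<pi> F
  assumes \<pi>: "\<pi> \<in> policies" and F: "\<And>t. F t \<in> selectors S A Av"
    and \<pi>F: "\<And>t h x. (h, x) \<in> space (hist t) \<Longrightarrow> \<pi> t (h, x) = return A (F t x)"
begin

lemma AE_absorbed_step: "AE \<omega> in P \<pi>. fst (\<omega> t) = xb \<longrightarrow> fst (\<omega> (Suc t)) = xb"
proof -
  let ?g = "\<lambda>z z'. indicator {xb} (fst z) * indicator (space S - {xb}) (fst z') :: ennreal"
  have m1: "indicator {xb} \<in> borel_measurable S" "indicator (space S - {xb}) \<in> borel_measurable S" using xb_in_sets by auto
  have g: "(\<lambda>(z, z'). ?g z z') \<in> borel_measurable ((S \<Otimes>\<^sub>M A) \<Otimes>\<^sub>M (S \<Otimes>\<^sub>M A))"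
    unfolding split_def
    by (intro borel_measurable_times_ennreal measurable_compose[OF _ m1(1)] measurable_compose[OF _ m1(2)]
        measurable_compose[OF measurable_fst measurable_fst] measurable_compose[OF measurable_snd measurable_fst])
  have "(\<integral>\<^sup>+\<omega>. ?g (\<omega> t) (\<omega> (Suc t)) \<partial>P \<pi>)
      = (\<integral>\<^sup>+x. \<integral>\<^sup>+y. ?g (x, F t x) (y, F (Suc t) y) \<partial>p (x, F t x) \<partial>state_law p \<mu> F t)"
    by (rule nn_integral_P_pair[where F=F, OF \<pi> F \<pi>F g])
  also have "\<dots> = (\<integral>\<^sup>+x. 0 \<partial>state_law p \<mu> F t)"
  proof (rule nn_integral_cong)
    fix x assume "x \<in> space (state_law p \<mu> F t)"
    show "(\<integral>\<^sup>+y. ?g (x, F t x) (y, F (Suc t) y) \<partial>p (x, F t x)) = 0"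
    proof (cases "x = xb")
      case True
      have "F t xb \<in> Av xb" using F[of t] xb_state by (simp add: selectors_def)
      from xb_absorbing_AE[OF this] have "AE y in p (x, F t x). ?g (x, F t x) (y, F (Suc t) y) = 0"
        unfolding True by eventually_elim simp
      then show ?thesis by (subst nn_integral_cong_AE[where v="\<lambda>_. 0"]) auto
    qed simp
  qed
  finally have z: "(\<integral>\<^sup>+\<omega>. ?g (\<omega> t) (\<omega> (Suc t)) \<partial>P \<pi>) = 0" by simp
  note cm = coordinate_measurable[where F=F, OF \<pi> F \<pi>F]
  have "(\<lambda>\<omega>. ?g (\<omega> t) (\<omega> (Suc t))) \<in> borel_measurable (P \<pi>)"
    by (intro borel_measurable_times_ennreal measurable_compose[OF _ m1(1)] measurable_compose[OF _ m1(2)]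
        measurable_compose[OF cm measurable_fst])
  from nn_integral_0_iff_AE[OF this] z
  have "AE \<omega> in P \<pi>. ?g (\<omega> t) (\<omega> (Suc t)) = 0" by simp
  then show ?thesis using AE_space
  proof eventually_elim
    case (elim \<omega>)
    have "fst (\<omega> (Suc t)) \<in> space S"
      using measurable_space[OF measurable_compose[OF cm measurable_fst] elim(2), of "Suc t"] .
    then show ?case using elim(1) by (auto simp: indicator_def split: if_splits)
  qed
qed

text \<open>Once at \<open>xb\<close>, the process almost surely stays there, so that not having hit \<open>xb\<close> up to time \<open>t\<close> is the
  same as not being at \<open>xb\<close> at time \<open>t\<close>.\<close>

lemma AE_hitting_time: "AE \<omega> in P \<pi>. \<forall>t. enat t < hitting_time xb \<omega> \<longleftrightarrow> fst (\<omega> t) \<noteq> xb"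
proof -
  have "AE \<omega> in P \<pi>. \<forall>t. fst (\<omega> t) = xb \<longrightarrow> fst (\<omega> (Suc t)) = xb"
    using AE_absorbed_step by (simp add: AE_all_countable)
  then show ?thesis
  proof eventually_elim
    case (elim \<omega>)
    show ?case
    proof
      fix t
      have stay: "fst (\<omega> (s + k)) = xb" if "fst (\<omega> s) = xb" for s k
        using that elim by (induction k) auto
      show "enat t < hitting_time xb \<omega> \<longleftrightarrow> fst (\<omega> t) \<noteq> xb"
      proof
        assume "enat t < hitting_time xb \<omega>"
        then show "fst (\<omega> t) \<noteq> xb"
          unfolding hitting_time_def using Inf_lower[of "enat t" "enat ` {t. fst (\<omega> t) = xb}"] by (auto simp: not_le[symmetric])
      next
        assume ne: "fst (\<omega> t) \<noteq> xb"
        have "enat (Suc t) \<le> hitting_time xb \<omega>"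
          unfolding hitting_time_def
        proof (rule Inf_greatest)
          fix e assume "e \<in> enat ` {t. fst (\<omega> t) = xb}"
          then obtain s where s: "e = enat s" "fst (\<omega> s) = xb" by auto
          have "\<not> s \<le> t" using stay[OF s(2), of "t - s"] ne by auto
          then show "enat (Suc t) \<le> e" using s by simp
        qed
        then show "enat t < hitting_time xb \<omega>"
          by (metis Suc_ile_eq)
      qed
    qed
  qed
qed

lemma live_law: "(\<integral>\<^sup>+\<omega>. indicator (- {xb}) (fst (\<omega> t)) \<partial>P \<pi>) = (\<integral>\<^sup>+x. indicator (- {xb}) x \<partial>state_law p \<mu> F t)"
proof -
  have "(indicator (- {xb}) :: 'x \<Rightarrow> ennreal) \<in> borel_measurable S"
    by (rule indicator_compl_singleton_measurable(2)[OF xb_in_sets])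
  from nn_integral_P_coordinate[where F=F, OF \<pi> F \<pi>F measurable_compose[OF measurable_fst this]]
  show ?thesis by simp
qed

lemma tail_law:
  "(\<integral>\<^sup>+\<omega>. (\<Sum>t. if enat (n + t) < hitting_time xb \<omega> then 1 else 0) \<partial>P \<pi>)
    = (\<Sum>t. \<integral>\<^sup>+x. indicator (- {xb}) x \<partial>state_law p \<mu> F (n + t))"
proof -
  have m: "(indicator (- {xb}) :: 'x \<Rightarrow> ennreal) \<in> borel_measurable S"
    by (rule indicator_compl_singleton_measurable(2)[OF xb_in_sets])
  have "(\<integral>\<^sup>+\<omega>. (\<Sum>t. if enat (n + t) < hitting_time xb \<omega> then 1 else 0) \<partial>P \<pi>)
      = (\<integral>\<^sup>+\<omega>. (\<Sum>t. indicator (- {xb}) (fst (\<omega> (n + t)))) \<partial>P \<pi>)"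
    using AE_hitting_time by (intro nn_integral_cong_AE) (auto elim!: eventually_mono intro!: suminf_cong)
  also have "\<dots> = (\<Sum>t. \<integral>\<^sup>+\<omega>. indicator (- {xb}) (fst (\<omega> (n + t))) \<partial>P \<pi>)"
    by (intro nn_integral_suminf measurable_compose[OF measurable_compose[OF coordinate_measurable[where F=F, OF \<pi> F \<pi>F] measurable_fst] m])
  finally show ?thesis by (simp add: live_law)
qed

text \<open>Since the reward vanishes at \<open>xb\<close>, the sum up to the hitting time is almost surely the full series,
  which is dominated by \<open>K\<close> times the time spent off \<open>xb\<close>.\<close>

lemma performance_law:
  assumes fin: "(\<Sum>t. \<integral>\<^sup>+x. indicator (- {xb}) x \<partial>state_law p \<mu> F t) < \<infinity>"
  shows "performance \<pi> = (\<Sum>t. \<integral>x. r (x, F t x) \<partial>state_law p \<mu> F t)"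
proof -
  note cm = coordinate_measurable[where F=F, OF \<pi> F \<pi>F]
  interpret prob_space "P \<pi>" by (rule prob_space_P[where F=F, OF \<pi> F \<pi>F])
  obtain K where K: "0 \<le> K" "\<And>z. z \<in> space (S \<Otimes>\<^sub>M A) \<Longrightarrow> norm (r z) \<le> K"
    using reward_bounded unfolding bounded_pos by (auto intro: less_imp_le)
  define g where "g z = (if fst z = xb then 0 else r z)" for z
  have gm: "g \<in> borel_measurable (S \<Otimes>\<^sub>M A)"
  proof -
    have "{z \<in> space (S \<Otimes>\<^sub>M A). fst z = xb} = fst -` {xb} \<inter> space (S \<Otimes>\<^sub>M A)" by auto
    then have "{z \<in> space (S \<Otimes>\<^sub>M A). fst z = xb} \<in> sets (S \<Otimes>\<^sub>M A)"
      using measurable_sets[OF measurable_fst xb_in_sets] by simp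
    then show ?thesis unfolding g_def[abs_def] using reward_measurable by (intro measurable_If) auto
  qed
  have gb: "norm (g z) \<le> K * indicator (- {xb}) (fst z)" if "z \<in> space (S \<Otimes>\<^sub>M A)" for z
    using K(2)[OF that] by (auto simp: g_def)
  have gK: "norm (g z) \<le> K" if "z \<in> space (S \<Otimes>\<^sub>M A)" for z
    using K that by (auto simp: g_def)
  have gwm: "(\<lambda>\<omega>. g (\<omega> t)) \<in> borel_measurable (P \<pi>)" for t by (rule measurable_compose[OF cm gm])
  have gi: "integrable (P \<pi>) (\<lambda>\<omega>. g (\<omega> t))" for t
    using gwm gK measurable_space[OF cm] by (intro integrable_const_bound[where B=K]) auto
  have nle: "(\<integral>\<^sup>+\<omega>. norm (g (\<omega> t)) \<partial>P \<pi>) \<le> ennreal K * (\<integral>\<^sup>+x. indicator (- {xb}) x \<partial>state_law p \<mu> F t)" for t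
  proof -
    have m: "(indicator (- {xb}) :: 'x \<Rightarrow> ennreal) \<in> borel_measurable S"
      by (rule indicator_compl_singleton_measurable(2)[OF xb_in_sets])
    have "(\<integral>\<^sup>+\<omega>. norm (g (\<omega> t)) \<partial>P \<pi>) \<le> (\<integral>\<^sup>+\<omega>. ennreal K * indicator (- {xb}) (fst (\<omega> t)) \<partial>P \<pi>)"
    proof (rule nn_integral_mono)
      fix \<omega> assume "\<omega> \<in> space (P \<pi>)"
      then have "norm (g (\<omega> t)) \<le> K * indicator (- {xb}) (fst (\<omega> t))" using gb measurable_space[OF cm] by blast
      then show "ennreal (norm (g (\<omega> t))) \<le> ennreal K * indicator (- {xb}) (fst (\<omega> t))"
        by (auto split: split_indicator_asm split_indicator intro: ennreal_leI)
    qed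
    also have "\<dots> = ennreal K * (\<integral>\<^sup>+\<omega>. indicator (- {xb}) (fst (\<omega> t)) \<partial>P \<pi>)"
      by (intro nn_integral_cmult measurable_compose[OF measurable_compose[OF cm measurable_fst] m])
    finally show ?thesis by (simp add: live_law)
  qed
  have "(\<Sum>t. \<integral>\<^sup>+\<omega>. norm (g (\<omega> t)) \<partial>P \<pi>) \<le> ennreal K * (\<Sum>t. \<integral>\<^sup>+x. indicator (- {xb}) x \<partial>state_law p \<mu> F t)"
    unfolding ennreal_suminf_cmult[symmetric] by (intro suminf_le nle) auto
  also have "\<dots> < \<infinity>" using fin by (simp add: ennreal_mult_less_top)
  finally have sf: "(\<Sum>t. \<integral>\<^sup>+\<omega>. norm (g (\<omega> t)) \<partial>P \<pi>) < \<infinity>" .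
  then have "(\<integral>\<^sup>+\<omega>. (\<Sum>t. ennreal (norm (g (\<omega> t)))) \<partial>P \<pi>) \<noteq> \<infinity>"
    using gwm by (subst nn_integral_suminf) auto
  then have "AE \<omega> in P \<pi>. (\<Sum>t. ennreal (norm (g (\<omega> t)))) \<noteq> \<infinity>"
    using gwm by (intro nn_integral_PInf_AE) auto
  then have as: "AE \<omega> in P \<pi>. summable (\<lambda>t. norm (g (\<omega> t)))"
    by eventually_elim (auto intro: summable_suminf_not_top)
  have si: "summable (\<lambda>t. \<integral>\<omega>. norm (g (\<omega> t)) \<partial>P \<pi>)"
  proof (rule summable_suminf_not_top)
    have "ennreal (\<integral>\<omega>. norm (g (\<omega> t)) \<partial>P \<pi>) = (\<integral>\<^sup>+\<omega>. norm (g (\<omega> t)) \<partial>P \<pi>)" for t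
      using gi by (intro nn_integral_eq_integral[symmetric]) auto
    then show "(\<Sum>t. ennreal (\<integral>\<omega>. norm (g (\<omega> t)) \<partial>P \<pi>)) \<noteq> top" using sf by simp
  qed auto
  have "performance \<pi> = (\<integral>\<omega>. (\<Sum>t. g (\<omega> t)) \<partial>P \<pi>)"
    unfolding performance_def
  proof (rule integral_cong_AE)
    have ae: "AE \<omega> in P \<pi>. (\<Sum>t. if enat t < hitting_time xb \<omega> then r (\<omega> t) else 0) = (\<Sum>t. g (\<omega> t))"
      using AE_hitting_time by eventually_elim (auto simp: g_def intro!: suminf_cong)
    then show "AE \<omega> in P \<pi>. (\<Sum>t. if enat t < hitting_time xb \<omega> then r (\<omega> t) else 0) = (\<Sum>t. g (\<omega> t))" .
    show "(\<lambda>\<omega>. \<Sum>t. g (\<omega> t)) \<in> borel_measurable (P \<pi>)" using gwm by (rule borel_measurable_suminf)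
    have hm: "Measurable.pred (P \<pi>) (\<lambda>\<omega>. enat t < hitting_time xb \<omega>)" for t
    proof -
      have "enat t < hitting_time xb \<omega> \<longleftrightarrow> (\<forall>s\<in>{..t}. fst (\<omega> s) \<noteq> xb)" for \<omega>
      proof
        assume l: "enat t < hitting_time xb \<omega>"
        show "\<forall>s\<in>{..t}. fst (\<omega> s) \<noteq> xb"
        proof (intro ballI notI)
          fix s assume "s \<in> {..t}" "fst (\<omega> s) = xb"
          then have "hitting_time xb \<omega> \<le> enat s" "enat s \<le> enat t" unfolding hitting_time_def by (auto intro!: Inf_lower)
          then show False using l by (meson leD order_trans)
        qed
      next
        assume *: "\<forall>s\<in>{..t}. fst (\<omega> s) \<noteq> xb"
        have "enat (Suc t) \<le> hitting_time xb \<omega>"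
          unfolding hitting_time_def using * by (intro Inf_greatest) (auto simp: not_less_eq_eq[symmetric])
        then show "enat t < hitting_time xb \<omega>" by (metis Suc_ile_eq)
      qed
      moreover have "Measurable.pred (P \<pi>) (\<lambda>\<omega>. fst (\<omega> s) \<noteq> xb)" for s
      proof -
        have "(\<lambda>\<omega>. fst (\<omega> s)) -` {xb} \<inter> space (P \<pi>) \<in> sets (P \<pi>)"
          by (rule measurable_sets[OF measurable_compose[OF cm measurable_fst] xb_in_sets])
        then have "Measurable.pred (P \<pi>) (\<lambda>\<omega>. fst (\<omega> s) = xb)"
          by (simp add: pred_def vimage_def Int_def conj_commute)
        then show ?thesis by (rule pred_intros_logic)
      qed
      ultimately show ?thesis by (simp only:) (intro pred_intros_finite finite_atMost; assumption)
    qed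
    show "(\<lambda>\<omega>. \<Sum>t. if enat t < hitting_time xb \<omega> then r (\<omega> t) else 0) \<in> borel_measurable (P \<pi>)"
      using hm measurable_compose[OF cm reward_measurable]
      by (intro borel_measurable_suminf measurable_If) (auto simp: pred_def)
  qed
  also have "\<dots> = (\<Sum>t. \<integral>\<omega>. g (\<omega> t) \<partial>P \<pi>)"
    by (rule integral_suminf[OF gi as si])
  also have "\<dots> = (\<Sum>t. \<integral>x. r (x, F t x) \<partial>state_law p \<mu> F t)"
  proof (rule suminf_cong)
    fix t
    have sl: "sets (state_law p \<mu> F t) = sets S" using law_in[where F=F, OF \<pi> F \<pi>F] by (simp add: space_prob_algebra)
    have Fl: "(\<lambda>x. (x, F t x)) \<in> state_law p \<mu> F t \<rightarrow>\<^sub>M S \<Otimes>\<^sub>M A"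
      unfolding measurable_cong_sets[OF sl refl] by (rule F_pair[where F=F, OF \<pi> F \<pi>F])
    have "(\<integral>\<omega>. g (\<omega> t) \<partial>P \<pi>) = (\<integral>z. g z \<partial>distr (P \<pi>) (S \<Otimes>\<^sub>M A) (\<lambda>\<omega>. \<omega> t))"
      by (rule integral_distr[OF cm gm, symmetric])
    also have "\<dots> = (\<integral>z. g z \<partial>distr (state_law p \<mu> F t) (S \<Otimes>\<^sub>M A) (\<lambda>x. (x, F t x)))"
      by (rule arg_cong[where f="\<lambda>M. integral\<^sup>L M g"]) (rule distr_P_coordinate[where F=F, OF \<pi> F \<pi>F])
    also have "\<dots> = (\<integral>x. g (x, F t x) \<partial>state_law p \<mu> F t)"
      by (rule integral_distr[OF Fl gm])
    also have "\<dots> = (\<integral>x. r (x, F t x) \<partial>state_law p \<mu> F t)"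
    proof (rule Bochner_Integration.integral_cong[OF refl])
      fix x
      have "F t xb \<in> Av xb" using F[of t] xb_state by (simp add: selectors_def)
      then show "g (x, F t x) = r (x, F t x)" using xb_absorbing(1) by (auto simp: g_def)
    qed
    finally show "(\<integral>\<omega>. g (\<omega> t) \<partial>P \<pi>) = (\<integral>x. r (x, F t x) \<partial>state_law p \<mu> F t)" .
  qed
  finally show ?thesis .
qed

end
end

section \<open>The weight function of a uniformly absorbing process\<close>

context absorbing_MDP
begin

lemma selector_law_in: "(\<And>t. F t \<in> selectors S A Av) \<Longrightarrow> state_law p \<mu> F n \<in> space (prob_algebra S)"
  by (rule state_law_in_prob_algebra[OF transition initial]) (simp add: selectors_def)

definition tail_sup :: "nat \<Rightarrow> ennreal" where
  "tail_sup n = (SUP \<pi>\<in>nonrandomized_Markov_policies.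
        \<integral>\<^sup>+\<omega>. (\<Sum>t. if enat (n + t) < hitting_time xb \<omega> then 1 else 0) \<partial>P \<pi>)"

lemma tail_sup_law:
  assumes F: "\<And>t. F t \<in> selectors S A Av"
  shows "(\<Sum>t. \<integral>\<^sup>+x. indicator (- {xb}) x \<partial>state_law p \<mu> F (n + t)) \<le> tail_sup n"
proof -
  have nm: "selector_policy F \<in> nonrandomized_Markov_policies" by (rule selector_policy_policies[OF F])
  then have pol: "selector_policy F \<in> policies" by (simp add: nonrandomized_Markov_policies_def)
  have "(\<Sum>t. \<integral>\<^sup>+x. indicator (- {xb}) x \<partial>state_law p \<mu> F (n + t))
      = (\<integral>\<^sup>+\<omega>. (\<Sum>t. if enat (n + t) < hitting_time xb \<omega> then 1 else 0) \<partial>P (selector_policy F))"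
    by (rule tail_law[where F=F, OF pol F, symmetric]) (simp add: selector_policy_def)
  also have "\<dots> \<le> tail_sup n" unfolding tail_sup_def by (rule SUP_upper[OF nm])
  finally show ?thesis .
qed

context
  fixes \<phi>0 \<phi>1 :: "'x \<Rightarrow> 'a"
  assumes \<phi>: "\<phi>0 \<in> selectors S A Av" "\<phi>1 \<in> selectors S A Av"
begin

text \<open>The maximal expected number of the next \<open>k\<close> steps spent off \<open>xb\<close>, over all Markov policies using the two
  given selectors.\<close>

primrec max_stay :: "nat \<Rightarrow> 'x \<Rightarrow> ennreal" where
  "max_stay 0 = (\<lambda>x. 0)"
| "max_stay (Suc k) = (\<lambda>x. indicator (- {xb}) x +
     max (\<integral>\<^sup>+y. max_stay k y \<partial>p (x, \<phi>0 x)) (\<integral>\<^sup>+y. max_stay k y \<partial>p (x, \<phi>1 x)))"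

abbreviation choices :: "('x \<Rightarrow> 'a) set" where
  "choices \<equiv> selectors S A (\<lambda>x. {\<phi>0 x, \<phi>1 x})"

lemma choices_selectors: "f \<in> choices \<Longrightarrow> f \<in> selectors S A Av"
  using \<phi> by (auto simp: selectors_def)

lemma \<phi>_measurable: "\<phi>0 \<in> S \<rightarrow>\<^sub>M A" "\<phi>1 \<in> S \<rightarrow>\<^sub>M A"
  using \<phi> by (auto simp: selectors_def)

lemma p_nn_integral_measurable:
  "f \<in> S \<rightarrow>\<^sub>M A \<Longrightarrow> g \<in> borel_measurable S \<Longrightarrow> (\<lambda>x. \<integral>\<^sup>+y. g y \<partial>p (x, f x)) \<in> borel_measurable S"
  by (rule measurable_compose[OF measurable_prob_algebraD[OF kernel_selector_measurable[OF transition]]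
        nn_integral_measurable_subprob_algebra])

lemma max_stay_measurable: "max_stay k \<in> borel_measurable S"
proof (induction k)
  case (Suc k)
  show ?case
    unfolding max_stay.simps
    by (intro borel_measurable_add borel_measurable_max p_nn_integral_measurable \<phi>_measurable Suc
        indicator_compl_singleton_measurable(2)[OF xb_in_sets])
qed simp

lemma max_stay_Suc_mono: "max_stay k x \<le> max_stay (Suc k) x"
proof (induction k arbitrary: x)
  case (Suc k)
  show ?case
    unfolding max_stay.simps(2)[of "Suc k"] max_stay.simps(2)[of k]
    by (intro add_left_mono max.mono nn_integral_mono Suc[unfolded max_stay.simps(2)])
qed simp

lemma max_stay_incseq: "incseq max_stay"
  by (intro incseq_SucI le_funI max_stay_Suc_mono)

definition max_total_stay :: "'x \<Rightarrow> ennreal" where "max_total_stay x = (SUP k. max_stay k x)"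

lemma max_total_stay_measurable: "max_total_stay \<in> borel_measurable S"
  unfolding max_total_stay_def[abs_def] using max_stay_measurable by (intro borel_measurable_SUP) auto

text \<open>By monotone convergence the supremum over the horizons satisfies the optimality equation;
  one inequality of it is the drift condition for the weight.\<close>

lemma max_total_stay_drift:
  assumes x: "x \<in> space S" and f: "f \<in> choices"
  shows "indicator (- {xb}) x + (\<integral>\<^sup>+y. max_total_stay y \<partial>p (x, f x)) \<le> max_total_stay x"
proof -
  have fm: "f \<in> S \<rightarrow>\<^sub>M A" using f by (simp add: selectors_def)
  have "sets (p (x, f x)) = sets S"
    using measurable_space[OF kernel_selector_measurable[OF transition fm] x] by (simp add: space_prob_algebra)
  then have m: "max_stay k \<in> borel_measurable (p (x, f x))" for k
    using max_stay_measurable by (simp only: measurable_cong_sets[of "p (x, f x)" S])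
  have "indicator (- {xb}) x + (\<integral>\<^sup>+y. max_total_stay y \<partial>p (x, f x)) = indicator (- {xb}) x + (SUP k. \<integral>\<^sup>+y. max_stay k y \<partial>p (x, f x))"
    unfolding max_total_stay_def by (subst nn_integral_monotone_convergence_SUP[OF max_stay_incseq m]) simp
  also have "\<dots> = (SUP k. indicator (- {xb}) x + (\<integral>\<^sup>+y. max_stay k y \<partial>p (x, f x)))"
    by (rule ennreal_SUP_add_right) simp
  also have "\<dots> \<le> max_total_stay x"
    unfolding max_total_stay_def
  proof (rule SUP_least)
    fix k
    have "indicator (- {xb}) x + (\<integral>\<^sup>+y. max_stay k y \<partial>p (x, f x)) \<le> max_stay (Suc k) x"
      using f x unfolding max_stay.simps by (intro add_left_mono) (auto simp: selectors_def)
    also have "\<dots> \<le> (SUP k. max_stay k x)" by (rule SUP_upper) simp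
    finally show "indicator (- {xb}) x + (\<integral>\<^sup>+y. max_stay k y \<partial>p (x, f x)) \<le> (SUP k. max_stay k x)" .
  qed
  finally show ?thesis .
qed

text \<open>Following \<open>F\<close> up to time \<open>n\<close> and afterwards the greedy choices for the remaining horizon
  is itself a Markov policy. This is where nonstationary policies enter, and how
  uniform absorption bounds the weight.\<close>

lemma max_stay_law:
  assumes "\<And>i. F i \<in> choices"
  shows "\<exists>F'. (\<forall>i. F' i \<in> choices) \<and> (\<forall>i<n. F' i = F i) \<and>
    (\<integral>\<^sup>+x. max_stay k x \<partial>state_law p \<mu> F n) \<le> (\<Sum>t<k. \<integral>\<^sup>+x. indicator (- {xb}) x \<partial>state_law p \<mu> F' (n + t))"
  using assms
proof (induction k arbitrary: n F)
  case 0
  then show ?case by (intro exI[of _ F]) simp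
next
  case (Suc k)
  define best where "best x = (if (\<integral>\<^sup>+y. max_stay k y \<partial>p (x, \<phi>1 x)) \<le> (\<integral>\<^sup>+y. max_stay k y \<partial>p (x, \<phi>0 x)) then \<phi>0 x else \<phi>1 x)" for x
  have best: "best \<in> choices"
  proof -
    note [measurable] = \<phi>_measurable p_nn_integral_measurable[OF \<phi>_measurable(1) max_stay_measurable]
      p_nn_integral_measurable[OF \<phi>_measurable(2) max_stay_measurable]
    have "best \<in> S \<rightarrow>\<^sub>M A" unfolding best_def[abs_def] by measurable
    then show ?thesis by (auto simp: selectors_def best_def)
  qed
  \<comment> \<open>greedy at time \<open>n\<close>; the induction hypothesis continues from time \<open>n + 1\<close>\<close>
  define F1 where "F1 = F(n := best)"
  have F1: "F1 i \<in> choices" for i using Suc(2) best by (simp add: F1_def)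
  then have F1v: "F1 i \<in> selectors S A Av" for i by (rule choices_selectors)
  have eq: "state_law p \<mu> F1 n = state_law p \<mu> F n" by (rule state_law_cong) (simp add: F1_def)
  from Suc.IH[where F=F1 and n="Suc n", OF F1] obtain F' where F': "\<And>i. F' i \<in> choices" "\<And>i. i < Suc n \<Longrightarrow> F' i = F1 i"
    "(\<integral>\<^sup>+x. max_stay k x \<partial>state_law p \<mu> F1 (Suc n)) \<le> (\<Sum>t<k. \<integral>\<^sup>+x. indicator (- {xb}) x \<partial>state_law p \<mu> F' (Suc n + t))"
    by blast
  have eq': "state_law p \<mu> F' n = state_law p \<mu> F1 n" by (rule state_law_cong) (simp add: F'(2))
  have sl: "sets (state_law p \<mu> F n) = sets S"
    using selector_law_in[where F=F1 and n=n, OF F1v]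
    by (simp add: eq space_prob_algebra)
  have "(\<integral>\<^sup>+x. max_stay (Suc k) x \<partial>state_law p \<mu> F n)
      = (\<integral>\<^sup>+x. indicator (- {xb}) x + (\<integral>\<^sup>+y. max_stay k y \<partial>p (x, F1 n x)) \<partial>state_law p \<mu> F n)"
    by (intro nn_integral_cong) (auto simp: best_def F1_def max_def)
  also have "\<dots> = (\<integral>\<^sup>+x. indicator (- {xb}) x \<partial>state_law p \<mu> F n) + (\<integral>\<^sup>+x. \<integral>\<^sup>+y. max_stay k y \<partial>p (x, F1 n x) \<partial>state_law p \<mu> F n)"
  proof (rule nn_integral_add)
    show "(indicator (- {xb}) :: 'x \<Rightarrow> ennreal) \<in> borel_measurable (state_law p \<mu> F n)"
      unfolding measurable_cong_sets[OF sl refl] by (rule indicator_compl_singleton_measurable(2)[OF xb_in_sets])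
    have "F1 n \<in> S \<rightarrow>\<^sub>M A" using F1[of n] by (simp add: selectors_def)
    then show "(\<lambda>x. \<integral>\<^sup>+y. max_stay k y \<partial>p (x, F1 n x)) \<in> borel_measurable (state_law p \<mu> F n)"
      unfolding measurable_cong_sets[OF sl refl] by (rule p_nn_integral_measurable[OF _ max_stay_measurable])
  qed
  also have "(\<integral>\<^sup>+x. \<integral>\<^sup>+y. max_stay k y \<partial>p (x, F1 n x) \<partial>state_law p \<mu> F n) = (\<integral>\<^sup>+x. max_stay k x \<partial>state_law p \<mu> F1 (Suc n))"
    using state_law_Suc_nn_integral[where F=F1 and n=n, OF transition initial _ max_stay_measurable[of k]] F1
    by (simp add: eq selectors_def)
  also have "(\<integral>\<^sup>+x. indicator (- {xb}) x \<partial>state_law p \<mu> F n) + (\<integral>\<^sup>+x. max_stay k x \<partial>state_law p \<mu> F1 (Suc n))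
      \<le> (\<integral>\<^sup>+x. indicator (- {xb}) x \<partial>state_law p \<mu> F' n) + (\<Sum>t<k. \<integral>\<^sup>+x. indicator (- {xb}) x \<partial>state_law p \<mu> F' (Suc n + t))"
    unfolding eq' eq by (intro add_left_mono F'(3))
  also have "\<dots> = (\<Sum>t<Suc k. \<integral>\<^sup>+x. indicator (- {xb}) x \<partial>state_law p \<mu> F' (n + t))"
    by (subst sum.lessThan_Suc_shift) simp
  finally show ?case using F'(1,2) by (intro exI[of _ F']) (auto simp: F1_def)
qed

lemma max_total_stay_law_le:
  assumes F: "\<And>i. F i \<in> choices" and le: "\<And>k. (\<integral>\<^sup>+x. max_stay k x \<partial>state_law p \<mu> F n) \<le> c"
  shows "(\<integral>\<^sup>+x. max_total_stay x \<partial>state_law p \<mu> F n) \<le> c"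
proof -
  have Fv: "F i \<in> selectors S A Av" for i using F by (rule choices_selectors)
  have sl: "sets (state_law p \<mu> F n) = sets S"
    using selector_law_in[where F=F and n=n, OF Fv]
    by (simp add: space_prob_algebra)
  have m: "max_stay k \<in> borel_measurable (state_law p \<mu> F n)" for k
    unfolding measurable_cong_sets[OF sl refl] by (rule max_stay_measurable)
  show ?thesis
    unfolding max_total_stay_def nn_integral_monotone_convergence_SUP[OF max_stay_incseq m] by (rule SUP_least) (rule le)
qed

lemma max_total_stay_law_tail:
  assumes F: "\<And>i. F i \<in> choices"
  shows "(\<integral>\<^sup>+x. max_total_stay x \<partial>state_law p \<mu> F n) \<le> tail_sup n"
proof (rule max_total_stay_law_le[where F=F, OF F])
  fix k
  obtain F' where F': "\<And>i. F' i \<in> choices" and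
    le: "(\<integral>\<^sup>+x. max_stay k x \<partial>state_law p \<mu> F n) \<le> (\<Sum>t<k. \<integral>\<^sup>+x. indicator (- {xb}) x \<partial>state_law p \<mu> F' (n + t))"
    using max_stay_law[where F=F, OF F] by blast
  note le
  also have "\<dots> \<le> (\<Sum>t. \<integral>\<^sup>+x. indicator (- {xb}) x \<partial>state_law p \<mu> F' (n + t))" by (rule sum_le_suminf) auto
  also have "\<dots> \<le> tail_sup n" by (rule tail_sup_law[where F=F', OF choices_selectors[OF F']])
  finally show "(\<integral>\<^sup>+x. max_stay k x \<partial>state_law p \<mu> F n) \<le> tail_sup n" .
qed

text \<open>Before the tails drop below \<open>1\<close>, each of the \<open>N\<close> steps contributes at most \<open>1\<close>. This makes the expected
  weight finite at all times.\<close>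

lemma max_total_stay_law_bound:
  assumes F: "\<And>i. F i \<in> choices" and N: "tail_sup (n + N) \<le> 1"
  shows "(\<integral>\<^sup>+x. max_total_stay x \<partial>state_law p \<mu> F n) \<le> of_nat N + 1"
proof (rule max_total_stay_law_le[where F=F, OF F])
  fix k
  obtain F' where F': "\<And>i. F' i \<in> choices" and
    le: "(\<integral>\<^sup>+x. max_stay k x \<partial>state_law p \<mu> F n) \<le> (\<Sum>t<k. \<integral>\<^sup>+x. indicator (- {xb}) x \<partial>state_law p \<mu> F' (n + t))"
    using max_stay_law[where F=F, OF F] by blast
  define e where "e t = (\<integral>\<^sup>+x. indicator (- {xb}) x \<partial>state_law p \<mu> F' t)" for t
  have F'v: "F' i \<in> selectors S A Av" for i using F' by (rule choices_selectors)
  have e1: "e t \<le> 1" for t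
  proof -
    interpret prob_space "state_law p \<mu> F' t"
      using selector_law_in[where F=F' and n=t, OF F'v] by (simp add: space_prob_algebra)
    have "e t \<le> (\<integral>\<^sup>+x. 1 \<partial>state_law p \<mu> F' t)"
      unfolding e_def by (intro nn_integral_mono) (auto split: split_indicator)
    then show ?thesis by (simp add: emeasure_space_1)
  qed
  have "(\<Sum>t<k. e (n + t)) \<le> (\<Sum>t<N + k. e (n + t))" by (rule sum_mono2) auto
  also have "\<dots> = (\<Sum>t<N. e (n + t)) + (\<Sum>t<k. e (n + N + t))"
    by (induction k) (auto simp: add.assoc)
  also have "\<dots> \<le> of_nat N + 1"
  proof (rule add_mono)
    have "(\<Sum>t<N. e (n + t)) \<le> (\<Sum>t<N. 1)" using e1 by (rule sum_mono)
    then show "(\<Sum>t<N. e (n + t)) \<le> of_nat N" by simp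
    have "(\<Sum>t<k. e (n + N + t)) \<le> (\<Sum>t. e (n + N + t))" by (rule sum_le_suminf) auto
    also have "\<dots> \<le> tail_sup (n + N)" unfolding e_def by (rule tail_sup_law[where F=F', OF F'v])
    finally show "(\<Sum>t<k. e (n + N + t)) \<le> 1" using N by (rule order_trans)
  qed
  finally show "(\<integral>\<^sup>+x. max_stay k x \<partial>state_law p \<mu> F n) \<le> of_nat N + 1"
    using le unfolding e_def by (rule order_trans[rotated])
qed

end
end

locale uniformly_absorbing_atomless_MDP = uniformly_absorbing_MDP S A Av p \<mu> r xb + atomless_MDP S A Av p \<mu> r xb
  for S :: "'x measure" and A :: "'a measure" and Av p \<mu> and r :: "'x \<times> 'a \<Rightarrow> real ^ 'n" and xb
begin

lemma tail_sup_tendsto: "tail_sup \<longlonglongrightarrow> 0"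
  using uniformly_absorbing unfolding tail_sup_def .

text \<open>The weight is the maximal expected absorption time, made real valued. Its expectation
  at time \<open>n\<close> is bounded by the tail in the definition of uniform absorption.\<close>

lemma weighted_control_pair:
  assumes \<phi>: "\<phi>0 \<in> selectors S A Av" "\<phi>1 \<in> selectors S A Av"
  shows "\<exists>G w K u U. weighted_control S A p \<mu> r (\<lambda>x. {\<phi>0 x, \<phi>1 x}) xb G w K u U"
proof -
  let ?T = "max_total_stay \<phi>0 \<phi>1" and ?Act = "\<lambda>x. {\<phi>0 x, \<phi>1 x}"
  have sel0: "\<phi>0 \<in> selectors S A ?Act" "\<phi>1 \<in> selectors S A ?Act"
    using \<phi> by (auto simp: selectors_def)
  have Tm[measurable]: "?T \<in> borel_measurable S" by (rule max_total_stay_measurable[OF \<phi>])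
  obtain N where N: "\<And>n. N \<le> n \<Longrightarrow> tail_sup n \<le> 1"
    using order_tendstoD(2)[OF tail_sup_tendsto, of 1] by (auto simp: eventually_sequentially intro: less_imp_le)
  \<comment> \<open>the minimum keeps the sequence finite where the tails may be infinite\<close>
  define v where "v n = min (tail_sup n) (of_nat N + 1)" for n
  have vtop: "v n \<noteq> top" for n by (auto simp: v_def min_def top_unique)
  have Tv: "(\<integral>\<^sup>+x. ?T x \<partial>state_law p \<mu> F n) \<le> v n" if F: "\<And>i. F i \<in> selectors S A ?Act" for F n
    unfolding v_def using max_total_stay_law_tail[where F=F, OF \<phi> F] max_total_stay_law_bound[where F=F and n=n and N=N, OF \<phi> F] N by simp
  define w where "w x = enn2real (?T x)" for x
  define G where "G = {x \<in> space S. ?T x < \<infinity>}"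
  define u where "u n = enn2real (v n)" for n
  have wT: "ennreal (w x) \<le> ?T x" for x unfolding w_def by (cases "?T x") auto
  obtain K where K: "0 \<le> K" "\<And>z. z \<in> space (S \<Otimes>\<^sub>M A) \<Longrightarrow> norm (r z) \<le> K"
    using reward_bounded unfolding bounded_pos by (auto intro: less_imp_le)
  obtain U :: "'x \<Rightarrow> real" where U: "U \<in> borel_measurable S" "inj_on U (space S)" "\<And>x. 0 \<le> U x" "\<And>x. U x < 1"
    using standard_borel_embedding[OF standard_borel_S] by blast
  have Av: "a \<in> Av x" "a \<in> space A" if "x \<in> space S" "a \<in> ?Act x" for x a
    using that \<phi> measurable_space[of _ S A x] by (auto simp: selectors_def)
  have kern: "prob_space (p (x, a))" "sets (p (x, a)) = sets S" if "x \<in> space S" "a \<in> ?Act x" for x a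
  proof -
    have "(x, a) \<in> space (S \<Otimes>\<^sub>M A)" using that(1) Av[OF that] by (simp add: space_pair_measure)
    from measurable_space[OF transition this]
    show "prob_space (p (x, a))" "sets (p (x, a)) = sets S" by (auto simp: space_prob_algebra)
  qed
  have Tdrift: "indicator (- {xb}) x + (\<integral>\<^sup>+y. ?T y \<partial>p (x, a)) \<le> ?T x" if "x \<in> space S" "a \<in> ?Act x" for x a
    using max_total_stay_drift[OF \<phi> that(1) sel0(1)] max_total_stay_drift[OF \<phi> that(1) sel0(2)] that(2) by auto
  have TAE: "AE y in p (x, a). y \<in> G" if x: "x \<in> G" and a: "a \<in> ?Act x" for x a
  proof -
    have xS: "x \<in> space S" using x by (simp add: G_def)
    have "(\<integral>\<^sup>+y. ?T y \<partial>p (x, a)) \<le> ?T x"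
      using Tdrift[OF xS a] by (rule order_trans[rotated]) simp
    then have "(\<integral>\<^sup>+y. ?T y \<partial>p (x, a)) \<noteq> \<infinity>" using x by (auto simp: G_def top_unique)
    moreover have "?T \<in> borel_measurable (p (x, a))"
      unfolding measurable_cong_sets[OF kern(2)[OF xS a] refl] by (rule Tm)
    ultimately have "AE y in p (x, a). ?T y \<noteq> \<infinity>" by (intro nn_integral_PInf_AE)
    then show ?thesis using AE_space
      by eventually_elim (use sets_eq_imp_space_eq[OF kern(2)[OF xS a]] in \<open>auto simp: G_def less_top\<close>)
  qed
  have init: "prob_space \<mu>" "sets \<mu> = sets S" using initial by (auto simp: space_prob_algebra)
  have "weighted_control S A p \<mu> r ?Act xb G w K u U"
  proof (rule weighted_control.intro)
    show "p \<in> S \<Otimes>\<^sub>M A \<rightarrow>\<^sub>M prob_algebra S" "\<mu> \<in> space (prob_algebra S)" "r \<in> borel_measurable (S \<Otimes>\<^sub>M A)"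
      by (rule transition initial reward_measurable)+
    show "{xb} \<in> sets S" by (rule xb_in_sets)
    show "0 \<le> K" by (rule K)
    show "norm (r (x, a)) \<le> K * indicator (- {xb}) x" if "x \<in> space S" "a \<in> ?Act x" for x a
      using K(2)[of "(x, a)"] that Av[OF that] xb_absorbing(1)[of a]
      by (auto simp: space_pair_measure split: split_indicator)
    show "a = a'" if "a \<in> ?Act xb" "a' \<in> ?Act xb" for a a'
      using Av(1)[OF xb_state that(1)] Av(1)[OF xb_state that(2)] absorbing_xb by auto
    show "G \<in> sets S" unfolding G_def by measurable
    show "w \<in> borel_measurable S" unfolding w_def by measurable
    show "0 \<le> w x" for x by (simp add: w_def)
    show "AE y in p (x, a). y \<in> G" if "x \<in> G" "a \<in> ?Act x" for x a by (rule TAE[OF that])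
    show "ennreal (indicator (- {xb}) x) + (\<integral>\<^sup>+y. ennreal (w y) \<partial>p (x, a)) \<le> ennreal (w x)"
      if x: "x \<in> G" and a: "a \<in> ?Act x" for x a
    proof -
      have xS: "x \<in> space S" using x by (simp add: G_def)
      have "ennreal (indicator (- {xb}) x) + (\<integral>\<^sup>+y. ennreal (w y) \<partial>p (x, a)) \<le> indicator (- {xb}) x + (\<integral>\<^sup>+y. ?T y \<partial>p (x, a))"
        using wT by (intro add_mono nn_integral_mono) (auto split: split_indicator)
      also have "\<dots> \<le> ?T x" by (rule Tdrift[OF xS a])
      also have "\<dots> = ennreal (w x)" using x by (simp add: w_def G_def)
      finally show ?thesis .
    qed
    show "AE x in \<mu>. x \<in> G"
    proof -
      have "(\<integral>\<^sup>+x. ?T x \<partial>\<mu>) \<le> v 0" using Tv[of "\<lambda>_. \<phi>0" 0] sel0 by simp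
      then have "(\<integral>\<^sup>+x. ?T x \<partial>\<mu>) \<noteq> \<infinity>" using vtop[of 0] by (auto simp: top_unique)
      moreover have "?T \<in> borel_measurable \<mu>" unfolding measurable_cong_sets[OF init(2) refl] by (rule Tm)
      ultimately have "AE y in \<mu>. ?T y \<noteq> \<infinity>" by (intro nn_integral_PInf_AE)
      then show ?thesis using AE_space
        by eventually_elim (use sets_eq_imp_space_eq[OF init(2)] in \<open>auto simp: G_def less_top\<close>)
    qed
    show "0 \<le> u n" for n by (simp add: u_def)
    show "(\<integral>\<^sup>+x. ennreal (w x) \<partial>state_law p \<mu> (\<lambda>_. f) n) \<le> ennreal (u n)" if "f \<in> selectors S A ?Act" for f n
    proof -
      have "(\<integral>\<^sup>+x. ennreal (w x) \<partial>state_law p \<mu> (\<lambda>_. f) n) \<le> (\<integral>\<^sup>+x. ?T x \<partial>state_law p \<mu> (\<lambda>_. f) n)"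
        by (intro nn_integral_mono wT)
      also have "\<dots> \<le> v n" by (rule Tv) (rule that)
      also have "\<dots> = ennreal (u n)" using vtop[of n] by (simp add: u_def less_top)
      finally show ?thesis .
    qed
    show "u \<longlonglongrightarrow> 0"
    proof -
      have "v \<longlonglongrightarrow> min 0 (of_nat N + 1)"
        unfolding v_def[abs_def] by (intro tendsto_min tail_sup_tendsto tendsto_const)
      then have "v \<longlonglongrightarrow> ennreal 0" by simp
      then show ?thesis unfolding u_def[abs_def] by (rule tendsto_enn2real) simp
    qed
    show "emeasure \<mu> {y} = 0" if "y \<in> space S - {xb}" for y by (rule initial_atomless[OF that])
    show "emeasure (p (x, a)) {y} = 0" if "x \<in> space S" "a \<in> ?Act x" "y \<in> space S - {xb}" for x a y
    proof (cases "x = xb")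
      case False
      then show ?thesis using that Av[OF that(1,2)] by (intro transition_atomless) auto
    next
      case True
      have ae: "AE z in p (x, a). z \<noteq> y"
        using xb_absorbing_AE[of a] Av(1)[OF that(1,2)] that(3) unfolding True by (auto elim: eventually_mono)
      have "{y} \<in> sets (p (x, a))"
        using standard_borel_singleton[OF standard_borel_S, of y] that kern(2)[OF that(1,2)] by simp
      moreover have "{z \<in> space (p (x, a)). \<not> z \<noteq> y} = {y}"
        using sets_eq_imp_space_eq[OF kern(2)[OF that(1,2)]] that(3) by auto
      ultimately show ?thesis using AE_iff_measurable[of "{y}" "p (x, a)" "\<lambda>z. z \<noteq> y"] ae by simp
    qed
    show "U \<in> borel_measurable S" "inj_on U (space S)" by fact+
    show "0 \<le> U x \<and> U x < 1" if "x \<in> space S" for x using U by simp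
    show "{x} \<in> sets S" if "x \<in> space S" for x by (rule standard_borel_singleton[OF standard_borel_S that])
  qed
  then show ?thesis by blast
qed

text \<open>The weight for the pair \<open>(f, f)\<close> supplies the finite expected absorption time.\<close>

lemma performance_selector:
  assumes f: "f \<in> selectors S A Av"
    and \<pi>: "\<pi> \<in> policies" "\<And>t h x. (h, x) \<in> space (hist t) \<Longrightarrow> \<pi> t (h, x) = return A (f x)"
  shows "performance \<pi> = (\<Sum>t. \<integral>x. r (x, f x) \<partial>state_law p \<mu> (\<lambda>_. f) t)"
proof (rule performance_law[where F="\<lambda>_. f", OF \<pi>(1)])
  let ?c = "\<lambda>x. {f x, f x}"
  have fc: "f \<in> selectors S A ?c" using f by (auto simp: selectors_def)
  obtain G w K u U where wc: "weighted_control S A p \<mu> r ?c xb G w K u U"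
    using weighted_control_pair[OF f f] by blast
  interpret W: weighted_control S A p \<mu> r ?c xb G w K u U by fact
  have l: "(\<integral>\<^sup>+x. indicator (- {xb}) x \<partial>W.law f t) = ennreal (\<integral>x. indicator (- {xb}) x \<partial>W.law f t)" for t
  proof -
    have "W.weight_bounded 1 (indicator (- {xb}))"
      using W.live_measurable fc by (intro W.weight_bounded_live) (auto split: split_indicator)
    from W.law_weight_bounded(1)[OF this fc] show ?thesis
      by (subst nn_integral_eq_integral[symmetric]) (auto simp: ennreal_indicator)
  qed
  have "(\<Sum>t. \<integral>\<^sup>+x. indicator (- {xb}) x \<partial>W.law f t) = ennreal (\<Sum>t. \<integral>x. indicator (- {xb}) x \<partial>W.law f t)"
    unfolding l using W.live_summable(1)[OF fc, of 0] by (intro suminf_ennreal2) (auto intro: integral_nonneg_AE)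
  then show "(\<Sum>t. \<integral>\<^sup>+x. indicator (- {xb}) x \<partial>state_law p \<mu> (\<lambda>_. f) t) < \<infinity>" by simp
qed (use f \<pi> in auto)

lemma deterministic_performance_set_eq:
  "deterministic_performance_set = (\<lambda>f. \<Sum>t. \<integral>x. r (x, f x) \<partial>state_law p \<mu> (\<lambda>_. f) t) ` selectors S A Av"
proof (intro set_eqI iffI)
  fix v assume "v \<in> deterministic_performance_set"
  then obtain \<pi> where \<pi>: "\<pi> \<in> deterministic_policies" "v = performance \<pi>"
    by (auto simp: deterministic_performance_set_def)
  then obtain f where f: "f \<in> selectors S A Av"
    "\<And>t h x. (h, x) \<in> space (hist t) \<Longrightarrow> \<pi> t (h, x) = return A (f x)"
    unfolding deterministic_policies_iff_selector by (fastforce simp: selectors_def)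
  have "\<pi> \<in> policies" using \<pi>(1) by (simp add: deterministic_policies_def)
  from performance_selector[OF f(1) this f(2)] f(1) \<pi>(2)
  show "v \<in> (\<lambda>f. \<Sum>t. \<integral>x. r (x, f x) \<partial>state_law p \<mu> (\<lambda>_. f) t) ` selectors S A Av" by blast
next
  fix v assume "v \<in> (\<lambda>f. \<Sum>t. \<integral>x. r (x, f x) \<partial>state_law p \<mu> (\<lambda>_. f) t) ` selectors S A Av"
  then obtain f where f: "f \<in> selectors S A Av" and v: "v = (\<Sum>t. \<integral>x. r (x, f x) \<partial>state_law p \<mu> (\<lambda>_. f) t)" by blast
  let ?\<pi> = "selector_policy (\<lambda>_. f)"
  have "?\<pi> \<in> deterministic_policies"
    unfolding deterministic_policies_iff_selector using f
    by (intro bexI[of _ f]) (auto simp: selectors_def selector_policy_def)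
  moreover have "performance ?\<pi> = v"
    unfolding v using f selector_policy_policies[of "\<lambda>_. f"]
    by (intro performance_selector) (auto simp: nonrandomized_Markov_policies_def selector_policy_def)
  ultimately show "v \<in> deterministic_performance_set" by (auto simp: deterministic_performance_set_def)
qed

lemma convex_deterministic_performance_set: "convex deterministic_performance_set"
proof (rule convexI)
  fix v0 v1 and s t :: real
  assume v: "v0 \<in> deterministic_performance_set" "v1 \<in> deterministic_performance_set"
    and st: "0 \<le> s" "0 \<le> t" "s + t = 1"
  obtain f0 f1 where f: "f0 \<in> selectors S A Av" "f1 \<in> selectors S A Av"
    and v_eq: "v0 = (\<Sum>t. \<integral>x. r (x, f0 x) \<partial>state_law p \<mu> (\<lambda>_. f0) t)"
      "v1 = (\<Sum>t. \<integral>x. r (x, f1 x) \<partial>state_law p \<mu> (\<lambda>_. f1) t)"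
    using v unfolding deterministic_performance_set_eq by blast
  let ?Act = "\<lambda>x. {f0 x, f1 x}"
  obtain G w K u U where "weighted_control S A p \<mu> r ?Act xb G w K u U"
    using weighted_control_pair[OF f] by blast
  then interpret W: weighted_control S A p \<mu> r ?Act xb G w K u U .
  have b: "f0 \<in> selectors S A ?Act" "f1 \<in> selectors S A ?Act" using f by (auto simp: selectors_def)
  have "v0 \<in> W.perf ` selectors S A ?Act" "v1 \<in> W.perf ` selectors S A ?Act"
    using b v_eq unfolding W.perf_def by blast+
  then have "s *\<^sub>R v0 + t *\<^sub>R v1 \<in> convex hull (W.perf ` selectors S A ?Act)"
    by (intro convexD[OF convex_convex_hull] hull_inc st)
  then obtain g where g: "g \<in> selectors S A ?Act" "s *\<^sub>R v0 + t *\<^sub>R v1 = W.perf g"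
    using W.perf_between_convex_hull[OF b] by blast
  have "g \<in> selectors S A Av" using g(1) f by (auto simp: selectors_def)
  then show "s *\<^sub>R v0 + t *\<^sub>R v1 \<in> deterministic_performance_set"
    unfolding deterministic_performance_set_eq g(2) W.perf_def by blast
qed

end

theorem corollary3p10:
  fixes S :: "'x measure" and A :: "'a measure" and Av :: "'x \<Rightarrow> 'a set"
    and p :: "'x \<times> 'a \<Rightarrow> 'x measure" and \<mu> :: "'x measure"
    and r :: "'x \<times> 'a \<Rightarrow> real ^ 'n" and xb :: 'x
  assumes "uniformly_absorbing_MDP S A Av p \<mu> r xb"
    and "atomless_MDP S A Av p \<mu> r xb"
  shows "convex (absorbing_MDP.deterministic_performance_set S A Av p \<mu> r xb)"
proof -
  interpret uniformly_absorbing_atomless_MDP S A Av p \<mu> r xb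
    using assms by (rule uniformly_absorbing_atomless_MDP.intro)
  show ?thesis by (rule convex_deterministic_performance_set)
qed

end
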